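(* Let $n\ge 2$ and let $M$ be a non-orientable triangulable $(n-1)$-manifold (possibly with boundary). Then $\mathbb{R}^n$ does not contain uncountably many pairwise disjoint subsets each homeomorphic to $M$. *)

theory Defs
  imports "HOL-Analysis.Analysis" "HOL-Homology.Homology" "HOL-Algebra.Generated_Groups"
begin

definition half_space :: "nat \<Rightarrow> (nat \<Rightarrow> real) set" where
  "half_space m = {x \<in> topspace (Euclidean_space m). x 0 \<ge> 0}"

definition manifold_with_boundary :: "nat \<Rightarrow> 'a topology \<Rightarrow> bool" where
  "manifold_with_boundary m M \<longleftrightarrow>
     Hausdorff_space M \<and> second_countable M \<and>
     (\<forall>x \<in> topspace M. \<exists>U V. openin M U \<and> x \<in> U \<and>
        openin (subtopology (Euclidean_space m) (half_space m)) V \<and>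
        subtopology M U homeomorphic_space subtopology (Euclidean_space m) V)"

definition manifold_interior :: "nat \<Rightarrow> 'a topology \<Rightarrow> 'a set" where
  "manifold_interior m M =
     {x \<in> topspace M. \<exists>U V. openin M U \<and> x \<in> U \<and> openin (Euclidean_space m) V \<and>
        subtopology M U homeomorphic_space subtopology (Euclidean_space m) V}"

definition orientable_manifold :: "nat \<Rightarrow> 'a topology \<Rightarrow> bool" where
  "orientable_manifold m N \<longleftrightarrow>
     (\<exists>\<mu>. (\<forall>x \<in> topspace N.
              \<mu> x \<in> carrier (relative_homology_group (int m) N (topspace N - {x})) \<and>
              generate (relative_homology_group (int m) N (topspace N - {x})) {\<mu> x}
                = carrier (relative_homology_group (int m) N (topspace N - {x}))) \<and>
          (\<forall>x \<in> topspace N. \<exists>W c. openin N W \<and> x \<in> W \<and>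
              c \<in> carrier (relative_homology_group (int m) N (topspace N - W)) \<and>
              (\<forall>y \<in> W. hom_induced (int m) N (topspace N - W) N (topspace N - {y}) id c = \<mu> y)))"

definition orientable_mwb :: "nat \<Rightarrow> 'a topology \<Rightarrow> bool" where
  "orientable_mwb m M \<longleftrightarrow> orientable_manifold m (subtopology M (manifold_interior m M))"

definition locally_finite_simplicial_complex :: "'b::euclidean_space set set \<Rightarrow> bool" where
  "locally_finite_simplicial_complex K \<longleftrightarrow>
     (\<forall>S \<in> K. \<exists>d. d simplex S) \<and>
     (\<forall>F S. S \<in> K \<and> F face_of S \<and> F \<noteq> {} \<longrightarrow> F \<in> K) \<and>
     (\<forall>S S'. S \<in> K \<and> S' \<in> K \<longrightarrow> (S \<inter> S') face_of S) \<and>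
     (\<forall>x. \<exists>e>0. finite {S \<in> K. S \<inter> ball x e \<noteq> {}})"

definition triangulates :: "'b::euclidean_space set set \<Rightarrow> 'a topology \<Rightarrow> bool" where
  "triangulates K M \<longleftrightarrow> locally_finite_simplicial_complex K \<and>
     M homeomorphic_space subtopology euclidean (\<Union>K)"

end

(* Put m = n - 1.  Among uncountably many embeddings of a second countable space X into R^n, one, f, is
   a locally uniform limit of others, g_1, g_2, ..., and all their images are disjoint.  Suppose that g
   is close to f near a point x, and let D be a small m-disc around x.  The maps y -> f y - g x and
   y -> g y - f x of D into R^n - 0 agree on the boundary of D after a small deformation (both become
   y -> f y - f x), so they define a map of the double of D, an m-sphere, into R^n - 0.  Moving x to the
   point opposite to y turns it into an odd map, whose degree is odd by Borsuk's theorem.  The degree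
   changes sign with the orientation of D and is locally constant in x, so its sign orients X near every
   point where g is close enough to f.  A diagonal subsequence of the g_j makes these local
   orientations agree in the limit on all of X.  Applied to the interior of M, this shows that M is
   orientable. *)
theory Submission
  imports Defs "HOL-Library.Diagonal_Subsequence"
begin

text \<open>The two directions make sense at y = x because f and g have disjoint images. A cutoff at
  a radius r makes them agree away from x, without ever producing the zero vector if g is closer to
  f than r. Nothing is glued: the difference of two chain maps is applied to a chain whose boundary
  lies where the maps agree. No single g need be close to f on all of X, which may be noncompact. So
  each chart has its own radius and its own compact set on which closeness is required, and
  statements about the g_j hold from some index on. The degrees may be unbounded in j; only their
  signs can be made to converge, and the diagonal argument needs countably many charts. The chains
  of two charts that meet in a point are cycles relative to different sets. To compare them there,
  the radius is shrunk until both chains, and a homology between them, can be read relative to the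
  complement of a small ball; shrinking leaves the degree unchanged. The nonzero degree then also
  forces the factor between the two local classes to be a unit.\<close>

section \<open>Relative homology classes represented by chains\<close>

lemma homologous_rel_set_add:
  assumes "singular_relcycle p X S a" "singular_relcycle p X S b"
  shows "homologous_rel_set p X S (a + b)
       = homologous_rel_set p X S a \<otimes>\<^bsub>relative_homology_group (int p) X S\<^esub> homologous_rel_set p X S b"
proof -
  have "(#>\<^bsub>relcycle_group p X S\<^esub>) (singular_relboundary_set p X S)
      \<in> hom (relcycle_group p X S) (relative_homology_group (int p) X S)"
    by (simp add: nontrivial_relative_homology_group normal.r_coset_hom_Mod
        normal_subgroup_singular_relboundary_relcycle)
  then show ?thesis
    using assms by (simp add: hom_def right_coset_singular_relboundary)
qed

lemma homologous_rel_set_in_carrier: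
  "singular_relcycle p X S c \<Longrightarrow> homologous_rel_set p X S c \<in> carrier (relative_homology_group (int p) X S)"
  by (auto simp: carrier_relative_homology_group)

lemma homologous_rel_set_cmul:
  assumes c: "singular_relcycle p X S c"
  shows "homologous_rel_set p X S (frag_cmul k c)
       = homologous_rel_set p X S c [^]\<^bsub>relative_homology_group (int p) X S\<^esub> (k::int)"
proof -
  let ?G = "relative_homology_group (int p) X S" and ?cl = "homologous_rel_set p X S"
  interpret group ?G
    by simp
  note car = homologous_rel_set_in_carrier [OF c]
  have nat: "?cl (frag_cmul (int n) c) = ?cl c [^]\<^bsub>?G\<^esub> int n" for n
  proof (induction n)
    case 0
    have "?cl 0 = \<one>\<^bsub>?G\<^esub>"
      by (simp only: one_relative_homology_group homologous_rel_set_eq_relboundary singular_relboundary_0)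
    then show ?case
      by (metis frag_cmul_zero int_ops(1) int_pow_0)
  next
    case (Suc n)
    have "frag_cmul (int (Suc n)) c = frag_cmul (int n) c + c"
      by (simp add: frag_cmul_distrib add.commute)
    then show ?case
      using Suc car by (simp only: homologous_rel_set_add [OF singular_relcycle_cmul [OF c] c] int_pow_int nat_pow_Suc)
  qed
  show ?thesis
  proof (cases k)
    case (nonneg n)
    then show ?thesis by (simp only: nat)
  next
    case (neg n)
    have cyc: "singular_relcycle p X S (frag_cmul j c)" for j
      by (simp add: c singular_relcycle_cmul)
    \<comment> \<open>Here \<open>k\<close> is \<open>- int (Suc n)\<close>: a negative multiple is
      recognised as the inverse of the positive one, since the two chains add up to 0.\<close>
    have "?cl (frag_cmul k c) \<otimes>\<^bsub>?G\<^esub> ?cl (frag_cmul (int (Suc n)) c) = ?cl 0"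
      using neg homologous_rel_set_add [OF cyc cyc, of k "int (Suc n)"]
      by (simp only: frag_cmul_distrib [symmetric]) simp
    also have "?cl 0 = \<one>\<^bsub>?G\<^esub>"
      by (simp only: one_relative_homology_group homologous_rel_set_eq_relboundary singular_relboundary_0)
    finally have "?cl (frag_cmul k c) = inv\<^bsub>?G\<^esub> (?cl (frag_cmul (int (Suc n)) c))"
      by (metis cyc homologous_rel_set_in_carrier inv_equality)
    then show ?thesis
      using car neg by (simp only: nat int_pow_neg)
  qed
qed

text \<open>Being a generator is expressed by chains, because one and the same chain is later read
  relative to many subsets and in several subspaces, whereas its classes live in different
  groups.\<close>

definition rel_generator :: "nat \<Rightarrow> 'a topology \<Rightarrow> 'a set \<Rightarrow> 'a chain \<Rightarrow> bool"
  where "rel_generator p X S c \<longleftrightarrow> singular_relcycle p X S c \<and>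
           (\<forall>b. singular_relcycle p X S b \<longrightarrow> (\<exists>k. homologous_rel p X S b (frag_cmul k c)))"

lemma rel_generator_restrict [simp]: "rel_generator p X (topspace X \<inter> S) = rel_generator p X S"
  by (auto simp: rel_generator_def fun_eq_iff)

lemma rel_generator_imp_generate:
  assumes "rel_generator p X S c"
  shows "generate (relative_homology_group (int p) X S) {homologous_rel_set p X S c}
       = carrier (relative_homology_group (int p) X S)"
proof -
  interpret group "relative_homology_group (int p) X S"
    by simp
  have c: "singular_relcycle p X S c"
    using assms by (simp add: rel_generator_def)
  show ?thesis
    unfolding generate_pow [OF homologous_rel_set_in_carrier [OF c]]
  proof (intro equalityI subsetI)
    fix x assume "x \<in> carrier (relative_homology_group (int p) X S)"
    then obtain b where b: "singular_relcycle p X S b" "x = homologous_rel_set p X S b"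
      by (auto simp: carrier_relative_homology_group)
    then obtain k where "homologous_rel p X S b (frag_cmul k c)"
      using assms by (auto simp: rel_generator_def)
    then have "x = homologous_rel_set p X S c [^]\<^bsub>relative_homology_group (int p) X S\<^esub> k"
      by (metis b(2) c homologous_rel_set_cmul homologous_rel_set_eq)
    then show "x \<in> {homologous_rel_set p X S c [^]\<^bsub>relative_homology_group (int p) X S\<^esub> (k::int) |k. k \<in> UNIV}"
      by blast
  qed (use int_pow_closed homologous_rel_set_in_carrier [OF c] in auto)
qed

lemma frag_cmul_diff_right: "frag_cmul k (a - b) = frag_cmul k a - frag_cmul k b"
  by (rule poly_mapping_eqI) (simp add: lookup_minus right_diff_distrib)

lemma homologous_rel_cmul:
  "homologous_rel p X S a b \<Longrightarrow> homologous_rel p X S (frag_cmul k a) (frag_cmul k b)"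
  unfolding homologous_rel_def by (metis frag_cmul_diff_right singular_relboundary_cmul)

lemma homologous_rel_chain_map:
  "\<lbrakk>homologous_rel p X S a b; continuous_map X Y f; f \<in> S \<rightarrow> T\<rbrakk>
    \<Longrightarrow> homologous_rel p Y T (chain_map p f a) (chain_map p f b)"
  unfolding homologous_rel_def by (metis chain_map_diff singular_relboundary_chain_map)

lemma homologous_rel_mono:
  "\<lbrakk>homologous_rel p X S a b; S \<subseteq> T\<rbrakk> \<Longrightarrow> homologous_rel p X T a b"
  unfolding homologous_rel_def singular_relboundary by (meson singular_chain_mono)

lemma singular_relcycle_mono:
  "\<lbrakk>singular_relcycle p X S a; S \<subseteq> T\<rbrakk> \<Longrightarrow> singular_relcycle p X T a"
  unfolding singular_relcycle by (meson singular_chain_mono)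

context
  fixes p :: nat and X :: "'a topology" and S and Y :: "'b topology" and T and f
  assumes cf: "continuous_map X Y f" and ST: "f \<in> S \<rightarrow> T"
    and iso: "hom_induced (int p) X S Y T f \<in> iso (relative_homology_group (int p) X S) (relative_homology_group (int p) Y T)"
begin

lemma iso_homologous_rel_chain_map_iff:
  assumes "singular_relcycle p X S a" "singular_relcycle p X S b"
  shows "homologous_rel p Y T (chain_map p f a) (chain_map p f b) \<longleftrightarrow> homologous_rel p X S a b"
proof
  assume "homologous_rel p Y T (chain_map p f a) (chain_map p f b)"
  then have "hom_induced (int p) X S Y T f (homologous_rel_set p X S a)
           = hom_induced (int p) X S Y T f (homologous_rel_set p X S b)"
    using assms by (simp only: hom_induced_chain_map [OF cf ST] homologous_rel_set_eq)
  moreover have "inj_on (hom_induced (int p) X S Y T f) (carrier (relative_homology_group (int p) X S))"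
    using iso by (auto simp: iso_def bij_betw_def)
  ultimately show "homologous_rel p X S a b"
    by (metis assms homologous_rel_set_eq homologous_rel_set_in_carrier inj_onD)
qed (simp add: homologous_rel_chain_map cf ST)

lemma iso_obtain_preimage_chain:
  assumes "singular_relcycle p Y T b"
  obtains a where "singular_relcycle p X S a" "homologous_rel p Y T b (chain_map p f a)"
proof -
  have "homologous_rel_set p Y T b
      \<in> hom_induced (int p) X S Y T f ` carrier (relative_homology_group (int p) X S)"
    using iso homologous_rel_set_in_carrier [OF assms] by (auto simp: iso_def bij_betw_def)
  then obtain a where a: "singular_relcycle p X S a"
      "homologous_rel_set p Y T b = hom_induced (int p) X S Y T f (homologous_rel_set p X S a)"
    by (auto simp: carrier_relative_homology_group)
  then have "homologous_rel p Y T b (chain_map p f a)"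
    by (simp only: hom_induced_chain_map [OF cf ST] homologous_rel_set_eq)
  then show thesis
    using a that by blast
qed

text \<open>Carries the isomorphisms of homology theory over to chains. Both directions occur:
  excision and the sequences of hemispheres push generators forward and pull them back.\<close>

lemma iso_rel_generator_chain_map_iff:
  assumes c: "singular_relcycle p X S c"
  shows "rel_generator p Y T (chain_map p f c) \<longleftrightarrow> rel_generator p X S c"
proof
  assume L: "rel_generator p Y T (chain_map p f c)"
  show "rel_generator p X S c"
    unfolding rel_generator_def
  proof (intro conjI allI impI c)
    fix b assume b: "singular_relcycle p X S b"
    then obtain k where "homologous_rel p Y T (chain_map p f b) (frag_cmul k (chain_map p f c))"
      using L singular_relcycle_chain_map [OF b cf ST] by (auto simp: rel_generator_def)
    then have "homologous_rel p Y T (chain_map p f b) (chain_map p f (frag_cmul k c))"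
      by simp
    then show "\<exists>k. homologous_rel p X S b (frag_cmul k c)"
      using iso_homologous_rel_chain_map_iff b c singular_relcycle_cmul by blast
  qed
next
  assume R: "rel_generator p X S c"
  show "rel_generator p Y T (chain_map p f c)"
    unfolding rel_generator_def
  proof (intro conjI allI impI singular_relcycle_chain_map [OF c cf ST])
    fix b assume "singular_relcycle p Y T b"
    then obtain a where a: "singular_relcycle p X S a" "homologous_rel p Y T b (chain_map p f a)"
      by (rule iso_obtain_preimage_chain)
    then obtain k where "homologous_rel p X S a (frag_cmul k c)"
      using R by (auto simp: rel_generator_def)
    from homologous_rel_chain_map [OF this cf ST] a(2)
    have "homologous_rel p Y T b (frag_cmul k (chain_map p f c))"
      by (metis chain_map_cmul homologous_rel_trans)
    then show "\<exists>k. homologous_rel p Y T b (frag_cmul k (chain_map p f c))" ..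
  qed
qed

end



section \<open>Cycles on a sphere as integers\<close>

lemma homology_group_nsphere_iso_integer:
  assumes "0 < n"
  shows "homology_group (int n) (nsphere n) \<cong> integer_group"
  using reduced_homology_group_nsphere(1) [of n] assms by (simp add: un_reduced_homology_group)

text \<open>The integer represented by an \<open>n\<close>-cycle on the \<open>n\<close>-sphere, up to a global choice of sign.\<close>

definition sphere_class :: "nat \<Rightarrow> (nat \<Rightarrow> real) chain \<Rightarrow> int"
  where "sphere_class n c =
    (SOME h. h \<in> iso (homology_group (int n) (nsphere n)) integer_group) (homologous_rel_set n (nsphere n) {} c)"

context
  fixes n :: nat
  assumes n: "0 < n"
begin

lemma sphere_class_iso:
  obtains h where "h \<in> iso (homology_group (int n) (nsphere n)) integer_group"
    "\<And>c. sphere_class n c = h (homologous_rel_set n (nsphere n) {} c)"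
proof
  show "(SOME h. h \<in> iso (homology_group (int n) (nsphere n)) integer_group)
      \<in> iso (homology_group (int n) (nsphere n)) integer_group"
    using homology_group_nsphere_iso_integer [OF n] unfolding is_iso_def by (simp add: some_in_eq)
qed (simp add: sphere_class_def)

lemma sphere_class_add:
  assumes "singular_relcycle n (nsphere n) {} a" "singular_relcycle n (nsphere n) {} b"
  shows "sphere_class n (a + b) = sphere_class n a + sphere_class n b"
proof -
  obtain h where h: "h \<in> iso (homology_group (int n) (nsphere n)) integer_group"
    "\<And>c. sphere_class n c = h (homologous_rel_set n (nsphere n) {} c)"
    using sphere_class_iso by blast
  then have "h \<in> hom (homology_group (int n) (nsphere n)) integer_group"
    by (simp add: iso_def)
  then have "h (homologous_rel_set n (nsphere n) {} (a + b))
      = h (homologous_rel_set n (nsphere n) {} a) \<otimes>\<^bsub>integer_group\<^esub> h (homologous_rel_set n (nsphere n) {} b)"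
    by (metis assms hom_mult homologous_rel_set_add homologous_rel_set_in_carrier)
  then show ?thesis
    by (simp only: h(2)) simp
qed

lemma sphere_class_cmul:
  assumes a: "singular_relcycle n (nsphere n) {} a"
  shows "sphere_class n (frag_cmul k a) = k * sphere_class n a"
proof -
  obtain h where h: "h \<in> iso (homology_group (int n) (nsphere n)) integer_group"
    "\<And>c. sphere_class n c = h (homologous_rel_set n (nsphere n) {} c)"
    using sphere_class_iso by blast
  then interpret group_hom "homology_group (int n) (nsphere n)" integer_group h
    by (simp add: group_hom_def group_hom_axioms_def iso_def)
  have "h (homologous_rel_set n (nsphere n) {} a [^]\<^bsub>homology_group (int n) (nsphere n)\<^esub> k)
      = h (homologous_rel_set n (nsphere n) {} a) [^]\<^bsub>integer_group\<^esub> k"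
    by (rule hom_int_pow [OF homologous_rel_set_in_carrier [OF a]])
  then show ?thesis
    by (simp only: h(2) homologous_rel_set_cmul [OF a] group_int_pow_integer_group)
qed

lemma sphere_class_minus:
  assumes "singular_relcycle n (nsphere n) {} a"
  shows "sphere_class n (- a) = - sphere_class n a"
  using sphere_class_cmul [OF assms, of "-1"] by simp

lemma sphere_class_diff:
  assumes "singular_relcycle n (nsphere n) {} a" "singular_relcycle n (nsphere n) {} b"
  shows "sphere_class n (a - b) = sphere_class n a - sphere_class n b"
  using sphere_class_add [of a "- b"] assms
  by (simp add: sphere_class_minus singular_relcycle_minus)

lemma sphere_class_eq_iff:
  assumes "singular_relcycle n (nsphere n) {} a" "singular_relcycle n (nsphere n) {} b"
  shows "sphere_class n a = sphere_class n b \<longleftrightarrow> homologous_rel n (nsphere n) {} a b"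
proof -
  obtain h where h: "h \<in> iso (homology_group (int n) (nsphere n)) integer_group"
    "\<And>c. sphere_class n c = h (homologous_rel_set n (nsphere n) {} c)"
    using sphere_class_iso by blast
  then have "inj_on h (carrier (homology_group (int n) (nsphere n)))"
    by (auto simp: iso_def bij_betw_def)
  from inj_on_eq_iff [OF this homologous_rel_set_in_carrier homologous_rel_set_in_carrier, OF assms]
  show ?thesis
    by (simp only: h(2) homologous_rel_set_eq)
qed

text \<open>Some cycle has class 1, and it is homologous to a multiple of \<open>z\<close>. The
  class of a generator can thus be cancelled from equations between integers.\<close>

lemma sphere_class_generator:
  assumes z: "rel_generator n (nsphere n) {} z"
  shows "sphere_class n z \<noteq> 0"
proof
  assume 0: "sphere_class n z = 0"
  obtain h where h: "h \<in> iso (homology_group (int n) (nsphere n)) integer_group"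
    "\<And>c. sphere_class n c = h (homologous_rel_set n (nsphere n) {} c)"
    using sphere_class_iso by blast
  then have "(1::int) \<in> h ` carrier (homology_group (int n) (nsphere n))"
    by (auto simp: iso_def bij_betw_def integer_group_def)
  then obtain b where b: "singular_relcycle n (nsphere n) {} b" "sphere_class n b = 1"
    using h(2) by (auto simp: carrier_relative_homology_group)
  then obtain k where "homologous_rel n (nsphere n) {} b (frag_cmul k z)"
    using z by (auto simp: rel_generator_def)
  then have "sphere_class n b = k * sphere_class n z"
    using b z by (metis rel_generator_def singular_relcycle_cmul sphere_class_cmul sphere_class_eq_iff)
  with 0 b show False
    by simp
qed

lemma sphere_class_chain_map:
  assumes f: "continuous_map (nsphere n) (nsphere n) f" and a: "singular_relcycle n (nsphere n) {} a"
  shows "sphere_class n (chain_map n f a) = Brouwer_degree2 n f * sphere_class n a"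
proof -
  have "reduced_homology_group (int n) (nsphere n) = homology_group (int n) (nsphere n)"
    using n by (simp add: un_reduced_homology_group)
  then have "hom_induced (int n) (nsphere n) {} (nsphere n) {} f (homologous_rel_set n (nsphere n) {} a)
      = homologous_rel_set n (nsphere n) {} a [^]\<^bsub>homology_group (int n) (nsphere n)\<^esub> (Brouwer_degree2 n f)"
    by (metis Brouwer_degree2 a homologous_rel_set_in_carrier)
  then have "homologous_rel_set n (nsphere n) {} (chain_map n f a)
      = homologous_rel_set n (nsphere n) {} (frag_cmul (Brouwer_degree2 n f) a)"
    using a f by (subst (asm) hom_induced_chain_map) (simp_all add: homologous_rel_set_cmul)
  then have "sphere_class n (chain_map n f a) = sphere_class n (frag_cmul (Brouwer_degree2 n f) a)"
    by (simp add: sphere_class_def)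
  then show ?thesis
    by (simp add: a sphere_class_cmul)
qed

end

section \<open>Odd self-maps of spheres\<close>

definition antipode :: "(nat \<Rightarrow> real) \<Rightarrow> nat \<Rightarrow> real"
  where "antipode x = (\<lambda>i. - x i)"

lemma antipode_antipode [simp]: "antipode (antipode x) = x"
  by (simp add: antipode_def)

lemma continuous_map_antipode: "continuous_map (nsphere n) (nsphere n) antipode"
proof -
  have "continuous_map (powertop_real UNIV) euclideanreal (\<lambda>x. - x k)" for k :: nat
    by (metis UNIV_I continuous_map_product_projection continuous_map_minus)
  then show ?thesis
    by (force simp: nsphere continuous_map_in_subtopology antipode_def continuous_map_componentwise_UNIV
        intro: continuous_map_from_subtopology)
qed

lemma chain_map_antipode_antipode:
  assumes "singular_chain k (nsphere n) c"
  shows "chain_map k antipode (chain_map k antipode c) = c"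
proof -
  have "chain_map k (antipode \<circ> antipode) c = c"
    by (rule chain_map_id_gen [OF assms]) simp
  then show ?thesis
    by (simp add: chain_map_compose)
qed

text \<open>Points of all spheres are functions on the natural numbers that vanish beyond the last
  coordinate, so lower spheres are literally subsets of higher ones and \<open>antipode\<close> is
  the same map on all of them.\<close>

lemma nsphere_mono:
  assumes "k \<le> n"
  shows "continuous_map (nsphere k) (nsphere n) id"
proof -
  have "(\<Sum>i\<le>n. (x i)\<^sup>2) = (\<Sum>i\<le>k. (x i)\<^sup>2)" if "\<forall>i>k. x i = 0" for x :: "nat \<Rightarrow> real"
    by (rule sum.mono_neutral_right) (use assms that in auto)
  then show ?thesis
    using assms by (auto simp: nsphere continuous_map_in_subtopology continuous_map_from_subtopology)
qed

lemma singular_chain_nsphere_mono: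
  assumes "singular_chain p (nsphere k) c" "k \<le> n"
  shows "singular_chain p (nsphere n) c"
  using singular_chain_chain_map [OF assms(1) nsphere_mono [OF assms(2)]] assms(1)
  by (simp add: chain_map_ident)

lemma singular_relcycle_0: "singular_relcycle 0 X {} c \<longleftrightarrow> singular_chain 0 X c"
  by (simp add: singular_cycle chain_boundary_def)

text \<open>In a one-point space the boundary of every 1-chain is 0. So the class of the image of
  \<open>c\<close> is trivial only if the image itself is 0.\<close>

lemma reduced_0_cycle_iff:
  assumes "singular_chain 0 X c"
  shows "homologous_rel_set 0 X {} c \<in> carrier (reduced_homology_group 0 X)
     \<longleftrightarrow> chain_map 0 (\<lambda>x. ()) c = 0"
proof -
  have cyc: "singular_relcycle 0 X {} c"
    using assms by (simp add: singular_relcycle_0)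
  have cm: "continuous_map X (discrete_topology {()}) (\<lambda>x. ())"
    by simp
  have ch: "singular_chain 0 (discrete_topology {()}) (chain_map 0 (\<lambda>x. ()) c)"
    using singular_chain_chain_map [OF assms cm] .
  have "homologous_rel_set 0 X {} c \<in> carrier (homology_group 0 X)"
    using homologous_rel_set_in_carrier [OF cyc] by simp
  moreover have "hom_induced 0 X {} (discrete_topology {()}) {} (\<lambda>x. ()) (homologous_rel_set 0 X {} c)
      = homologous_rel_set 0 (discrete_topology {()}) {} (chain_map 0 (\<lambda>x. ()) c)"
    using hom_induced_chain_map [OF cm _ cyc, of "{}"] by simp
  moreover have "homologous_rel_set 0 (discrete_topology {()}) {} (chain_map 0 (\<lambda>x. ()) c)
        = \<one>\<^bsub>homology_group 0 (discrete_topology {()})\<^esub> \<longleftrightarrow> chain_map 0 (\<lambda>x. ()) c = 0"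
    using one_relative_homology_group [of 0 "discrete_topology {()}" "{}"] ch
      singular_boundary_singleton [of "discrete_topology {()}" "()" 0]
    by (simp add: homologous_rel_set_eq_relboundary)
  ultimately show ?thesis
    unfolding carrier_reduced_homology_group kernel_def by simp
qed

section \<open>Reduced cycles on spheres\<close>

text \<open>All 0-simplices have the same image in the one-point space, so the extra condition says
  that the coefficients add up to 0: these are the cycles of the augmented complex. They let the
  inductions over the dimension start at the 0-sphere.\<close>

definition reduced_cycle :: "nat \<Rightarrow> 'a topology \<Rightarrow> 'a chain \<Rightarrow> bool"
  where "reduced_cycle k X c \<longleftrightarrow> singular_relcycle k X {} c \<and> (k = 0 \<longrightarrow> chain_map 0 (\<lambda>x. ()) c = 0)"

lemma reduced_cycle_in_carrier:
  assumes "reduced_cycle k X c"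
  shows "homologous_rel_set k X {} c \<in> carrier (reduced_homology_group (int k) X)"
proof (cases "k = 0")
  case True
  then show ?thesis
    using assms reduced_0_cycle_iff by (fastforce simp: reduced_cycle_def singular_relcycle_0)
next
  case False
  then show ?thesis
    using assms homologous_rel_set_in_carrier by (auto simp: reduced_cycle_def un_reduced_homology_group)
qed

lemma reduced_cycle_if_in_carrier:
  assumes "singular_relcycle k X {} c"
    "homologous_rel_set k X {} c \<in> carrier (reduced_homology_group (int k) X)"
  shows "reduced_cycle k X c"
  using assms reduced_0_cycle_iff [of X c] by (auto simp: reduced_cycle_def singular_relcycle_0)

lemma reduced_cycle_nsphere_imp_boundary:
  assumes "k < n" "reduced_cycle k (nsphere n) w"
  obtains y where "singular_chain (Suc k) (nsphere n) y" "chain_boundary (Suc k) y = w"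
proof -
  have "trivial_group (reduced_homology_group (int k) (nsphere n))"
    using reduced_homology_group_nsphere(2) [of "int k" n] assms by simp
  then have "homologous_rel_set k (nsphere n) {} w = \<one>\<^bsub>homology_group (int k) (nsphere n)\<^esub>"
    using reduced_cycle_in_carrier [OF assms(2)]
    by (auto simp: trivial_group_def one_reduced_homology_group)
  then have "singular_relboundary k (nsphere n) {} w"
    by (simp only: one_relative_homology_group homologous_rel_set_eq_relboundary)
  then show thesis
    using that by (auto simp: singular_boundary)
qed

definition reduced_generator :: "nat \<Rightarrow> 'a topology \<Rightarrow> 'a chain \<Rightarrow> bool"
  where "reduced_generator k X c \<longleftrightarrow> reduced_cycle k X c \<and>
     (\<forall>b. reduced_cycle k X b \<longrightarrow> (\<exists>j. homologous_rel k X {} b (frag_cmul j c)))"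

lemma reduced_generator_pos: "0 < k \<Longrightarrow> reduced_generator k X c \<longleftrightarrow> rel_generator k X {} c"
  by (simp add: reduced_generator_def rel_generator_def reduced_cycle_def)

section \<open>Antipodally symmetric chains of hemispheres\<close>

abbreviation upper :: "nat \<Rightarrow> (nat \<Rightarrow> real) topology"
  where "upper k \<equiv> subtopology (nsphere k) {x. x k \<ge> 0}"

text \<open>The degree of the antipode on the \<open>k\<close>-sphere. The antipode multiplies
  \<open>symm_chain k c\<close> by this sign, and the sign alternates with \<open>k\<close>; this is
  what makes a hemisphere and its antipodal copy close up to a cycle.\<close>

definition sgn_pow :: "nat \<Rightarrow> int"
  where "sgn_pow k = (-1) ^ (Suc k)"

lemma sgn_pow_0 [simp]: "sgn_pow 0 = -1"
  and sgn_pow_Suc [simp]: "sgn_pow (Suc k) = - sgn_pow k"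
  and sgn_pow_square [simp]: "sgn_pow k * sgn_pow k = 1"
  by (simp_all add: sgn_pow_def flip: power_mult_distrib)

lemma odd_sgn_pow: "odd (sgn_pow k)"
  by (simp add: sgn_pow_def)

definition symm_chain :: "nat \<Rightarrow> (nat \<Rightarrow> real) chain \<Rightarrow> (nat \<Rightarrow> real) chain"
  where "symm_chain k c = c + frag_cmul (sgn_pow k) (chain_map k antipode c)"

text \<open>The 0-sphere consists of \<open>p\<close> and \<open>antipode p\<close>, and a 0-chain
  whose coefficients add up to 0 is a multiple of the difference of these two points.\<close>

lemma reduced_generator_nsphere_0:
  defines "c \<equiv> frag_of (restrict (\<lambda>_ i. if i = 0 then 1 else 0) (standard_simplex 0))"
  shows "singular_chain 0 (upper 0) c" "reduced_generator 0 (nsphere 0) (symm_chain 0 c)"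
proof -
  define p :: "nat \<Rightarrow> real" where "p = (\<lambda>i. if i = 0 then 1 else 0)"
  define sp where "sp = restrict (\<lambda>_. p) (standard_simplex 0)"
  define sq where "sq = restrict (\<lambda>_. antipode p) (standard_simplex 0)"
  have ceq: "c = frag_of sp"
    by (simp add: c_def sp_def p_def)
  have top: "topspace (nsphere 0) = {p, antipode p}"
  proof -
    have "x = p \<or> x = antipode p" if "(x 0)\<^sup>2 = 1" "\<forall>i>0. x i = 0" for x
      using that by (auto simp: p_def antipode_def power2_eq_1_iff fun_eq_iff)
    then show ?thesis
      by (auto simp: nsphere) (auto simp: p_def antipode_def)
  qed
  have sp: "singular_simplex 0 (upper 0) sp"
    unfolding singular_simplex_def sp_def using top
    by (auto simp: continuous_map_in_subtopology p_def)
  then show "singular_chain 0 (upper 0) c"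
    by (simp add: ceq singular_chain_of)
  then have chc: "singular_chain 0 (nsphere 0) c"
    by (simp add: singular_chain_subtopology)
  have "simplex_map 0 antipode sp = sq"
    by (auto simp: simplex_map_def sp_def sq_def fun_eq_iff restrict_def)
  then have ac: "chain_map 0 antipode c = frag_of sq"
    by (simp add: ceq)
  have z: "symm_chain 0 c = frag_of sp - frag_of sq"
    by (simp add: symm_chain_def ac) (simp add: ceq)
  have chz: "singular_chain 0 (nsphere 0) (symm_chain 0 c)"
    unfolding symm_chain_def
    by (intro singular_chain_add singular_chain_cmul singular_chain_chain_map [OF _ continuous_map_antipode] chc)
  let ?t = "restrict (\<lambda>x. ()) (standard_simplex 0)"
  have t: "chain_map 0 (\<lambda>x. ()) (frag_of sp) = frag_of ?t" "chain_map 0 (\<lambda>x. ()) (frag_of sq) = frag_of ?t"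
    by (simp_all add: simplex_map_def o_def)
  show "reduced_generator 0 (nsphere 0) (symm_chain 0 c)"
    unfolding reduced_generator_def
  proof (intro conjI allI impI)
    show "reduced_cycle 0 (nsphere 0) (symm_chain 0 c)"
      using chz by (simp add: reduced_cycle_def singular_relcycle_0 z chain_map_diff t del: chain_map_of)
    fix b assume "reduced_cycle 0 (nsphere 0) b"
    then have b: "singular_chain 0 (nsphere 0) b" "chain_map 0 (\<lambda>x. ()) b = 0"
      by (auto simp: reduced_cycle_def singular_relcycle_0)
    have "\<exists>i j. b = frag_cmul i (frag_of sp) + frag_cmul j (frag_of sq)"
      using b(1) unfolding singular_chain_def
    proof (induction b rule: frag_induction)
      case zero
      then show ?case
        by (intro exI [of _ 0]) simp
    next
      case (one f)
      obtain x where x: "standard_simplex 0 = {x}"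
        by (simp add: standard_simplex_0)
      from one have "f \<in> extensional {x}" "f x \<in> {p, antipode p}"
        using continuous_map_image_subset_topspace [of "subtopology (powertop_real UNIV) {x}" "nsphere 0" f] top
        by (auto simp: singular_simplex_def x)
      then have "f = sp \<or> f = sq"
        using extensionalityI [of f "{x}" sp] extensionalityI [of f "{x}" sq] by (auto simp: sp_def sq_def x)
      then show ?case
        by (metis add.left_neutral add.right_neutral frag_cmul_one frag_cmul_zero)
    next
      case (diff a b)
      then obtain i j i' j' where "a = frag_cmul i (frag_of sp) + frag_cmul j (frag_of sq)"
        "b = frag_cmul i' (frag_of sp) + frag_cmul j' (frag_of sq)" by blast
      then have "a - b = frag_cmul (i - i') (frag_of sp) + frag_cmul (j - j') (frag_of sq)"
        by (simp add: frag_cmul_diff_distrib)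
      then show ?case by blast
    qed
    then obtain i j where ij: "b = frag_cmul i (frag_of sp) + frag_cmul j (frag_of sq)"
      by blast
    have "frag_cmul (i + j) (frag_of ?t) = 0"
      using b(2) unfolding ij by (simp add: chain_map_add t frag_cmul_distrib del: chain_map_of)
    then have "j = - i"
      by simp
    then have "b = frag_cmul i (symm_chain 0 c)"
      unfolding ij z by (simp add: frag_cmul_diff_right)
    then show "\<exists>j. homologous_rel 0 (nsphere 0) {} b (frag_cmul j (symm_chain 0 c))"
      by (metis homologous_rel_refl)
  qed
qed

lemma subtopology_upper_equator:
  "subtopology (upper (Suc k)) {x. x (Suc k) = 0} = nsphere k"
proof -
  have "{x. 0 \<le> x (Suc k)} \<inter> {x. x (Suc k) = 0} = {x. x (Suc k) = (0::real)}"
    by auto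
  then show ?thesis
    by (simp add: subtopology_nsphere_equator subtopology_subtopology)
qed

text \<open>Modulo the lower hemisphere \<open>c + d\<close> is just \<open>c\<close>, a generator
  by excision. As the lower hemisphere is contractible, passing to homology relative to it is an
  isomorphism.\<close>

lemma rel_generator_upper_imp_nsphere:
  assumes c: "rel_generator n (upper n) {x. x n = 0} c" and n: "0 < n"
    and d: "singular_chain n (subtopology (nsphere n) {x. x n \<le> 0}) d" and cyc: "singular_relcycle n (nsphere n) {} (c + d)"
  shows "rel_generator n (nsphere n) {} (c + d)"
proof -
  let ?L = "{x. x n \<le> (0::real)}"
  have c1: "singular_chain n (upper n) c" "singular_relcycle n (upper n) {x. x n = 0} c"
    using c by (auto simp: rel_generator_def singular_relcycle)
  have "rel_generator n (nsphere n) ?L (chain_map n id c)"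
    by (subst iso_rel_generator_chain_map_iff [OF _ _ iso_relative_homology_group_upper_hemisphere])
       (use c c1 in \<open>auto simp: continuous_map_in_subtopology continuous_map_from_subtopology\<close>)
  then have gc: "rel_generator n (nsphere n) ?L c"
    using c1(1) by (simp add: chain_map_ident)
  have "homologous_rel n (nsphere n) ?L (c + d) c"
    by (simp add: homologous_rel_def d singular_chain_imp_relboundary)
  then have "rel_generator n (nsphere n) ?L (c + d)"
    using gc unfolding rel_generator_def
    by (meson homologous_rel_cmul homologous_rel_singular_relcycle homologous_rel_sym homologous_rel_trans)
  moreover have "singular_chain n (nsphere n) (c + d)"
    using cyc by (simp add: singular_relcycle)
  ultimately have *: "rel_generator n (nsphere n) ?L (chain_map n id (c + d))"
    by (metis chain_map_ident)
  have "hom_induced (int n) (nsphere n) {} (nsphere n) ?L id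
      \<in> iso (homology_group (int n) (nsphere n)) (relative_homology_group (int n) (nsphere n) ?L)"
    using iso_reduced_homology_group_lower_hemisphere [of n n "int n"] n by (simp add: un_reduced_homology_group)
  from iso_rel_generator_chain_map_iff [OF _ _ this cyc] * show ?thesis
    by simp
qed

text \<open>Since the hemisphere is contractible, the connecting homomorphism to its equator is an
  isomorphism, which gives a chain whose boundary is homologous to \<open>z\<close>. The boundary
  must be equal to \<open>z\<close>, because symmetrisation is carried out on chains.\<close>

lemma upper_chain_step:
  assumes z: "reduced_generator k (nsphere k) z"
  obtains c where "rel_generator (Suc k) (upper (Suc k)) {x. x (Suc k) = 0} c" "chain_boundary (Suc k) c = z"
proof -
  let ?U = "upper (Suc k)" and ?E = "{x. x (Suc k) = (0::real)}"
  have iso: "hom_boundary (int (Suc k)) ?U ?E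
      \<in> iso (relative_homology_group (int (Suc k)) ?U ?E) (reduced_homology_group (int k) (nsphere k))"
    using iso_upper_hemisphere_reduced_homology_group [of "int k" k] by simp
  have bd: "hom_boundary (int (Suc k)) ?U ?E (homologous_rel_set (Suc k) ?U ?E b)
      = homologous_rel_set k (nsphere k) {} (chain_boundary (Suc k) b)"
    if "singular_relcycle (Suc k) ?U ?E b" for b
    using hom_boundary_chain_boundary [OF that] by (simp add: subtopology_upper_equator)
  have "homologous_rel_set k (nsphere k) {} z
      \<in> hom_boundary (int (Suc k)) ?U ?E ` carrier (relative_homology_group (int (Suc k)) ?U ?E)"
    using iso z reduced_cycle_in_carrier by (auto simp: iso_def bij_betw_def reduced_generator_def)
  then obtain c' where c': "singular_relcycle (Suc k) ?U ?E c'"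
    and "homologous_rel_set k (nsphere k) {} z
       = hom_boundary (int (Suc k)) ?U ?E (homologous_rel_set (Suc k) ?U ?E c')"
    unfolding carrier_relative_homology_group by blast
  then have "homologous_rel k (nsphere k) {} z (chain_boundary (Suc k) c')"
    by (simp only: bd homologous_rel_set_eq)
  then obtain d where d: "singular_chain (Suc k) (nsphere k) d"
      "chain_boundary (Suc k) d = chain_boundary (Suc k) c' - z"
    by (metis homologous_rel_def homologous_rel_sym singular_boundary)
  \<comment> \<open>The chain \<open>d\<close> lies in the equator, so it corrects the boundary
    without affecting the class relative to the equator.\<close>
  define c where "c = c' - d"
  have dE: "singular_chain (Suc k) (subtopology ?U ?E) d"
    using d(1) by (simp only: subtopology_upper_equator)
  then have dU: "singular_relcycle (Suc k) ?U ?E d"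
    using singular_chain_boundary_alt [OF dE] by (simp add: singular_relcycle singular_chain_subtopology)
  have c: "singular_relcycle (Suc k) ?U ?E c"
    using singular_relcycle_diff [OF c' dU] by (simp add: c_def)
  have bc: "chain_boundary (Suc k) c = z"
    by (simp add: c_def chain_boundary_diff d(2))
  have "\<exists>j. homologous_rel (Suc k) ?U ?E b (frag_cmul j c)" if b: "singular_relcycle (Suc k) ?U ?E b" for b
  proof -
    have cycb: "singular_relcycle k (nsphere k) {} (chain_boundary (Suc k) b)"
      using b chain_boundary_boundary_alt [of k ?U b]
      by (auto simp: singular_cycle singular_relcycle subtopology_upper_equator)
    moreover have "homologous_rel_set k (nsphere k) {} (chain_boundary (Suc k) b)
         \<in> carrier (reduced_homology_group (int k) (nsphere k))"
      using hom_in_carrier [OF iso_imp_homomorphism [OF iso] homologous_rel_set_in_carrier [OF b]]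
      by (simp only: bd [OF b])
    ultimately have "reduced_cycle k (nsphere k) (chain_boundary (Suc k) b)"
      by (rule reduced_cycle_if_in_carrier)
    then obtain j where "homologous_rel k (nsphere k) {} (chain_boundary (Suc k) b) (frag_cmul j z)"
      using z by (auto simp: reduced_generator_def)
    then have "homologous_rel_set k (nsphere k) {} (chain_boundary (Suc k) b)
             = homologous_rel_set k (nsphere k) {} (chain_boundary (Suc k) (frag_cmul j c))"
      by (simp only: homologous_rel_set_eq chain_boundary_cmul bc)
    then have hb: "hom_boundary (int (Suc k)) ?U ?E (homologous_rel_set (Suc k) ?U ?E b)
        = hom_boundary (int (Suc k)) ?U ?E (homologous_rel_set (Suc k) ?U ?E (frag_cmul j c))"
      by (simp only: bd [OF b] bd [OF singular_relcycle_cmul [OF c]])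
    have inj: "inj_on (hom_boundary (int (Suc k)) ?U ?E) (carrier (relative_homology_group (int (Suc k)) ?U ?E))"
      using iso by (auto simp: iso_def bij_betw_def)
    from inj_onD [OF this hb homologous_rel_set_in_carrier [OF b]
        homologous_rel_set_in_carrier [OF singular_relcycle_cmul [OF c]]]
 have "homologous_rel (Suc k) ?U ?E b (frag_cmul j c)"
      by (simp only: homologous_rel_set_eq)
    then show ?thesis ..
  qed
  then show thesis
    using that [of c] bc c by (auto simp: rel_generator_def)
qed

text \<open>The chains of the symmetric cell structure of the spheres, with one hemisphere and its
  antipodal copy in each dimension. They are chosen together because each is bounded by the
  symmetrisation of the one before.\<close>

lemma hemisphere_chains:
  obtains c where "\<And>k. singular_chain k (upper k) (c k)"
    "\<And>k. reduced_generator k (nsphere k) (symm_chain k (c k))"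
    "\<And>k. chain_boundary (Suc k) (c (Suc k)) = symm_chain k (c k)"
proof -
  define Q where "Q k d \<longleftrightarrow> singular_chain k (upper k) d \<and> reduced_generator k (nsphere k) (symm_chain k d)" for k d
  have "\<exists>c. \<forall>k. Q k (c k) \<and> chain_boundary (Suc k) (c (Suc k)) = symm_chain k (c k)"
  proof (rule dependent_nat_choice)
    show "\<exists>d. Q 0 d"
      unfolding Q_def using reduced_generator_nsphere_0 by blast
    fix d k assume "Q k d"
    then have gen: "reduced_generator k (nsphere k) (symm_chain k d)"
      and chd: "singular_chain k (nsphere k) d"
      by (auto simp: Q_def singular_chain_subtopology)
    obtain e where e: "rel_generator (Suc k) (upper (Suc k)) {x. x (Suc k) = 0} e"
      "chain_boundary (Suc k) e = symm_chain k d"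
      using upper_chain_step [OF gen] .
    have chU: "singular_chain (Suc k) (upper (Suc k)) e"
      using e(1) by (simp add: rel_generator_def singular_relcycle)
    then have che: "singular_chain (Suc k) (nsphere (Suc k)) e"
      by (simp add: singular_chain_subtopology)
    let ?d = "frag_cmul (sgn_pow (Suc k)) (chain_map (Suc k) antipode e)"
    have cm: "continuous_map (upper (Suc k)) (subtopology (nsphere (Suc k)) {x. x (Suc k) \<le> 0}) antipode"
      using continuous_map_antipode [of "Suc k"]
      by (auto simp: continuous_map_in_subtopology continuous_map_from_subtopology antipode_def)
    \<comment> \<open>The two boundaries cancel: the antipode multiplies
      \<open>symm_chain k d\<close> by \<open>sgn_pow k\<close>, and \<open>sgn_pow (Suc k)\<close>
      has the opposite sign.\<close>
    have "chain_boundary (Suc k) (e + ?d)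
        = symm_chain k d - frag_cmul (sgn_pow k) (chain_map k antipode (symm_chain k d))"
      using e(2) chain_boundary_chain_map [OF che, of antipode]
      by (simp add: chain_boundary_add chain_boundary_cmul)
    also have "\<dots> = 0"
      using chain_map_antipode_antipode [OF chd]
      by (simp add: symm_chain_def chain_map_add frag_cmul_distrib2)
    finally have "singular_relcycle (Suc k) (nsphere (Suc k)) {} (e + ?d)"
      by (simp add: singular_cycle che singular_chain_add singular_chain_cmul
          singular_chain_chain_map [OF _ continuous_map_antipode] del: sgn_pow_Suc)
    then have "rel_generator (Suc k) (nsphere (Suc k)) {} (e + ?d)"
      by (intro rel_generator_upper_imp_nsphere e singular_chain_cmul singular_chain_chain_map [OF chU cm]) auto
    then show "\<exists>y. Q (Suc k) y \<and> chain_boundary (Suc k) y = symm_chain k d"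
      using e(2) chU by (auto simp: Q_def symm_chain_def reduced_generator_pos)
  qed
  then show thesis
    using that by (auto simp: Q_def)
qed

text \<open>Compare \<open>f\<close> and the identity on equivariant chains of hemispheres.  Up to symmetrised
  chains the difference is a cycle in every degree, so \<open>f\<close> and the identity differ by a symmetrised
  cycle in the top degree, and the antipode acts there by a sign.\<close>

theorem Borsuk_odd_mapping_degree:
  assumes n: "0 < n" and f: "continuous_map (nsphere n) (nsphere n) f"
    and odd: "\<And>x. x \<in> topspace (nsphere n) \<Longrightarrow> f (antipode x) = antipode (f x)"
  shows "odd (Brouwer_degree2 n f)"
proof -
  obtain c where c: "\<And>k. singular_chain k (upper k) (c k)"
    "\<And>k. reduced_generator k (nsphere k) (symm_chain k (c k))"
    "\<And>k. chain_boundary (Suc k) (c (Suc k)) = symm_chain k (c k)"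
    using hemisphere_chains by blast
  have ch: "singular_chain k (nsphere n) (c k)" if "k \<le> n" for k
    using c(1) [of k] that by (auto simp: singular_chain_subtopology intro: singular_chain_nsphere_mono)
  note chf = singular_chain_chain_map [OF _ f]
  note cha = singular_chain_chain_map [OF _ continuous_map_antipode]
  have fa: "chain_map k f (chain_map k antipode d) = chain_map k antipode (chain_map k f d)"
    if "singular_chain k (nsphere n) d" for k d
  proof -
    have "chain_map k (f \<circ> antipode) d = chain_map k (antipode \<circ> f) d"
      by (rule chain_map_eq [OF that]) (simp add: odd)
    then show ?thesis
      by (simp add: chain_map_compose)
  qed
  define x where "x k = chain_map k f (c k) - c k" for k
  have chx: "singular_chain k (nsphere n) (x k)" if "k \<le> n" for k
    by (simp add: x_def singular_chain_diff chf ch that)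
  have claim: "\<exists>w y. reduced_cycle k (nsphere n) w \<and> singular_chain k (nsphere n) y
          \<and> x k = w + (y - frag_cmul (sgn_pow k) (chain_map k antipode y))" if "k \<le> n" for k
    using that
  proof (induction k)
    case 0
    \<comment> \<open>The map \<open>f\<close> preserves the sum of the coefficients, so
      \<open>x 0\<close> is itself a reduced cycle and \<open>y = 0\<close> will do.\<close>
    have "chain_map 0 (\<lambda>x. ()) (x 0) = 0"
      unfolding x_def chain_map_diff
      using chain_map_compose [of 0 "\<lambda>x. ()" f] by (simp add: o_def fun_eq_iff)
    then show ?case
      using chx [of 0] by (intro exI [of _ "x 0"] exI [of _ 0]) (simp add: reduced_cycle_def singular_relcycle_0)
  next
    case (Suc k)
    then obtain w y where w: "reduced_cycle k (nsphere n) w" and y: "singular_chain k (nsphere n) y"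
      and xk: "x k = w + (y - frag_cmul (sgn_pow k) (chain_map k antipode y))"
      by auto
    obtain u where u: "singular_chain (Suc k) (nsphere n) u" "chain_boundary (Suc k) u = w"
      using reduced_cycle_nsphere_imp_boundary w Suc.prems by (metis Suc_le_eq)
    \<comment> \<open>As \<open>u\<close> fills \<open>w\<close>, this chain has boundary
      \<open>w + frag_cmul (sgn_pow k) (chain_map k antipode w)\<close>, which is exactly the
      boundary of \<open>x (Suc k)\<close>; so \<open>u\<close> is the next
      \<open>y\<close>.\<close>
    let ?v = "u - frag_cmul (sgn_pow (Suc k)) (chain_map (Suc k) antipode u)"
    have chk: "singular_chain k (nsphere n) (c k)" and chSk: "singular_chain (Suc k) (nsphere n) (c (Suc k))"
      using ch Suc.prems by auto
    have bu: "chain_boundary (Suc k) (chain_map (Suc k) antipode u) = chain_map k antipode w"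
      using chain_boundary_chain_map [OF u(1), of antipode] u(2) by simp
    have "chain_boundary (Suc k) (x (Suc k)) = chain_map k f (symm_chain k (c k)) - symm_chain k (c k)"
      using chain_boundary_chain_map [OF chSk, of f] by (simp add: x_def chain_boundary_diff c(3))
    also have "\<dots> = x k + frag_cmul (sgn_pow k) (chain_map k antipode (x k))"
      by (simp add: symm_chain_def x_def chain_map_add chain_map_diff fa [OF chk] frag_cmul_diff_right)
    \<comment> \<open>The part of \<open>x k\<close> that comes from \<open>y\<close> is killed by
      symmetrisation, since the antipode is an involution and the sign squares to 1.\<close>
    also have "\<dots> = w + frag_cmul (sgn_pow k) (chain_map k antipode w)"
      using chain_map_antipode_antipode [OF y]
      by (simp add: xk chain_map_add chain_map_diff frag_cmul_distrib2 frag_cmul_diff_right)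
    also have "\<dots> = chain_boundary (Suc k) ?v"
      by (simp add: chain_boundary_diff chain_boundary_add chain_boundary_cmul u(2) bu)
    finally have "chain_boundary (Suc k) (x (Suc k) - ?v) = 0"
      by (simp add: chain_boundary_diff)
    then have "reduced_cycle (Suc k) (nsphere n) (x (Suc k) - ?v)"
      using chx [OF Suc.prems] u(1) unfolding reduced_cycle_def singular_cycle
      by (auto intro!: singular_chain_diff singular_chain_cmul cha)
    then show ?case
      using u(1) by (intro exI [of _ "x (Suc k) - ?v"] exI [of _ u]) auto
  qed
  obtain w y where w: "singular_relcycle n (nsphere n) {} w" and y: "singular_chain n (nsphere n) y"
      and xn: "x n = w + (y - frag_cmul (sgn_pow n) (chain_map n antipode y))"
    using claim [OF order_refl] by (auto simp: reduced_cycle_def)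
  define z where "z = symm_chain n (c n)"
  have gz: "rel_generator n (nsphere n) {} z"
    using c(2) [of n] n by (simp add: z_def reduced_generator_pos)
  then have z: "singular_relcycle n (nsphere n) {} z"
    by (simp add: rel_generator_def)
  have "chain_map n f z - z = x n + frag_cmul (sgn_pow n) (chain_map n antipode (x n))"
    by (simp add: z_def symm_chain_def x_def chain_map_add chain_map_diff fa [OF ch] frag_cmul_diff_right)
  also have "\<dots> = w + frag_cmul (sgn_pow n) (chain_map n antipode w)"
    using chain_map_antipode_antipode [OF y]
    by (simp add: xn chain_map_add chain_map_diff frag_cmul_distrib2 frag_cmul_diff_right)
  finally have eq: "chain_map n f z - z = w + frag_cmul (sgn_pow n) (chain_map n antipode w)" .
  define a where "a = Brouwer_degree2 n antipode"
  have cyc: "singular_relcycle n (nsphere n) {} (chain_map n g b)"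
    if "continuous_map (nsphere n) (nsphere n) g" "singular_relcycle n (nsphere n) {} b" for g b
    using singular_relcycle_chain_map [OF that(2,1)] by simp
  note cyca = cyc [OF continuous_map_antipode]
  have "sphere_class n (chain_map n f z - z) = sphere_class n w + sgn_pow n * (a * sphere_class n w)"
    unfolding eq using w n
    by (simp add: sphere_class_add sphere_class_cmul sphere_class_chain_map continuous_map_antipode
        singular_relcycle_cmul cyca a_def)
  moreover have "sphere_class n (chain_map n f z - z) = Brouwer_degree2 n f * sphere_class n z - sphere_class n z"
    using z n f cyc by (simp add: sphere_class_diff sphere_class_chain_map)
  moreover obtain j where "homologous_rel n (nsphere n) {} w (frag_cmul j z)"
    using gz w by (auto simp: rel_generator_def)
  then have "sphere_class n w = j * sphere_class n z"
    using n w z by (metis singular_relcycle_cmul sphere_class_cmul sphere_class_eq_iff)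
  ultimately have "(Brouwer_degree2 n f - 1) * sphere_class n z = (j * (1 + sgn_pow n * a)) * sphere_class n z"
    by (simp add: algebra_simps)
  then have deg: "Brouwer_degree2 n f - 1 = j * (1 + sgn_pow n * a)"
    using sphere_class_generator [OF n gz] by simp
  have "chain_map n antipode (chain_map n antipode z) = z"
    using z by (intro chain_map_antipode_antipode) (auto simp: singular_relcycle)
  then have "a * (a * sphere_class n z) = sphere_class n z"
    using n z cyca by (metis a_def continuous_map_antipode sphere_class_chain_map)
  then have "a * a = 1"
    using sphere_class_generator [OF n gz] by (simp flip: mult.assoc)
  then have "odd a"
    by (metis even_mult_iff odd_one)
  \<comment> \<open>Both \<open>sgn_pow n\<close> and \<open>a\<close> are odd, the latter because
    the antipode is an involution and hence \<open>a * a = 1\<close>.\<close>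
  then have "even (1 + sgn_pow n * a)"
    by (simp add: odd_sgn_pow)
  then have "even (Brouwer_degree2 n f - 1)"
    by (simp add: deg)
  then show ?thesis
    by simp
qed

section \<open>Difference chains\<close>

text \<open>Stands for gluing along \<open>A\<close>: if \<open>u\<close> and \<open>v\<close> agree
  on \<open>A\<close> and \<open>c\<close> is a cycle relative to \<open>A\<close>, this is the
  image of the doubled \<open>c\<close> under \<open>u\<close> on one copy and \<open>v\<close> on
  the other.\<close>

definition difference_chain :: "nat \<Rightarrow> ('a \<Rightarrow> 'b) \<Rightarrow> ('a \<Rightarrow> 'b) \<Rightarrow> 'a chain \<Rightarrow> 'b chain"
  where "difference_chain p u v c = chain_map p u c - chain_map p v c"

lemma difference_chain_diff: "difference_chain p u v (a - b) = difference_chain p u v a - difference_chain p u v b"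
  by (simp add: difference_chain_def chain_map_diff)

lemma difference_chain_cmul: "difference_chain p u v (frag_cmul k a) = frag_cmul k (difference_chain p u v a)"
  by (simp add: difference_chain_def frag_cmul_diff_right)

lemma difference_chain_chain_map:
  "difference_chain p u v (chain_map p g c) = difference_chain p (u \<circ> g) (v \<circ> g) c"
  by (simp add: difference_chain_def chain_map_compose)

lemma difference_chain_eq_0:
  assumes "singular_chain p (subtopology X A) c" "\<And>x. \<lbrakk>x \<in> topspace X; x \<in> A\<rbrakk> \<Longrightarrow> u x = v x"
  shows "difference_chain p u v c = 0"
  unfolding difference_chain_def using chain_map_eq [OF assms(1), of u v] assms(2) by simp

context
  fixes X :: "'a topology" and Y :: "'b topology" and A u v
  assumes u: "continuous_map X Y u" and v: "continuous_map X Y v"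
    and eq: "\<And>x. \<lbrakk>x \<in> topspace X; x \<in> A\<rbrakk> \<Longrightarrow> u x = v x"
begin

lemma singular_cycle_difference_chain:
  assumes "singular_relcycle p X A c"
  shows "singular_relcycle p Y {} (difference_chain p u v c)"
proof -
  have c: "singular_chain p X c" "singular_chain (p - 1) (subtopology X A) (chain_boundary p c)"
    using assms by (auto simp: singular_relcycle)
  have "chain_boundary p (difference_chain p u v c) = difference_chain (p - 1) u v (chain_boundary p c)"
    by (simp add: difference_chain_def chain_boundary_diff chain_boundary_chain_map [OF c(1)])
  also have "\<dots> = 0"
    using difference_chain_eq_0 [OF c(2) eq] .
  finally show ?thesis
    using c u v by (simp add: singular_cycle difference_chain_def singular_chain_diff singular_chain_chain_map)
qed

text \<open>The part of a relative boundary that lies in \<open>A\<close> contributes nothing,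
  because \<open>u\<close> and \<open>v\<close> agree there.\<close>

lemma homologous_difference_chain:
  assumes "homologous_rel p X A a b"
  shows "homologous_rel p Y {} (difference_chain p u v a) (difference_chain p u v b)"
proof -
  obtain d e where d: "singular_chain (Suc p) X d" and e: "singular_chain p (subtopology X A) e"
    and "chain_boundary (Suc p) d + e = a - b"
    using assms by (auto simp: homologous_rel_def singular_relboundary)
  then have "difference_chain p u v a - difference_chain p u v b
           = difference_chain p u v (chain_boundary (Suc p) d + e)"
    by (simp add: difference_chain_diff)
  also have "\<dots> = difference_chain p u v (chain_boundary (Suc p) d) + difference_chain p u v e"
    by (simp add: difference_chain_def chain_map_add)
  also have "\<dots> = chain_boundary (Suc p) (difference_chain (Suc p) u v d)"
    using difference_chain_eq_0 [OF e, of u v] eq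
    by (simp add: difference_chain_def chain_boundary_diff chain_boundary_chain_map [OF d])
  finally show ?thesis
    unfolding homologous_rel_def singular_boundary
    using d u v by (metis difference_chain_def singular_chain_chain_map singular_chain_diff)
qed

end

text \<open>The homotopies form one pair of maps on the cylinder that agree on
  \<open>{0..1} \<times> A\<close>, and the copies of \<open>c\<close> at both ends of the cylinder
  are homologous relative to this set.\<close>

lemma homologous_difference_chain_homotopy:
  assumes U: "continuous_map (prod_topology (top_of_set {0..1::real}) X) Y U"
    and V: "continuous_map (prod_topology (top_of_set {0..1::real}) X) Y V"
    and eq: "\<And>t x. \<lbrakk>0 \<le> t; t \<le> 1; x \<in> topspace X; x \<in> A\<rbrakk> \<Longrightarrow> U (t, x) = V (t, x)"
    and c: "singular_relcycle p X A c"
  shows "homologous_rel p Y {} (difference_chain p (\<lambda>x. U (0, x)) (\<lambda>x. V (0, x)) c)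
           (difference_chain p (\<lambda>x. U (1, x)) (\<lambda>x. V (1, x)) c)"
proof -
  let ?T = "prod_topology (top_of_set {0..1::real}) X"
  have "homotopic_with (\<lambda>h. h \<in> A \<rightarrow> {0..1} \<times> A) X ?T (Pair 0) (Pair 1)"
    unfolding homotopic_with_def
    \<comment> \<open>The identity of the cylinder is a homotopy between the inclusions of its two
      ends.\<close>
    by (intro exI [of _ id]) auto
  then have "homologous_rel p ?T ({0..1} \<times> A) (chain_map p (Pair 0) c) (chain_map p (Pair 1) c)"
    by (rule homotopic_imp_homologous_rel_chain_maps [OF _ c])
  then have "homologous_rel p Y {} (difference_chain p U V (chain_map p (Pair 0) c))
              (difference_chain p U V (chain_map p (Pair 1) c))"
    by (rule homologous_difference_chain [OF U V, rotated]) (use eq in auto)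
  then show ?thesis
    by (simp add: difference_chain_chain_map o_def)
qed

section \<open>Pushing one sheet off the other\<close>

text \<open>The Euclidean distance, for points of a space that is given only as a subspace of a
  product topology.\<close>

definition ed :: "nat \<Rightarrow> (nat \<Rightarrow> real) \<Rightarrow> (nat \<Rightarrow> real) \<Rightarrow> real"
  where "ed n a b = L2_set (\<lambda>i. a i - b i) {..<n}"

lemma ed_nonneg [simp]: "0 \<le> ed n a b"
  by (simp add: ed_def)

lemma ed_commute: "ed n a b = ed n b a"
  by (simp add: ed_def L2_set_def power2_commute)

lemma ed_triangle: "ed n a c \<le> ed n a b + ed n b c"
  using L2_set_triangle_ineq [of "\<lambda>i. a i - b i" "\<lambda>i. b i - c i" "{..<n}"] by (simp add: ed_def)

lemma ed_eq_0_iff: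
  assumes "a \<in> topspace (Euclidean_space n)" "b \<in> topspace (Euclidean_space n)"
  shows "ed n a b = 0 \<longleftrightarrow> a = b"
  using assms by (auto simp: ed_def L2_set_eq_0_iff topspace_Euclidean_space fun_eq_iff)
    (metis lessThan_iff not_le)

lemma ed_refl [simp]: "ed n a a = 0"
  by (simp add: ed_def L2_set_def)

lemma continuous_map_Euclidean_component:
  assumes "continuous_map T (Euclidean_space n) a"
  shows "continuous_map T euclideanreal (\<lambda>t. a t i)"
  using assms by (auto simp: Euclidean_space_def continuous_map_in_subtopology continuous_map_componentwise_UNIV)

lemma continuous_map_Euclidean_space_iff_components:
  "continuous_map T (Euclidean_space n) a \<longleftrightarrow>
     (\<forall>i. continuous_map T euclideanreal (\<lambda>t. a t i)) \<and> a \<in> topspace T \<rightarrow> topspace (Euclidean_space n)"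
  by (auto simp: Euclidean_space_def continuous_map_in_subtopology continuous_map_componentwise_UNIV)

lemma continuous_map_ed:
  assumes "continuous_map T (Euclidean_space n) a" "continuous_map T (Euclidean_space n) b"
  shows "continuous_map T euclideanreal (\<lambda>t. ed n (a t) (b t))"
  unfolding ed_def L2_set_def
  by (intro continuous_intros continuous_map_Euclidean_component [OF assms(1)]
      continuous_map_Euclidean_component [OF assms(2)]) auto

text \<open>For positive \<open>r\<close> this is 1 up to distance \<open>r\<close>, 0 from distance
  \<open>2 * r\<close> on, and linear in between.\<close>

definition cutoff :: "real \<Rightarrow> real \<Rightarrow> real"
  where "cutoff r d = max 0 (min 1 (2 - d / r))"

definition push_vec :: "nat \<Rightarrow> real \<Rightarrow> (nat \<Rightarrow> real) \<Rightarrow> (nat \<Rightarrow> real) \<Rightarrow> (nat \<Rightarrow> real) \<Rightarrow> nat \<Rightarrow> real"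
  where "push_vec n r a b c = (\<lambda>i. a i - (cutoff r (ed n a b) * c i + (1 - cutoff r (ed n a b)) * b i))"

text \<open>The direction from \<open>b\<close> to \<open>a\<close>, except that for \<open>a\<close> near \<open>b\<close> the point \<open>b\<close> is replaced by its
  displacement \<open>c\<close>.  This makes sense for \<open>a = b\<close>, too, provided that \<open>c\<close> is closer to \<open>b\<close> than \<open>r\<close>.\<close>

definition push :: "nat \<Rightarrow> real \<Rightarrow> (nat \<Rightarrow> real) \<Rightarrow> (nat \<Rightarrow> real) \<Rightarrow> (nat \<Rightarrow> real) \<Rightarrow> nat \<Rightarrow> real"
  where "push m r a b c = (\<lambda>i. push_vec (Suc m) r a b c i / L2_set (push_vec (Suc m) r a b c) {..<Suc m})"

lemma push_vec_in_Euclidean_space: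
  "\<lbrakk>a \<in> topspace (Euclidean_space n); b \<in> topspace (Euclidean_space n); c \<in> topspace (Euclidean_space n)\<rbrakk>
    \<Longrightarrow> push_vec n r a b c \<in> topspace (Euclidean_space n)"
  by (simp add: push_vec_def topspace_Euclidean_space)

text \<open>If the vector vanished, \<open>a\<close> would divide the segment from \<open>b\<close>
  to \<open>c\<close> in the ratio given by \<open>l\<close>. For \<open>l = 1\<close> it would be
  \<open>c\<close>. For smaller \<open>l\<close> it is farther than \<open>r\<close> from
  \<open>b\<close>: below distance \<open>2 * r\<close> the segment is too short for that, and
  beyond it \<open>l = 0\<close> would put \<open>a\<close> at \<open>b\<close>.\<close>

lemma push_vec_nonzero:
  assumes "a \<in> topspace (Euclidean_space n)" "b \<in> topspace (Euclidean_space n)" "c \<in> topspace (Euclidean_space n)"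
    and r: "0 < r" and "a \<noteq> c" and near: "ed n a b < 2 * r \<Longrightarrow> ed n c b < r"
  shows "L2_set (push_vec n r a b c) {..<n} \<noteq> 0"
proof
  assume 0: "L2_set (push_vec n r a b c) {..<n} = 0"
  define l where "l = cutoff r (ed n a b)"
  have l: "0 \<le> l" "l \<le> 1"
    by (auto simp: l_def cutoff_def)
  have eq: "a i = l * c i + (1 - l) * b i" if "i < n" for i
    using 0 that by (simp add: L2_set_eq_0_iff push_vec_def l_def)
  have "ed n a b = L2_set (\<lambda>i. l * (c i - b i)) {..<n}"
    unfolding ed_def by (rule L2_set_cong) (auto simp: eq algebra_simps)
  then have d: "ed n a b = l * ed n c b"
    by (simp add: L2_set_right_distrib l ed_def)
  show False
  proof (cases "l = 1")
    case True
    then have "ed n a c = 0"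
      using eq by (simp add: ed_def L2_set_eq_0_iff)
    with assms show False
      by (simp add: ed_eq_0_iff)
  next
    case False
    with l have "2 - ed n a b / r < 1"
      by (auto simp: l_def cutoff_def max_def min_def split: if_splits)
    with r have far: "r < ed n a b"
      by (simp add: field_simps)
    have "ed n a b < 2 * r"
    proof (rule ccontr)
      assume "\<not> ed n a b < 2 * r"
      with r have "l = 0"
        by (auto simp: l_def cutoff_def field_simps)
      with d far r show False
        by simp
    qed
    then have "ed n c b < r"
      by (rule near)
    moreover have "l * ed n c b \<le> ed n c b"
      using l by (simp add: mult_left_le_one_le)
    ultimately show False
      using d far by simp
  qed
qed

text \<open>From distance \<open>2 * r\<close> on the displacement is switched off, so both sides
  depend on \<open>a\<close> and \<open>b\<close> alone and are opposite directions.\<close>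

lemma push_far:
  assumes "0 < r" "2 * r \<le> ed (Suc m) a b"
  shows "push m r a b c = antipode (push m r b a d)"
proof -
  have "cutoff r (ed (Suc m) a b) = 0" "cutoff r (ed (Suc m) b a) = 0"
    using assms by (auto simp: cutoff_def field_simps ed_commute [of _ b])
  then show ?thesis
    by (simp add: push_def push_vec_def antipode_def L2_set_def power2_commute fun_eq_iff
        minus_divide_left del: sum.lessThan_Suc)
qed

lemma continuous_map_cutoff:
  assumes "continuous_map T euclideanreal r" "continuous_map T euclideanreal d" "\<And>t. t \<in> topspace T \<Longrightarrow> 0 < r t"
  shows "continuous_map T euclideanreal (\<lambda>t. cutoff (r t) (d t))"
  unfolding cutoff_def using assms by (intro continuous_intros) (auto simp: less_le)

lemma continuous_map_push:
  assumes r: "continuous_map T euclideanreal r" "\<And>t. t \<in> topspace T \<Longrightarrow> 0 < r t"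
    and a: "continuous_map T (Euclidean_space (Suc m)) a"
    and b: "continuous_map T (Euclidean_space (Suc m)) b"
    and c: "continuous_map T (Euclidean_space (Suc m)) c"
    and ne: "\<And>t. t \<in> topspace T \<Longrightarrow> a t \<noteq> c t"
    and near: "\<And>t. \<lbrakk>t \<in> topspace T; ed (Suc m) (a t) (b t) < 2 * r t\<rbrakk> \<Longrightarrow> ed (Suc m) (c t) (b t) < r t"
  shows "continuous_map T (nsphere m) (\<lambda>t. push m (r t) (a t) (b t) (c t))"
proof -
  let ?v = "\<lambda>t. push_vec (Suc m) (r t) (a t) (b t) (c t)"
  have E: "a t \<in> topspace (Euclidean_space (Suc m))" "b t \<in> topspace (Euclidean_space (Suc m))"
    "c t \<in> topspace (Euclidean_space (Suc m))" if "t \<in> topspace T" for t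
    using a b c that by (auto simp: continuous_map_def)
  have nz: "L2_set (?v t) {..<Suc m} \<noteq> 0" if "t \<in> topspace T" for t
    using push_vec_nonzero E [OF that] r(2) ne near that by blast
  have v: "continuous_map T euclideanreal (\<lambda>t. ?v t i)" for i
    unfolding push_vec_def
    by (intro continuous_intros continuous_map_cutoff continuous_map_ed r a b c
        continuous_map_Euclidean_component [OF a] continuous_map_Euclidean_component [OF b]
        continuous_map_Euclidean_component [OF c]) auto
  have L: "continuous_map T euclideanreal (\<lambda>t. L2_set (?v t) {..<Suc m})"
    unfolding L2_set_def by (intro continuous_intros v) auto
  have "continuous_map T euclideanreal (\<lambda>t. push m (r t) (a t) (b t) (c t) i)" for i
    unfolding push_def by (intro continuous_intros v L nz)
  moreover have "(\<Sum>i\<le>m. (push m (r t) (a t) (b t) (c t) i)\<^sup>2) = 1" if t: "t \<in> topspace T" for t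
  proof -
    have "(\<Sum>i\<le>m. (push m (r t) (a t) (b t) (c t) i)\<^sup>2) = (\<Sum>i<Suc m. (?v t i)\<^sup>2) / (L2_set (?v t) {..<Suc m})\<^sup>2"
      by (simp only: push_def power_divide sum_divide_distrib lessThan_Suc_atMost)
    also have "\<dots> = 1"
      using nz [OF t] by (simp add: L2_set_def sum_nonneg del: sum.lessThan_Suc)
    finally show ?thesis .
  qed
  moreover have "push m (r t) (a t) (b t) (c t) i = 0" if "t \<in> topspace T" "m < i" for t i
    using push_vec_in_Euclidean_space [OF E, OF that(1) that(1) that(1)] that(2)
    by (simp add: push_def topspace_Euclidean_space)
  ultimately show ?thesis
    by (auto simp: nsphere continuous_map_in_subtopology continuous_map_componentwise_UNIV)
qed

text \<open>For disjoint maps \<open>f\<close> and \<open>g\<close> into \<open>\<real>\<^bsup>m+1\<^esup>\<close> that are close to each other near \<open>x\<close>, and a local homology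
  class \<open>c\<close> at \<open>x\<close>, compare the two directions \<open>f y - g x\<close> and \<open>g y - f x\<close> for \<open>y\<close> near \<open>x\<close>; away from
  \<open>x\<close> both become \<open>f y - f x\<close>.\<close>

definition link :: "nat \<Rightarrow> ('a \<Rightarrow> nat \<Rightarrow> real) \<Rightarrow> ('a \<Rightarrow> nat \<Rightarrow> real) \<Rightarrow> real \<Rightarrow> 'a \<Rightarrow> 'a chain \<Rightarrow> int"
  where "link m f g r x c = sphere_class m
    (difference_chain m (\<lambda>y. push m r (f y) (f x) (g x)) (\<lambda>y. antipode (push m r (f x) (f y) (g y))) c)"

locale disjoint_maps =
  fixes m :: nat and X :: "'a topology" and f g :: "'a \<Rightarrow> nat \<Rightarrow> real"
  assumes m: "0 < m"
    and cf: "continuous_map X (Euclidean_space (Suc m)) f"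
    and cg: "continuous_map X (Euclidean_space (Suc m)) g"
    and disj: "\<lbrakk>x \<in> topspace X; y \<in> topspace X\<rbrakk> \<Longrightarrow> f x \<noteq> g y"
begin

text \<open>Two demands on the points whose \<open>f\<close>-image is nearer than
  \<open>2 * r\<close> to that of \<open>x\<close>: they stay out of \<open>A\<close>, so that the
  two directions agree on \<open>A\<close>, and \<open>g\<close> is close to \<open>f\<close> at
  them, so that the directions are defined. Nearness is measured through \<open>f\<close>, which
  saves a metric on \<open>X\<close>.\<close>

definition admissible :: "real \<Rightarrow> 'a \<Rightarrow> 'a set \<Rightarrow> bool"
  where "admissible r x A \<longleftrightarrow> 0 < r \<and> x \<in> topspace X \<and>
    (\<forall>y \<in> topspace X. ed (Suc m) (f y) (f x) < 2 * r \<longrightarrow> y \<notin> A \<and> ed (Suc m) (g y) (f y) < r)"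

lemma continuous_map_push_pair:
  assumes r: "continuous_map T euclideanreal r" "\<And>t. t \<in> topspace T \<Longrightarrow> 0 < r t"
    and x: "continuous_map T X x" and y: "continuous_map T X y"
    and near: "\<And>t. \<lbrakk>t \<in> topspace T; ed (Suc m) (f (y t)) (f (x t)) < 2 * r t\<rbrakk>
      \<Longrightarrow> ed (Suc m) (g (y t)) (f (y t)) < r t \<and> ed (Suc m) (g (x t)) (f (x t)) < r t"
  shows "continuous_map T (nsphere m) (\<lambda>t. push m (r t) (f (y t)) (f (x t)) (g (x t)))"
    and "continuous_map T (nsphere m) (\<lambda>t. antipode (push m (r t) (f (x t)) (f (y t)) (g (y t))))"
proof -
  note comp = continuous_map_compose [OF _ cf, unfolded o_def] continuous_map_compose [OF _ cg, unfolded o_def]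
  have X: "x t \<in> topspace X" "y t \<in> topspace X" if "t \<in> topspace T" for t
    using x y that by (auto simp: continuous_map_def)
  show "continuous_map T (nsphere m) (\<lambda>t. push m (r t) (f (y t)) (f (x t)) (g (x t)))"
    using near disj X by (intro continuous_map_push comp r x y) auto
  have "continuous_map T (nsphere m) (\<lambda>t. push m (r t) (f (x t)) (f (y t)) (g (y t)))"
    using near disj X by (intro continuous_map_push comp r x y) (auto simp: ed_commute)
  from continuous_map_compose [OF this continuous_map_antipode]
  show "continuous_map T (nsphere m) (\<lambda>t. antipode (push m (r t) (f (x t)) (f (y t)) (g (y t))))"
    by (simp add: o_def)
qed

lemma admissible_far:
  assumes "admissible r x A" "y \<in> topspace X" "y \<in> A"
  shows "push m r (f y) (f x) (g x) = antipode (push m r (f x) (f y) (g y))"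
  using assms by (intro push_far) (auto simp: admissible_def)

lemma admissible_close:
  assumes "admissible r x A" "y \<in> topspace X" "ed (Suc m) (f y) (f x) < 2 * r"
  shows "ed (Suc m) (g y) (f y) < r \<and> ed (Suc m) (g x) (f x) < r"
  using assms by (auto simp: admissible_def)

lemma continuous_map_push_admissible:
  assumes "admissible r x A"
  shows "continuous_map X (nsphere m) (\<lambda>y. push m r (f y) (f x) (g x))"
    and "continuous_map X (nsphere m) (\<lambda>y. antipode (push m r (f x) (f y) (g y)))"
  using admissible_close [OF assms] assms
    continuous_map_push_pair [where T = X and r = "\<lambda>_. r" and x = "\<lambda>_. x" and y = "\<lambda>y. y"]
  by (auto simp: admissible_def)

lemma link_cycle:
  assumes "admissible r x A" "singular_relcycle m X A a"
  shows "singular_relcycle m (nsphere m) {}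
    (difference_chain m (\<lambda>y. push m r (f y) (f x) (g x)) (\<lambda>y. antipode (push m r (f x) (f y) (g y))) a)"
  using singular_cycle_difference_chain [OF continuous_map_push_admissible [OF assms(1)] admissible_far [OF assms(1)]] assms(2)
  by blast

lemma link_homologous:
  assumes ad: "admissible r x A" and a: "singular_relcycle m X A a" and b: "singular_relcycle m X A b"
    and "homologous_rel m X A a b"
  shows "link m f g r x a = link m f g r x b"
  unfolding link_def
  using sphere_class_eq_iff [OF m link_cycle [OF ad a] link_cycle [OF ad b]] assms(4)
    homologous_difference_chain [OF continuous_map_push_admissible [OF ad] admissible_far [OF ad]]
  by blast

lemma link_cmul:
  assumes ad: "admissible r x A" and a: "singular_relcycle m X A a"
  shows "link m f g r x (frag_cmul k a) = k * link m f g r x a"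
  unfolding link_def difference_chain_cmul by (rule sphere_class_cmul [OF m link_cycle [OF ad a]])

text \<open>The point and the radius vary while \<open>A\<close> is fixed, so the directions agree
  on \<open>A\<close> all the time and one relative cycle \<open>c\<close> serves for the whole
  homotopy.\<close>

lemma link_path:
  fixes x :: "real \<Rightarrow> 'a" and r :: "real \<Rightarrow> real"
  assumes x: "continuous_map (top_of_set {0..1}) X x" and r: "continuous_on {0..1} r"
    and ad: "\<And>t. \<lbrakk>0 \<le> t; t \<le> 1\<rbrakk> \<Longrightarrow> admissible (r t) (x t) A"
    and c: "singular_relcycle m X A c"
  shows "link m f g (r 0) (x 0) c = link m f g (r 1) (x 1) c"
proof -
  let ?T = "prod_topology (top_of_set {0..1::real}) X"
  have fst: "continuous_map ?T (top_of_set {0..1::real}) fst" and snd: "continuous_map ?T X snd"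
    by (simp_all add: continuous_map_fst continuous_map_snd)
  have rT: "continuous_map ?T euclideanreal (\<lambda>z. r (fst z))"
    using continuous_map_compose [OF fst, of euclideanreal r] r by (simp add: o_def)
  have xT: "continuous_map ?T X (\<lambda>z. x (fst z))"
    using continuous_map_compose [OF fst x] by (simp add: o_def)
  have pos: "0 < r (fst z)" if "z \<in> topspace ?T" for z
    using ad [of "fst z"] that by (auto simp: admissible_def)
  have close: "ed (Suc m) (g (snd z)) (f (snd z)) < r (fst z) \<and> ed (Suc m) (g (x (fst z))) (f (x (fst z))) < r (fst z)"
    if "z \<in> topspace ?T" "ed (Suc m) (f (snd z)) (f (x (fst z))) < 2 * r (fst z)" for z
    using admissible_close [OF ad [of "fst z"], of "snd z"] that by auto
  have "homologous_rel m (nsphere m) {}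
     (difference_chain m (\<lambda>y. push m (r 0) (f y) (f (x 0)) (g (x 0))) (\<lambda>y. antipode (push m (r 0) (f (x 0)) (f y) (g y))) c)
     (difference_chain m (\<lambda>y. push m (r 1) (f y) (f (x 1)) (g (x 1))) (\<lambda>y. antipode (push m (r 1) (f (x 1)) (f y) (g y))) c)"
    using homologous_difference_chain_homotopy
        [OF continuous_map_push_pair [where x = "\<lambda>z. x (fst z)" and y = snd, OF rT pos xT snd close], where A = A and p = m and c = c]
      admissible_far [OF ad] c
    by simp
  then show ?thesis
    unfolding link_def using sphere_class_eq_iff [OF m link_cycle [OF ad c] link_cycle [OF ad c]] by simp
qed

end

section \<open>Local homology classes of embedded discs\<close>

definition pole :: "nat \<Rightarrow> nat \<Rightarrow> real"
  where "pole m = (\<lambda>i. if i = m then 1 else 0)"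

definition reflect :: "nat \<Rightarrow> (nat \<Rightarrow> real) \<Rightarrow> nat \<Rightarrow> real"
  where "reflect m x = (\<lambda>i. if i = m then - x i else x i)"

text \<open>Identifies the closed upper hemisphere with the closed unit ball; by this map a chain of
  the hemisphere serves as a chain of the disc.\<close>

definition proj :: "nat \<Rightarrow> (nat \<Rightarrow> real) \<Rightarrow> nat \<Rightarrow> real"
  where "proj m x = (\<lambda>i. if i < m then x i else 0)"

abbreviation nrm :: "nat \<Rightarrow> (nat \<Rightarrow> real) \<Rightarrow> real"
  where "nrm m v \<equiv> L2_set v {..<m}"

lemma topspace_nsphere: "topspace (nsphere m) = {x. (nrm m x)\<^sup>2 + (x m)\<^sup>2 = 1 \<and> (\<forall>i>m. x i = 0)}"
  by (simp add: nsphere L2_set_def sum_nonneg flip: lessThan_Suc_atMost)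

lemma pole_in_upper: "pole m \<in> topspace (upper m)"
  by (simp add: topspace_nsphere pole_def L2_set_def)

lemma topspace_nsphere_eq_pole:
  assumes "x \<in> topspace (nsphere m)" "\<And>i. i < m \<Longrightarrow> x i = 0" "0 < x m"
  shows "x = pole m"
proof -
  have "(x m)\<^sup>2 = 1"
    using assms by (simp add: topspace_nsphere L2_set_def)
  then have "x m = 1"
    using assms(3) by (auto simp: power2_eq_1_iff)
  then show ?thesis
    using assms by (auto simp: fun_eq_iff pole_def topspace_nsphere) (metis linorder_neqE_nat)
qed

lemma compact_space_upper: "compact_space (upper m)"
proof -
  have cl: "closedin (powertop_real UNIV) (topspace (upper m))"
  proof -
    have "topspace (upper m) = {x \<in> topspace (powertop_real UNIV). (\<Sum>i\<le>m. (x i)\<^sup>2) \<in> {1}}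
            \<inter> {x \<in> topspace (powertop_real UNIV). x m \<in> {0..}}
            \<inter> topspace (Euclidean_space (Suc m))"
      by (auto simp: nsphere topspace_Euclidean_space Suc_le_eq)
    also have "closedin (powertop_real UNIV) \<dots>"
    proof (intro closedin_Int closedin_Euclidean_space)
      show "closedin (powertop_real UNIV) {x \<in> topspace (powertop_real UNIV). (\<Sum>i\<le>m. (x i)\<^sup>2) \<in> {1}}"
        by (rule closedin_continuous_map_preimage [where Y = euclideanreal])
           (auto intro!: continuous_intros continuous_map_product_projection)
      show "closedin (powertop_real UNIV) {x \<in> topspace (powertop_real UNIV). x m \<in> {0..}}"
        by (rule closedin_continuous_map_preimage [where Y = euclideanreal])
           (auto intro!: continuous_intros continuous_map_product_projection)
    qed
    finally show ?thesis .
  qed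
  moreover have "topspace (upper m) \<subseteq> UNIV \<rightarrow>\<^sub>E {-1..1}"
  proof -
    have "\<bar>x i\<bar> \<le> 1" if "x \<in> topspace (nsphere m)" for x i
      using topspace_nsphere_1 [OF that, of i] by (simp add: abs_square_le_1)
    then show ?thesis
      by (auto simp: abs_le_iff)
  qed
  moreover have "compactin (powertop_real UNIV) (UNIV \<rightarrow>\<^sub>E {-1..1})"
    by (simp add: compactin_PiE)
  ultimately have "compactin (powertop_real UNIV) (topspace (upper m))"
    using closed_compactin by blast
  moreover have "upper m = subtopology (powertop_real UNIV) (topspace (upper m))"
    by (simp add: nsphere subtopology_subtopology)
  ultimately show ?thesis
    by (metis compact_space_subtopology)
qed

text \<open>Move each point along its segment to the opposite pole and project radially to the
  sphere. The segment meets the closed ray from 0 through \<open>pole m\<close> only if it starts at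
  the pole.\<close>

lemma contractible_punctured_nsphere: "contractible_space (subtopology (nsphere m) (- {pole m}))"
proof -
  let ?X = "subtopology (nsphere m) (- {pole m})"
  let ?T = "prod_topology (top_of_set {0..1::real}) ?X"
  define w where "w = (\<lambda>(t::real, x) i. (1 - t) * x i - t * pole m i)"
  define h where "h = (\<lambda>z i. w z i / nrm (Suc m) (w z))"
  have nz: "nrm (Suc m) (w (t, x)) \<noteq> 0" if tx: "(t, x) \<in> topspace ?T" for t x
  proof
    assume "nrm (Suc m) (w (t, x)) = 0"
    then have eq: "(1 - t) * x i = t * pole m i" if "i < Suc m" for i
      using that by (simp add: w_def L2_set_eq_0_iff del: L2_set_insert)
    show False
    proof (cases "t = 1")
      case True
      then show False
        using eq [of m] by (simp add: pole_def)
    next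
      case False
      then have x0: "x i = 0" if "i < m" for i
        using eq [of i] that by (simp add: pole_def)
      have "0 \<le> (1 - t) * x m"
        using eq [of m] tx by (simp add: pole_def)
      then have "0 \<le> x m"
        using False tx by (simp add: zero_le_mult_iff)
      moreover have "(x m)\<^sup>2 = 1"
        using tx x0 by (simp add: topspace_nsphere L2_set_def)
      ultimately have "x = pole m"
        using tx by (intro topspace_nsphere_eq_pole x0) (auto simp: less_le)
      then show False
        using tx by simp
    qed
  qed
  have snd: "continuous_map ?T euclideanreal (\<lambda>z. snd z i)" for i
    using continuous_map_compose [OF continuous_map_snd, of ?X euclideanreal "\<lambda>x. x i" "top_of_set {0..1::real}"]
    by (simp add: o_def continuous_map_from_subtopology continuous_map_nsphere_projection)
  have fst: "continuous_map ?T euclideanreal fst"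
    using continuous_map_into_fulltopology continuous_map_fst by blast
  have cw: "continuous_map ?T euclideanreal (\<lambda>z. w z i)" for i
    unfolding w_def case_prod_unfold by (intro continuous_intros fst snd) auto
  have cN: "continuous_map ?T euclideanreal (\<lambda>z. nrm (Suc m) (w z))"
    unfolding L2_set_def by (intro continuous_intros cw) auto
  have cth: "continuous_map ?T euclideanreal (\<lambda>z. h z i)" for i
    unfolding h_def using nz by (intro continuous_intros cw cN) auto
  have h_sphere: "(\<Sum>i\<le>m. (h (t, x) i)\<^sup>2) = 1" if "(t, x) \<in> topspace ?T" for t x
  proof -
    have "(\<Sum>i\<le>m. (h (t, x) i)\<^sup>2) = (\<Sum>i<Suc m. (w (t, x) i)\<^sup>2) / (nrm (Suc m) (w (t, x)))\<^sup>2"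
      by (simp only: h_def power_divide sum_divide_distrib lessThan_Suc_atMost)
    also have "\<dots> = 1"
      using nz [OF that] by (simp add: L2_set_def sum_nonneg del: sum.lessThan_Suc)
    finally show ?thesis .
  qed
  have h_0: "h (t, x) i = 0" if "(t, x) \<in> topspace ?T" "m < i" for t x i
    using that by (auto simp: h_def w_def topspace_nsphere pole_def)
  have h_pole: "h (t, x) \<noteq> pole m" if tx: "(t, x) \<in> topspace ?T" for t x
  proof
    assume hp: "h (t, x) = pole m"
    have N: "0 < nrm (Suc m) (w (t, x))"
      using nz [OF tx] by (simp add: less_le)
    have w: "w (t, x) i = nrm (Suc m) (w (t, x)) * pole m i" for i
      using fun_cong [OF hp, of i] N by (simp add: h_def field_simps)
    have t: "0 \<le> t" "t \<le> 1"
      using tx by auto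
    have "0 < (1 - t) * x m - t"
      using w [of m] N by (simp add: w_def pole_def)
    with t have pos: "0 < (1 - t) * x m"
      by linarith
    then have "x i = 0" if "i < m" for i
      using w [of i] that by (auto simp: w_def pole_def)
    moreover have "0 < x m"
      using pos t by (simp add: zero_less_mult_iff)
    ultimately have "x = pole m"
      using tx by (intro topspace_nsphere_eq_pole) auto
    then show False
      using tx by simp
  qed
  have "h z \<in> {x. (\<Sum>i\<le>m. (x i)\<^sup>2) = 1 \<and> (\<forall>i>m. x i = 0)} \<inter> - {pole m}" if "z \<in> topspace ?T" for z
  proof -
    obtain t x where z: "z = (t, x)"
      by fastforce
    then have tx: "(t, x) \<in> topspace ?T"
      using that by simp
    show ?thesis
      using h_sphere [OF tx] h_0 [OF tx] h_pole [OF tx] unfolding z by blast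
  qed
  then have ch: "continuous_map ?T ?X h"
    unfolding nsphere subtopology_subtopology continuous_map_in_subtopology continuous_map_componentwise_UNIV
    using cth by (simp only: nsphere Pi_iff subtopology_subtopology) blast
  have h0: "h (0, x) = x" if "x \<in> topspace ?X" for x
  proof -
    have "nrm (Suc m) x = 1"
      using that by (simp add: nsphere L2_set_def lessThan_Suc_atMost del: sum.lessThan_Suc)
    then show ?thesis
      by (simp add: h_def w_def del: L2_set_insert)
  qed
  have h1: "h (1, x) = h (1, pole m)" for x
    by (simp add: h_def w_def)
  have "homotopic_with (\<lambda>x. True) ?X ?X (\<lambda>x. h (0, x)) (\<lambda>x. h (1, x))"
    unfolding homotopic_with_def using ch by blast
  moreover have "homotopic_with (\<lambda>x. True) ?X ?X (\<lambda>x. h (0, x)) id"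
    using h0 continuous_map_id by (intro homotopic_with_equal) (auto intro: continuous_map_eq [of _ _ id])
  ultimately have "homotopic_with (\<lambda>x. True) ?X ?X id (\<lambda>x. h (1, pole m))"
    using h1 homotopic_with_symD homotopic_with_trans by (metis (no_types, lifting) ext)
  then show ?thesis
    by (auto simp: contractible_space_def)
qed

section \<open>Local homology carried by a hemisphere chain\<close>

context
  fixes m :: nat and k :: "(nat \<Rightarrow> real) chain"
  assumes m: "0 < m" and k: "rel_generator m (upper m) {x. x m = 0} k"
begin

lemma hemisphere_chain: "singular_chain m (upper m) k" "singular_relcycle m (upper m) {x. x m = 0} k"
  using k by (auto simp: rel_generator_def singular_relcycle)

lemma reflect_hemisphere_chain:
  "singular_chain m (subtopology (nsphere m) {x. x m \<le> 0}) (chain_map m (reflect m) k)"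
proof -
  have "continuous_map (upper m) (subtopology (nsphere m) {x. x m \<le> 0}) (reflect m)"
    using continuous_map_nsphere_reflection [of m m]
    by (auto simp: continuous_map_in_subtopology continuous_map_from_subtopology reflect_def [abs_def])
  then show ?thesis
    using hemisphere_chain(1) singular_chain_chain_map by blast
qed

text \<open>The reflection fixes the equator, so the boundaries cancel: the double of the disc is
  the sphere.\<close>

lemma rel_generator_double_hemisphere:
  "rel_generator m (nsphere m) {} (k - chain_map m (reflect m) k)"
proof -
  have "singular_relcycle m (nsphere m) {} (difference_chain m id (reflect m) k)"
    using continuous_map_nsphere_reflection [of m m]
    by (intro singular_cycle_difference_chain [OF _ _ _ hemisphere_chain(2)])
       (auto simp: continuous_map_in_subtopology continuous_map_from_subtopology reflect_def [abs_def])
  then have "singular_relcycle m (nsphere m) {} (k + - chain_map m (reflect m) k)"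
    by (simp add: difference_chain_def chain_map_ident [OF hemisphere_chain(1)])
  from rel_generator_upper_imp_nsphere [OF k m _ this] reflect_hemisphere_chain show ?thesis
    by (simp add: singular_chain_minus)
qed

text \<open>The double generates the homology of the sphere, also relative to the contractible
  complement of the pole. Its reflected half lies in that complement, so \<open>k\<close> alone is a
  generator there.\<close>

lemma rel_generator_punctured_hemisphere: "rel_generator m (upper m) (topspace (upper m) - {pole m}) k"
proof -
  let ?S = "nsphere m" and ?P = "- {pole m}"
  let ?z = "k - chain_map m (reflect m) k"
  have ne: "antipode (pole m) \<in> topspace ?S \<inter> ?P"
    by (auto simp: topspace_nsphere pole_def antipode_def L2_set_def fun_eq_iff intro!: exI [of _ m])
  have "hom_induced (int m) ?S {} ?S ?P id \<in> iso (homology_group (int m) ?S) (relative_homology_group (int m) ?S ?P)"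
    using iso_reduced_homology_by_contractible [OF contractible_punctured_nsphere [of m], of "int m"] ne m
    by (auto simp: un_reduced_homology_group)
  from iso_rel_generator_chain_map_iff [OF _ _ this, of ?z] rel_generator_double_hemisphere
  have "rel_generator m ?S ?P (chain_map m id ?z)"
    by (auto simp: rel_generator_def)
  moreover have "chain_map m id ?z = ?z"
    using rel_generator_double_hemisphere by (intro chain_map_ident [of _ ?S]) (auto simp: rel_generator_def singular_relcycle)
  ultimately have z: "rel_generator m ?S ?P ?z"
    by simp
  have "singular_chain m (subtopology ?S ?P) (chain_map m (reflect m) k)"
    by (rule singular_chain_mono [OF reflect_hemisphere_chain]) (auto simp: pole_def)
  then have hom: "homologous_rel m ?S ?P k ?z"
    by (simp add: homologous_rel_def singular_chain_imp_relboundary)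
  have gk: "rel_generator m ?S ?P k"
    using z hom unfolding rel_generator_def
    by (meson homologous_rel_cmul homologous_rel_singular_relcycle homologous_rel_sym homologous_rel_trans)
  \<comment> \<open>The open lower hemisphere is excised; its closure does not contain the
    pole.\<close>
  let ?U = "{x. x m < (0::real)}"
  have cl: "closedin ?S {x \<in> topspace ?S. x m \<in> {..0}}"
    by (rule closedin_continuous_map_preimage [OF continuous_map_nsphere_projection]) auto
  have "?S closure_of ?U \<subseteq> {x \<in> topspace ?S. x m \<in> {..0}}"
    by (subst closure_of_restrict, rule closure_of_minimal [OF _ cl]) auto
  also have "\<dots> \<subseteq> topspace ?S - {pole m}"
    by (auto simp: pole_def)
  also have "\<dots> \<subseteq> ?S interior_of ?P"
  proof (rule interior_of_maximal)
    have "Hausdorff_space ?S"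
      by (simp add: nsphere_def Hausdorff_Euclidean_space Hausdorff_space_subtopology)
    then show "openin ?S (topspace ?S - {pole m})"
      using closedin_Hausdorff_sing_eq pole_in_upper by fastforce
  qed auto
  finally have "hom_induced (int m) (subtopology ?S (UNIV - ?U)) (?P - ?U) (subtopology ?S UNIV) ?P id
      \<in> iso (relative_homology_group (int m) (subtopology ?S (UNIV - ?U)) (?P - ?U))
            (relative_homology_group (int m) (subtopology ?S UNIV) ?P)"
    by (rule homology_excision_axiom) auto
  moreover have "UNIV - ?U = {x. 0 \<le> x m}"
    by auto
  ultimately have iso: "hom_induced (int m) (upper m) (?P - ?U) ?S ?P id
      \<in> iso (relative_homology_group (int m) (upper m) (?P - ?U)) (relative_homology_group (int m) ?S ?P)"
    by simp
  have P: "topspace (upper m) \<inter> (?P - ?U) = topspace (upper m) - {pole m}"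
    by auto
  have "singular_relcycle m (upper m) (topspace (upper m) \<inter> (?P - ?U)) k"
    unfolding P by (rule singular_relcycle_mono [of _ _ "topspace (upper m) \<inter> {x. x m = 0}"])
      (use hemisphere_chain in \<open>auto simp: pole_def simp del: topspace_subtopology\<close>)
  then have cyc: "singular_relcycle m (upper m) (?P - ?U) k"
    by (simp only: singular_relcycle_restrict)
  have "rel_generator m ?S ?P (chain_map m id k)"
    using gk by (simp add: chain_map_ident [OF hemisphere_chain(1)])
  with iso_rel_generator_chain_map_iff [OF _ _ iso cyc]
  have "rel_generator m (upper m) (?P - ?U) k"
    by (auto simp: continuous_map_from_subtopology)
  then have "rel_generator m (upper m) (topspace (upper m) \<inter> (?P - ?U)) k"
    by (simp only: rel_generator_restrict)
  then show ?thesis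
    unfolding P .
qed

text \<open>An injection of a compact space into a Hausdorff space is a homeomorphism onto its
  image, whose complement can be excised: by \<open>W\<close> the image of the pole is an interior
  point.\<close>

lemma rel_generator_embedded_hemisphere:
  fixes X :: "'a topology"
  assumes X: "Hausdorff_space X" and cont: "continuous_map (upper m) X h"
    and inj: "inj_on h (topspace (upper m))"
    and W: "openin X W" "h (pole m) \<in> W" "W \<subseteq> h ` topspace (upper m)"
  shows "rel_generator m X (topspace X - {h (pole m)}) (chain_map m h k)"
proof -
  define Z where "Z = h ` topspace (upper m)"
  have ZX: "Z \<subseteq> topspace X"
    using cont by (auto simp: Z_def continuous_map_def)
  have cZ: "continuous_map (upper m) (subtopology X Z) h"
    using cont by (auto simp: continuous_map_in_subtopology Z_def)
  have homeo: "homeomorphic_map (upper m) (subtopology X Z) h"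
    using ZX inj by (intro continuous_imp_homeomorphic_map cZ compact_space_upper Hausdorff_space_subtopology X)
      (auto simp: Z_def)
  let ?S = "topspace (upper m) - {pole m}"
  have img: "h ` ?S = Z - {h (pole m)}"
    unfolding Z_def using inj_onD [OF inj] pole_in_upper [of m] by blast
  have iso1: "hom_induced (int m) (upper m) ?S (subtopology X Z) (Z - {h (pole m)}) h
      \<in> iso (relative_homology_group (int m) (upper m) ?S) (relative_homology_group (int m) (subtopology X Z) (Z - {h (pole m)}))"
    by (rule homeomorphic_map_relative_homology_iso [OF homeo _ img]) auto
  have "h \<in> ?S \<rightarrow> Z - {h (pole m)}"
    using img by blast
  from iso_rel_generator_chain_map_iff [OF cZ this iso1] rel_generator_punctured_hemisphere
  have gZ: "rel_generator m (subtopology X Z) (Z - {h (pole m)}) (chain_map m h k)"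
    by (auto simp: rel_generator_def)
  let ?U = "topspace X - Z" and ?T = "topspace X - {h (pole m)}"
  have "X closure_of ?U \<subseteq> topspace X - W"
    using W by (intro closure_of_minimal) (auto simp: Z_def)
  also have "\<dots> \<subseteq> ?T"
    using W by auto
  also have "\<dots> \<subseteq> X interior_of ?T"
    using X closedin_Hausdorff_sing_eq [OF X, of "h (pole m)"] openin_subset [OF W(1)] W(2)
    by (intro interior_of_maximal) auto
  finally have "hom_induced (int m) (subtopology X (topspace X - ?U)) (?T - ?U) (subtopology X (topspace X)) ?T id
      \<in> iso (relative_homology_group (int m) (subtopology X (topspace X - ?U)) (?T - ?U))
            (relative_homology_group (int m) (subtopology X (topspace X)) ?T)"
    by (rule homology_excision_axiom) auto
  moreover have "topspace X - ?U = Z" "?T - ?U = Z - {h (pole m)}"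
    using ZX by auto
  ultimately have iso2: "hom_induced (int m) (subtopology X Z) (Z - {h (pole m)}) X ?T id
      \<in> iso (relative_homology_group (int m) (subtopology X Z) (Z - {h (pole m)})) (relative_homology_group (int m) X ?T)"
    by simp
  have "rel_generator m X ?T (chain_map m id (chain_map m h k))"
    by (subst iso_rel_generator_chain_map_iff [OF _ _ iso2])
       (use gZ ZX in \<open>auto simp: continuous_map_from_subtopology rel_generator_def\<close>)
  moreover have "chain_map m id (chain_map m h k) = chain_map m h k"
    using gZ by (intro chain_map_ident [of _ "subtopology X Z"]) (auto simp: rel_generator_def singular_relcycle)
  ultimately show ?thesis
    by simp
qed

end

section \<open>Balls and charts\<close>

definition nball :: "nat \<Rightarrow> real \<Rightarrow> (nat \<Rightarrow> real) set"
  where "nball m r = {v \<in> topspace (Euclidean_space m). nrm m v < r}"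

lemma continuous_map_nrm: "continuous_map (Euclidean_space m) euclideanreal (nrm m)"
  unfolding L2_set_def
  by (intro continuous_intros continuous_map_Euclidean_component [OF continuous_map_id [unfolded id_def]]) auto

lemma openin_ed_less:
  assumes "c \<in> topspace (Euclidean_space m)"
  shows "openin (Euclidean_space m) {v \<in> topspace (Euclidean_space m). ed m v c < r}"
proof -
  have "continuous_map (Euclidean_space m) euclideanreal (\<lambda>v. ed m v c)"
    using assms by (intro continuous_map_ed) auto
  from openin_continuous_map_preimage [OF this, of "{..<r}"] show ?thesis
    by simp
qed

lemma proj_in_Euclidean_space [simp]: "proj m x \<in> topspace (Euclidean_space m)"
  by (simp add: proj_def topspace_Euclidean_space)

lemma nrm_proj: "nrm m (proj m x) = nrm m x"
  by (rule L2_set_cong) (auto simp: proj_def)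

lemma nrm_le_1_nsphere: "x \<in> topspace (nsphere m) \<Longrightarrow> nrm m x \<le> 1"
  by (simp add: topspace_nsphere) (smt (verit) abs_square_le_1 abs_of_nonneg L2_set_nonneg zero_le_power2)

lemma continuous_map_proj: "continuous_map (nsphere m) (Euclidean_space m) (proj m)"
  unfolding proj_def continuous_map_componentwise_Euclidean_space
  by (simp add: continuous_map_nsphere_projection)

lemma inj_on_proj_upper: "inj_on (proj m) (topspace (upper m))"
proof (rule inj_onI)
  fix x y assume xy: "x \<in> topspace (upper m)" "y \<in> topspace (upper m)" and eq: "proj m x = proj m y"
  then have lt: "x i = y i" if "i < m" for i
    using fun_cong [OF eq, of i] that unfolding proj_def by simp
  have "nrm m x = nrm m y"
    using eq by (metis nrm_proj)
  moreover have "(nrm m x)\<^sup>2 + (x m)\<^sup>2 = 1" "(nrm m y)\<^sup>2 + (y m)\<^sup>2 = 1"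
    using xy by (auto simp: topspace_nsphere)
  ultimately have "(x m)\<^sup>2 = (y m)\<^sup>2"
    by (metis add_left_imp_eq)
  then have "x m = y m"
    using xy by (auto intro: power2_eq_imp_eq)
  moreover have "x i = y i" if "m < i" for i
    using xy that by (simp add: topspace_nsphere)
  ultimately show "x = y"
    using lt by (metis ext linorder_neqE_nat)
qed

lemma proj_upper_lift:
  assumes "v \<in> topspace (Euclidean_space m)" "nrm m v \<le> 1"
  obtains x where "x \<in> topspace (upper m)" "proj m x = v"
proof
  let ?x = "\<lambda>i. if i = m then sqrt (1 - (nrm m v)\<^sup>2) else v i"
  have "nrm m ?x = nrm m v"
    by (rule L2_set_cong) auto
  moreover have "(nrm m v)\<^sup>2 \<le> 1"
    using assms(2) by (simp add: power_le_one)
  ultimately show "?x \<in> topspace (upper m)"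
    using assms by (simp add: topspace_nsphere topspace_Euclidean_space)
  show "proj m ?x = v"
    using assms by (auto simp: proj_def topspace_Euclidean_space fun_eq_iff)
qed

lemma nrm_triangle: "nrm m (\<lambda>i. v i + w i) \<le> nrm m v + nrm m w"
  by (rule L2_set_triangle_ineq)

lemma nrm_scale: "nrm m (\<lambda>i. t * v i) = \<bar>t\<bar> * nrm m v"
  by (simp add: L2_set_def power_mult_distrib real_sqrt_mult flip: sum_distrib_left)

text \<open>The radius leaves room for translating the unit ball.\<close>

definition chart :: "nat \<Rightarrow> 'a topology \<Rightarrow> ((nat \<Rightarrow> real) \<Rightarrow> 'a) \<Rightarrow> bool"
  where "chart m X h \<longleftrightarrow> continuous_map (subtopology (Euclidean_space m) (nball m 3)) X h \<and> inj_on h (nball m 3) \<and>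
    (\<forall>U. openin (Euclidean_space m) U \<and> U \<subseteq> nball m 3 \<longrightarrow> openin X (h ` U))"

lemma continuous_map_chart:
  assumes "chart m X h" "continuous_map T (Euclidean_space m) v" "\<And>t. t \<in> topspace T \<Longrightarrow> nrm m (v t) < 3"
  shows "continuous_map T X (\<lambda>t. h (v t))"
proof -
  have "continuous_map T (subtopology (Euclidean_space m) (nball m 3)) v"
    using assms(2,3) continuous_map_funspace [OF assms(2)] by (auto simp: continuous_map_in_subtopology nball_def)
  from continuous_map_compose [OF this] show ?thesis
    using assms(1) by (auto simp: chart_def o_def)
qed

lemma chart_inj:
  assumes "chart m X h" "h v = h w" "v \<in> topspace (Euclidean_space m)" "w \<in> topspace (Euclidean_space m)"
    "nrm m v < 3" "nrm m w < 3"
  shows "v = w"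
  using assms by (auto simp: chart_def nball_def inj_on_def)

text \<open>One chain serves all points of the open unit ball. Translating the ball by
  \<open>t * w\<close> moves its centre to \<open>w\<close>, and its boundary never meets
  \<open>w\<close>, which is at distance \<open>(1 - t) * nrm m w < 1\<close> from the moving
  centre.\<close>

lemma chart_rel_generator:
  assumes m: "0 < m" and k: "rel_generator m (upper m) {x. x m = 0} k" and X: "Hausdorff_space X"
    and h: "chart m X h" and w: "w \<in> nball m 1"
  shows "rel_generator m X (topspace X - {h w}) (chain_map m (h \<circ> proj m) k)"
proof -
  let ?h = "\<lambda>t x. h (\<lambda>i. t * w i + proj m x i)"
  have wE: "w \<in> topspace (Euclidean_space m)" "nrm m w < 1"
    using w by (auto simp: nball_def)
  have proj_le: "nrm m (proj m x) \<le> 1" if "x \<in> topspace (upper m)" for x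
    using that nrm_le_1_nsphere by (simp add: nrm_proj)
  have bound: "nrm m (\<lambda>i. t * w i + proj m x i) < 3" if "0 \<le> t" "t \<le> 1" "x \<in> topspace (upper m)" for t x
  proof -
    have "nrm m (\<lambda>i. t * w i + proj m x i) \<le> \<bar>t\<bar> * nrm m w + nrm m (proj m x)"
      using nrm_triangle [of "\<lambda>i. t * w i" "proj m x" m] by (simp add: nrm_scale)
    also have "\<bar>t\<bar> * nrm m w \<le> nrm m w"
      using that by (simp add: mult_left_le_one_le)
    finally show ?thesis
      using proj_le [OF that(3)] wE by simp
  qed
  have inE: "(\<lambda>i. t * w i + proj m x i) \<in> topspace (Euclidean_space m)" for t x
    using wE by (simp add: topspace_Euclidean_space proj_def)
  let ?T = "prod_topology (top_of_set {0..1::real}) (upper m)"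
  have fst: "continuous_map ?T euclideanreal fst"
    using continuous_map_into_fulltopology continuous_map_fst by blast
  have "continuous_map ?T (Euclidean_space m) (\<lambda>z. proj m (snd z))"
    using continuous_map_compose [OF continuous_map_snd continuous_map_from_subtopology [OF continuous_map_proj]]
    by (simp add: o_def)
  then have ct: "continuous_map ?T (Euclidean_space m) (\<lambda>z i. fst z * w i + proj m (snd z) i)"
    using inE by (auto simp: continuous_map_Euclidean_space_iff_components intro!: continuous_intros fst)
  then have cH: "continuous_map ?T X (\<lambda>z. ?h (fst z) (snd z))"
    using bound by (intro continuous_map_chart [OF h ct]) auto
  have avoid: "?h t x \<noteq> h w" if tx: "0 \<le> t" "t \<le> 1" "x \<in> topspace (upper m)" "x m = 0" for t x
  proof
    assume "?h t x = h w"
    then have "(\<lambda>i. t * w i + proj m x i) = w"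
      using wE bound [OF tx(1-3)] by (intro chart_inj [OF h]) (auto simp: inE)
    then have "proj m x = (\<lambda>i. (1 - t) * w i)"
      by (auto simp: fun_eq_iff algebra_simps)
    then have "nrm m (proj m x) = (1 - t) * nrm m w"
      using tx nrm_scale [of "1 - t" w m] by simp
    also have "\<dots> \<le> nrm m w"
      using tx by (simp add: mult_left_le_one_le)
    finally have "nrm m x < 1"
      using wE by (simp add: nrm_proj)
    moreover have "(nrm m x)\<^sup>2 = 1"
      using tx by (simp add: topspace_nsphere)
    ultimately show False
      by (simp add: power2_eq_1_iff) (smt (verit) L2_set_nonneg)
  qed
  let ?E = "topspace (upper m) \<inter> {x. x m = 0}"
  have top: "?h t x \<in> topspace X" if "0 \<le> t" "t \<le> 1" "x \<in> topspace (upper m)" for t x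
    using funcset_mem [OF continuous_map_funspace [OF cH], of "(t, x)"] that by simp
  have hw: "homotopic_with (\<lambda>u. u \<in> ?E \<rightarrow> topspace X - {h w}) (upper m) X (?h 0) (?h 1)"
    unfolding homotopic_with_def
  proof (intro exI conjI allI ballI)
    show "continuous_map ?T X (\<lambda>z. ?h (fst z) (snd z))"
      by (rule cH)
  qed (use avoid top in auto)
  have hom: "homologous_rel m X (topspace X - {h w}) (chain_map m (?h 0) k) (chain_map m (?h 1) k)"
    by (rule homotopic_imp_homologous_rel_chain_maps [OF hw])
       (use k in \<open>simp add: rel_generator_def del: topspace_subtopology\<close>)
  have pole: "?h 1 (pole m) = h w"
    by (rule arg_cong [of _ _ h]) (auto simp: proj_def pole_def fun_eq_iff)
  \<comment> \<open>The translated open ball; its image is the neighbourhood that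
    \<open>rel_generator_embedded_hemisphere\<close> asks for.\<close>
  let ?U = "{v \<in> topspace (Euclidean_space m). ed m v w < 1}"
  have U3: "?U \<subseteq> nball m 3"
  proof
    fix v assume v: "v \<in> ?U"
    have "nrm m v \<le> ed m v w + nrm m w"
      using nrm_triangle [of "\<lambda>i. v i - w i" w m] by (simp add: ed_def)
    then show "v \<in> nball m 3"
      using v wE by (simp add: nball_def)
  qed
  have img: "h ` ?U \<subseteq> ?h 1 ` topspace (upper m)"
  proof clarify
    fix v assume v: "v \<in> topspace (Euclidean_space m)" "ed m v w < 1"
    obtain x where x: "x \<in> topspace (upper m)" "proj m x = (\<lambda>i. v i - w i)"
      using proj_upper_lift [of "\<lambda>i. v i - w i" m] wE v by (auto simp: ed_def topspace_Euclidean_space)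
    have "h v = ?h 1 x"
      by (simp add: x(2))
    then show "h v \<in> ?h 1 ` topspace (upper m)"
      using x(1) by (rule image_eqI)
  qed
  have c1: "continuous_map (upper m) X (?h 1)"
    using homotopic_with_imp_continuous_maps [OF hw] by blast
  have inj: "inj_on (?h 1) (topspace (upper m))"
  proof (rule inj_onI)
    fix x y assume xy: "x \<in> topspace (upper m)" "y \<in> topspace (upper m)" "?h 1 x = ?h 1 y"
    then have "(\<lambda>i. 1 * w i + proj m x i) = (\<lambda>i. 1 * w i + proj m y i)"
      by (intro chart_inj [OF h xy(3) inE inE] bound) auto
    then have "proj m x = proj m y"
      by (simp add: fun_eq_iff)
    then show "x = y"
      using xy inj_on_proj_upper by (auto dest: inj_onD)
  qed
  have "w \<in> ?U"
    using wE by simp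
  then have "rel_generator m X (topspace X - {?h 1 (pole m)}) (chain_map m (?h 1) k)"
    using h U3 openin_ed_less [OF wE(1)] pole
    by (intro rel_generator_embedded_hemisphere [OF m k X c1 inj _ _ img]) (auto simp: chart_def)
  then have g1: "rel_generator m X (topspace X - {h w}) (chain_map m (?h 1) k)"
    unfolding pole .
  have h0: "?h 0 = h \<circ> proj m"
    by (simp add: fun_eq_iff)
  show ?thesis
    using g1 hom unfolding rel_generator_def h0
    by (meson homologous_rel_cmul homologous_rel_singular_relcycle homologous_rel_sym homologous_rel_trans)
qed

text \<open>Replacing \<open>f 0\<close>, \<open>g 0\<close> by \<open>f (- t v)\<close>, \<open>g (- t v)\<close> deforms the two directions compared by \<open>link\<close>, glued
  along the equator, into an odd map of the sphere.\<close>

lemma (in disjoint_maps) link_nonzero: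
  assumes k: "rel_generator m (upper m) {x. x m = 0} k"
    and h: "chart m X h" and ad: "admissible r (h (\<lambda>i. 0)) A"
    and A: "\<And>v. \<lbrakk>v \<in> topspace (Euclidean_space m); nrm m v = 1\<rbrakk> \<Longrightarrow> h v \<in> A"
    and far: "\<And>v t. \<lbrakk>v \<in> topspace (Euclidean_space m); nrm m v = 1; 0 \<le> t; t \<le> 1\<rbrakk>
      \<Longrightarrow> 2 * r \<le> ed (Suc m) (f (h v)) (f (h (\<lambda>i. - t * v i)))"
    and near: "\<And>v. \<lbrakk>v \<in> topspace (Euclidean_space m); nrm m v \<le> 1\<rbrakk> \<Longrightarrow> ed (Suc m) (g (h v)) (f (h v)) < r"
  shows "link m f g r (h (\<lambda>i. 0)) (chain_map m (h \<circ> proj m) k) \<noteq> 0"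
proof -
  have r: "0 < r"
    using ad by (simp add: admissible_def)
  define a where "a x = h (proj m x)" for x
  define b where "b t x = h (\<lambda>i. - t * proj m x i)" for t x
  define P where "P t x = push m r (f (a x)) (f (b t x)) (g (b t x))" for t x
  define Q where "Q t x = antipode (push m r (f (b t x)) (f (a x)) (g (a x)))" for t x
  \<comment> \<open>The sphere is the double of the disc: each hemisphere carries one of the two
    directions.\<close>
  define H where "H = (\<lambda>(t, x). if 0 \<le> x m then P t x else Q t x)"
  let ?T = "prod_topology (top_of_set {0..1::real}) (nsphere m)"
  have nproj: "nrm m (\<lambda>i. - t * proj m x i) \<le> 1" "nrm m (proj m x) \<le> 1"
    if "0 \<le> t" "t \<le> 1" "x \<in> topspace (nsphere m)" for t x
  proof -
    show "nrm m (proj m x) \<le> 1"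
      using nrm_le_1_nsphere that by (simp add: nrm_proj)
    moreover have "nrm m (\<lambda>i. - t * proj m x i) = t * nrm m (proj m x)"
      using nrm_scale [of "- t" "proj m x" m] that by simp
    ultimately show "nrm m (\<lambda>i. - t * proj m x i) \<le> 1"
      using that by (simp add: mult_le_one)
  qed
  have inE: "(\<lambda>i. t * proj m x i) \<in> topspace (Euclidean_space m)" for t x
    by (simp add: topspace_Euclidean_space proj_def)
  have inE': "(\<lambda>i. - (t * proj m x i)) \<in> topspace (Euclidean_space m)" for t x
    by (simp add: topspace_Euclidean_space proj_def)
  have fst: "continuous_map ?T euclideanreal fst"
    using continuous_map_into_fulltopology continuous_map_fst by blast
  have cproj: "continuous_map ?T (Euclidean_space m) (\<lambda>z. proj m (snd z))"
    using continuous_map_compose [OF continuous_map_snd continuous_map_proj] by (simp add: o_def)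
  have ca: "continuous_map ?T X (\<lambda>z. a (snd z))"
    unfolding a_def using nproj(2) by (intro continuous_map_chart [OF h cproj]) fastforce
  have "continuous_map ?T (Euclidean_space m) (\<lambda>z i. - fst z * proj m (snd z) i)"
    using cproj inE' by (auto simp: continuous_map_Euclidean_space_iff_components intro!: continuous_intros fst)
  then have cb: "continuous_map ?T X (\<lambda>z. b (fst z) (snd z))"
    unfolding b_def using nproj(1) by (intro continuous_map_chart [OF h]) (assumption, fastforce)
  have near_ab: "ed (Suc m) (g (a x)) (f (a x)) < r \<and> ed (Suc m) (g (b t x)) (f (b t x)) < r"
    if "0 \<le> t" "t \<le> 1" "x \<in> topspace (nsphere m)" for t x
    unfolding a_def b_def using near nproj [OF that] inE [of "- t" x] by simp
  have cPQ: "continuous_map ?T (nsphere m) (\<lambda>z. P (fst z) (snd z))"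
      "continuous_map ?T (nsphere m) (\<lambda>z. Q (fst z) (snd z))"
    unfolding P_def Q_def by (intro continuous_map_push_pair ca cb; use r near_ab in auto)+
  have agree: "P t x = Q t x" if "0 \<le> t" "t \<le> 1" "x \<in> topspace (nsphere m)" "x m = 0" for t x
  proof -
    have "(nrm m (proj m x))\<^sup>2 = 1"
      using that by (simp add: topspace_nsphere nrm_proj)
    then have "nrm m (proj m x) = 1"
      by (simp add: power2_eq_1_iff) (smt (verit) L2_set_nonneg)
    then have "2 * r \<le> ed (Suc m) (f (a x)) (f (b t x))"
      unfolding a_def b_def using far that by simp
    then show ?thesis
      unfolding P_def Q_def by (rule push_far [OF r])
  qed
  have cH: "continuous_map ?T (nsphere m) H"
    unfolding H_def case_prod_unfold
  proof (rule continuous_map_cases_le)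
    show "continuous_map ?T euclideanreal (\<lambda>z. snd z m)"
      using continuous_map_compose [OF continuous_map_snd continuous_map_nsphere_projection] by (simp add: o_def)
  qed (use cPQ agree in \<open>auto intro: continuous_map_from_subtopology\<close>)
  have top_antipode: "antipode x \<in> topspace (nsphere m)" if "x \<in> topspace (nsphere m)" for x
    using funcset_mem [OF continuous_map_funspace [OF continuous_map_antipode] that] .
  have proj_antipode: "proj m (antipode x) = (\<lambda>i. - 1 * proj m x i)" for x
    by (auto simp: proj_def antipode_def)
  \<comment> \<open>At time 1 the points \<open>a x\<close> and \<open>b 1 x\<close> are opposite
    points of the disc, so the antipode exchanges them, and with them the two directions up to
    sign.\<close>
  have odd: "H (1, antipode x) = antipode (H (1, x))" if x: "x \<in> topspace (nsphere m)" for x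
  proof -
    have ab: "a (antipode x) = b 1 x" "b 1 (antipode x) = a x"
      by (simp_all add: a_def b_def proj_antipode)
    then have PQ: "P 1 (antipode x) = antipode (Q 1 x)" "Q 1 (antipode x) = antipode (P 1 x)"
      by (simp_all add: P_def Q_def)
    show ?thesis
    proof (cases "x m = 0")
      \<comment> \<open>On the equator \<open>x\<close> and its antipode both fall under the upper
        case, so oddness rests on the agreement of \<open>P\<close> and \<open>Q\<close>.\<close>
      case True
      then show ?thesis
        using agree [OF _ _ x True] PQ by (simp add: H_def antipode_def)
    next
      case False
      then show ?thesis
        using PQ by (auto simp: H_def antipode_def)
    qed
  qed
  have hom: "homotopic_with (\<lambda>x. True) (nsphere m) (nsphere m) (\<lambda>x. H (0, x)) (\<lambda>x. H (1, x))"
    unfolding homotopic_with_def using cH by blast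
  then have c01: "continuous_map (nsphere m) (nsphere m) (\<lambda>x. H (0, x))"
      "continuous_map (nsphere m) (nsphere m) (\<lambda>x. H (1, x))"
    by (auto dest: homotopic_with_imp_continuous_maps)
  have "odd (Brouwer_degree2 m (\<lambda>x. H (1, x)))"
    using odd by (intro Borsuk_odd_mapping_degree [OF m c01(2)])
  then have deg: "Brouwer_degree2 m (\<lambda>x. H (0, x)) \<noteq> 0"
    using Brouwer_degree2_homotopic [OF hom] by auto
  let ?z = "k - chain_map m (reflect m) k"
  have gz: "rel_generator m (nsphere m) {} ?z"
    by (rule rel_generator_double_hemisphere [OF m k])
  let ?u = "\<lambda>y. push m r (f y) (f (h (\<lambda>i. 0))) (g (h (\<lambda>i. 0)))"
  let ?v = "\<lambda>y. antipode (push m r (f (h (\<lambda>i. 0))) (f y) (g y))"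
  have P0: "P 0 x = ?u (a x)" and Q0: "Q 0 x = ?v (a x)" for x
    by (simp_all add: P_def Q_def b_def)
  have kch: "singular_chain m (upper m) k"
    by (rule hemisphere_chain [OF m k])
  have "chain_map m (\<lambda>x. H (0, x)) k = chain_map m (?u \<circ> (h \<circ> proj m)) k"
    by (rule chain_map_eq [OF kch]) (simp add: H_def P0 a_def)
  \<comment> \<open>Reflected points lie in the lower hemisphere, where \<open>H\<close> is
    \<open>Q\<close>, and they have the same projection; on the equator \<open>P\<close> and
    \<open>Q\<close> agree.\<close>
  moreover have "chain_map m ((\<lambda>x. H (0, x)) \<circ> reflect m) k = chain_map m (?v \<circ> (h \<circ> proj m)) k"
  proof (rule chain_map_eq [OF kch])
    fix x assume x: "x \<in> topspace (upper m)"
    have "a (reflect m x) = a x"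
      unfolding a_def by (rule arg_cong [of _ _ h]) (auto simp: proj_def reflect_def)
    moreover have "reflect m x = x" if "x m = 0"
      using that by (auto simp: reflect_def)
    ultimately show "((\<lambda>x. H (0, x)) \<circ> reflect m) x = (?v \<circ> (h \<circ> proj m)) x"
      using x agree [of 0 x] by (auto simp: H_def Q0 P0 reflect_def a_def)
  qed
  ultimately have "difference_chain m ?u ?v (chain_map m (h \<circ> proj m) k) = chain_map m (\<lambda>x. H (0, x)) ?z"
    by (simp add: difference_chain_def chain_map_diff chain_map_compose)
  then have "link m f g r (h (\<lambda>i. 0)) (chain_map m (h \<circ> proj m) k)
      = Brouwer_degree2 m (\<lambda>x. H (0, x)) * sphere_class m ?z"
    unfolding link_def using gz by (simp add: sphere_class_chain_map [OF m c01(1)] rel_generator_def)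
  then show ?thesis
    using deg sphere_class_generator [OF m gz] by simp
qed

section \<open>Selecting close embeddings from an uncountable family\<close>

text \<open>By the pigeonhole principle every row is constant along some subsequence of any given
  one; the diagonal sequence settles all rows.\<close>

lemma diagonal_eventually_constant:
  fixes t :: "nat \<Rightarrow> nat \<Rightarrow> 'b"
  assumes B: "finite B" and t: "\<And>n j. t n j \<in> B"
  obtains s :: "nat \<Rightarrow> nat" and v where "strict_mono s" "\<And>n. \<forall>\<^sub>F j in sequentially. t n (s j) = v n"
proof -
  interpret subseqs "\<lambda>n s. \<exists>v. \<forall>\<^sub>F j in sequentially. t n (s j) = v"
  proof
    fix n and s :: "nat \<Rightarrow> nat" assume "strict_mono s"
    have "finite (range (\<lambda>j. t n (s j)))"
      by (rule finite_subset [OF _ B]) (use t in auto)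
    then obtain v where "infinite {j. t n (s j) = v}"
      using pigeonhole_infinite [of "UNIV :: nat set" "\<lambda>j. t n (s j)"] by auto
    from infinite_enumerate [OF this] obtain r :: "nat \<Rightarrow> nat" where "strict_mono r" "\<forall>k. r k \<in> {j. t n (s j) = v}"
      by blast
    then show "\<exists>r'. strict_mono r' \<and> (\<exists>v. \<forall>\<^sub>F j in sequentially. t n ((s \<circ> r') j) = v)"
      by (intro exI [of _ r]) auto
  qed
  have "\<forall>n. \<exists>v. \<forall>\<^sub>F j in sequentially. t n (diagseq j) = v"
  proof
    fix n
    \<comment> \<open>The diagonal sequence is known to refine the nested subsequence for
      \<open>n\<close> from index \<open>Suc n\<close> on.\<close>
    have "\<exists>v. \<forall>\<^sub>F j in sequentially. t n ((diagseq \<circ> ((+) (Suc n))) j) = v"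
    proof (rule diagseq_holds)
      fix r s :: "nat \<Rightarrow> nat" and k assume "strict_mono r" "\<exists>v. \<forall>\<^sub>F j in sequentially. t k (s j) = v"
      then show "\<exists>v. \<forall>\<^sub>F j in sequentially. t k ((s \<circ> r) j) = v"
        using eventually_subseq by fastforce
    qed
    then obtain v where "\<forall>\<^sub>F j in sequentially. t n (diagseq (j + Suc n)) = v"
      by (auto simp: add.commute)
    then show "\<exists>v. \<forall>\<^sub>F j in sequentially. t n (diagseq j) = v"
      using eventually_sequentially_seg [of "\<lambda>j. t n (diagseq j) = v" "Suc n"] by blast
  qed
  then obtain v where "\<forall>n. \<forall>\<^sub>F j in sequentially. t n (diagseq j) = v n"
    by (rule choice [THEN exE])
  then show thesis
    using that [OF subseq_diagseq, of v] by blast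
qed

lemma openin_Euclidean_space_contains_ball:
  assumes V: "openin (Euclidean_space n) V" and v: "v \<in> V"
  obtains r where "0 < r" "\<And>w. \<lbrakk>w \<in> topspace (Euclidean_space n); ed n w v < r\<rbrakk> \<Longrightarrow> w \<in> V"
proof -
  obtain T where T: "openin (powertop_real UNIV) T" and VT: "V = T \<inter> topspace (Euclidean_space n)"
    using V by (auto simp: Euclidean_space_def openin_subtopology)
  obtain U where fin: "finite {i. U i \<noteq> (UNIV :: real set)}" and U: "\<And>i. open (U i)" "v \<in> Pi\<^sub>E UNIV U"
      and UT: "Pi\<^sub>E UNIV U \<subseteq> T"
  proof -
    have "\<exists>U. finite {i \<in> UNIV. U i \<noteq> topspace euclideanreal} \<and> (\<forall>i\<in>UNIV. openin euclideanreal (U i))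
        \<and> v \<in> Pi\<^sub>E UNIV U \<and> Pi\<^sub>E UNIV U \<subseteq> T"
      using T v VT by (simp only: openin_product_topology_alt Int_iff)
    then obtain U where U: "finite {i \<in> UNIV. U i \<noteq> topspace euclideanreal}" "\<forall>i\<in>UNIV. openin euclideanreal (U i)"
        "v \<in> Pi\<^sub>E UNIV U" "Pi\<^sub>E UNIV U \<subseteq> T"
      by blast
    show thesis
      by (rule that [of U]) (use U in simp_all)
  qed
  have "\<forall>i. \<exists>e>0. \<forall>y. \<bar>y - v i\<bar> < e \<longrightarrow> y \<in> U i"
  proof
    fix i
    have "v i \<in> U i"
      using U(2) by (auto simp: PiE_UNIV_domain)
    then show "\<exists>e>0. \<forall>y. \<bar>y - v i\<bar> < e \<longrightarrow> y \<in> U i"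
      using U(1) [of i] by (simp add: open_dist dist_real_def)
  qed
  from choice [OF this] obtain e where "\<forall>i. 0 < e i \<and> (\<forall>y. \<bar>y - v i\<bar> < e i \<longrightarrow> y \<in> U i)" ..
  then have e: "\<And>i. 0 < e i" "\<And>i y. \<bar>y - v i\<bar> < e i \<Longrightarrow> y \<in> U i"
    by blast+
  let ?F = "{i. U i \<noteq> UNIV}"
  \<comment> \<open>A basic open set of the product restricts finitely many coordinates; the 1 keeps
    the minimum defined if there are none. Coordinates from \<open>n\<close> on vanish in all points
    anyway.\<close>
  define r where "r = Min (insert 1 (e ` ?F))"
  have r: "0 < r" "\<And>i. i \<in> ?F \<Longrightarrow> r \<le> e i"
    using fin e(1) unfolding r_def by (simp, intro Min_le) auto
  show thesis
  proof (rule that [OF r(1)])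
    fix w assume w: "w \<in> topspace (Euclidean_space n)" "ed n w v < r"
    have "w i \<in> U i" for i
    proof (cases "i \<in> ?F")
      case True
      have "\<bar>w i - v i\<bar> < r"
      proof (cases "i < n")
        case True
        then have "\<bar>w i - v i\<bar> \<le> ed n w v"
          using member_le_L2_set [of "{..<n}" i "\<lambda>i. \<bar>w i - v i\<bar>"] by (simp add: ed_def L2_set_def)
        then show ?thesis
          using w(2) by linarith
      next
        case False
        moreover have "v \<in> topspace (Euclidean_space n)"
          using v VT by simp
        ultimately show ?thesis
          using w r by (simp add: topspace_Euclidean_space)
      qed
      then show ?thesis
        using r(2) [OF True] by (intro e(2)) linarith
    qed auto
    then have "w \<in> Pi\<^sub>E UNIV U"
      by (auto simp: PiE_UNIV_domain)
    then show "w \<in> V"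
      using UT w(1) VT by blast
  qed
qed

lemma second_countable_Euclidean_space: "second_countable (Euclidean_space n)"
proof -
  obtain \<B> :: "(nat \<Rightarrow> real) set set" where "countable \<B>" "\<And>C. C \<in> \<B> \<Longrightarrow> open C"
    "\<And>S. open S \<Longrightarrow> \<exists>U. U \<subseteq> \<B> \<and> S = \<Union>U"
    using univ_second_countable by blast
  then have "second_countable (euclidean :: (nat \<Rightarrow> real) topology)"
    unfolding second_countable_def by (intro exI [of _ \<B>]) (fastforce simp flip: open_openin)
  then show ?thesis
    by (simp add: Euclidean_space_def euclidean_product_topology second_countable_subtopology)
qed

text \<open>Every map in the family is determined up to a prescribed local accuracy by a finite set of pairs of basic
  open sets, that is, by one of countably many data.\<close>

lemma uncountable_family_accumulates:
  fixes X :: "'a topology" and f :: "'i \<Rightarrow> 'a \<Rightarrow> nat \<Rightarrow> real"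
  assumes X: "second_countable X" and F: "uncountable F"
    and f: "\<And>S. S \<in> F \<Longrightarrow> continuous_map X (Euclidean_space n) (f S)"
  obtains S0 S where "S0 \<in> F" "\<And>j::nat. S j \<in> F \<and> S j \<noteq> S0"
    "\<And>x e. \<lbrakk>x \<in> topspace X; 0 < e\<rbrakk> \<Longrightarrow>
       \<exists>U. openin X U \<and> x \<in> U \<and> (\<forall>\<^sub>F j in sequentially. \<forall>y\<in>U. ed n (f (S j) y) (f S0 y) < e)"
proof -
  obtain \<B> where B: "countable \<B>" "\<And>V. V \<in> \<B> \<Longrightarrow> openin X V"
    "\<And>U x. \<lbrakk>openin X U; x \<in> U\<rbrakk> \<Longrightarrow> \<exists>V\<in>\<B>. x \<in> V \<and> V \<subseteq> U"
    using X unfolding second_countable_def by metis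
  obtain \<D> where D: "countable \<D>" "\<And>V. V \<in> \<D> \<Longrightarrow> openin (Euclidean_space n) V"
    "\<And>U x. \<lbrakk>openin (Euclidean_space n) U; x \<in> U\<rbrakk> \<Longrightarrow> \<exists>V\<in>\<D>. x \<in> V \<and> V \<subseteq> U"
    using second_countable_Euclidean_space [of n] unfolding second_countable_def by metis
  \<comment> \<open>What the first \<open>j\<close> basic sets on either side reveal about
    \<open>f S\<close>; a finite subset of a countable set.\<close>
  define code where "code j S = {(b, d). b \<in> \<B> \<and> d \<in> \<D> \<and> to_nat_on \<B> b < j \<and> to_nat_on \<D> d < j \<and> f S ` b \<subseteq> d}"
    for j S
  have "countable (range (code j))" for j
  proof (rule countable_subset)
    have fin: "finite {b \<in> \<B>. to_nat_on \<B> b < j}" "finite {d \<in> \<D>. to_nat_on \<D> d < j}"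
      using B(1) D(1) by (auto intro!: finite_imageD [of "to_nat_on _"] finite_subset [of _ "{..<j}"]
          inj_on_subset [OF inj_on_to_nat_on])
    have "finite (code j S)" for S
      by (rule finite_subset [OF _ finite_cartesian_product [OF fin]]) (auto simp: code_def)
    then show "range (code j) \<subseteq> {A. finite A \<and> A \<subseteq> \<B> \<times> \<D>}"
      by (auto simp: code_def)
    show "countable {A. finite A \<and> A \<subseteq> \<B> \<times> \<D>}"
      by (intro countable_Collect_finite_subset countable_SIGMA B D)
  qed
  note count = this
  \<comment> \<open>Otherwise every member of \<open>F\<close> is singled out by its code at some
    level. Each level has countably many codes, so \<open>F\<close> would be countable.\<close>
  have "\<exists>S0\<in>F. \<forall>j. \<exists>S\<in>F. code j S = code j S0 \<and> S \<noteq> S0"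
  proof (rule ccontr)
    assume "\<not> ?thesis"
    then have eq: "F = (\<Union>j. {S \<in> F. \<forall>S'\<in>F. code j S' = code j S \<longrightarrow> S' = S})"
      by auto
    have "countable {S \<in> F. \<forall>S'\<in>F. code j S' = code j S \<longrightarrow> S' = S}" for j
    proof (rule countable_image_inj_on [of "code j"])
      show "countable (code j ` {S \<in> F. \<forall>S'\<in>F. code j S' = code j S \<longrightarrow> S' = S})"
        by (rule countable_subset [OF _ count]) auto
    qed (auto simp: inj_on_def)
    then have "countable (\<Union>j. {S \<in> F. \<forall>S'\<in>F. code j S' = code j S \<longrightarrow> S' = S})"
      by (intro countable_UN) auto
    then have "countable F"
      by (rule ssubst [where P = countable, OF eq])
    with F show False ..
  qed
  then obtain S0 S where S0: "S0 \<in> F" and S: "\<And>j. S j \<in> F \<and> code j (S j) = code j S0 \<and> S j \<noteq> S0"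
    by metis
  show thesis
  proof (rule that [OF S0])
    fix x and e :: real assume x: "x \<in> topspace X" and e: "0 < e"
    have fx: "f S0 x \<in> topspace (Euclidean_space n)"
      using funcset_mem [OF continuous_map_funspace [OF f [OF S0]] x] .
    let ?D = "{p \<in> topspace (Euclidean_space n). ed n p (f S0 x) < e / 2}"
    obtain d where d: "d \<in> \<D>" "f S0 x \<in> d" "d \<subseteq> ?D"
      using D(3) [OF openin_ed_less [OF fx], of "f S0 x" "e / 2"] fx e by auto
    obtain b where b: "b \<in> \<B>" "x \<in> b" "b \<subseteq> {y \<in> topspace X. f S0 y \<in> d}"
      using B(3) [OF openin_continuous_map_preimage [OF f [OF S0] D(2) [OF d(1)]], of x] x d by auto
    \<comment> \<open>For such \<open>j\<close> the pair \<open>(b, d)\<close> is visible to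
      \<open>code j\<close>, so \<open>f (S j)\<close> also maps \<open>b\<close> into
      \<open>d\<close>, whose points are within \<open>e / 2\<close> of
      \<open>f S0 x\<close>.\<close>
    have "ed n (f (S j) y) (f S0 y) < e" if j: "max (to_nat_on \<B> b) (to_nat_on \<D> d) < j" and y: "y \<in> b" for j y
    proof -
      have "(b, d) \<in> code j S0"
        using b d j by (auto simp: code_def)
      then have "(b, d) \<in> code j (S j)"
        using S by simp
      then have "f (S j) y \<in> ?D" "f S0 y \<in> ?D"
        using y b d by (auto simp: code_def)
      then show ?thesis
        using ed_triangle [of n "f (S j) y" "f S0 y" "f S0 x"] by (auto simp: ed_commute)
    qed
    then have "\<forall>\<^sub>F j in sequentially. \<forall>y\<in>b. ed n (f (S j) y) (f S0 y) < e"
      by (intro eventually_mono [OF eventually_gt_at_top]) blast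
    then show "\<exists>U. openin X U \<and> x \<in> U \<and> (\<forall>\<^sub>F j in sequentially. \<forall>y\<in>U. ed n (f (S j) y) (f S0 y) < e)"
      using b B(2) by blast
  qed (use S in auto)
qed

lemma locally_uniform_imp_uniform_on_compactin:
  assumes K: "compactin X K"
    and loc: "\<And>x. x \<in> topspace X \<Longrightarrow> \<exists>U. openin X U \<and> x \<in> U \<and> (\<forall>\<^sub>F j in F. \<forall>y\<in>U. P j y)"
  shows "\<forall>\<^sub>F j in F. \<forall>y\<in>K. P j y"
proof -
  let ?\<U> = "{U. openin X U \<and> (\<forall>\<^sub>F j in F. \<forall>y\<in>U. P j y)}"
  have "K \<subseteq> \<Union>?\<U>"
    using loc compactin_subset_topspace [OF K] by blast
  then obtain \<V> where V: "finite \<V>" "\<V> \<subseteq> ?\<U>" "K \<subseteq> \<Union>\<V>"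
    using compactinD [OF K, of ?\<U>] by auto
  then have "\<forall>\<^sub>F j in F. \<forall>U\<in>\<V>. \<forall>y\<in>U. P j y"
    by (intro eventually_ball_finite) auto
  then show ?thesis
    by (rule eventually_mono) (use V in blast)
qed

section \<open>Charts and local data\<close>

lemma manifold_interior_chart:
  assumes x: "x \<in> manifold_interior m M"
  obtains h where "chart m (subtopology M (manifold_interior m M)) h" "h (\<lambda>i. 0) = x"
proof -
  let ?E = "Euclidean_space m"
  obtain U V where U: "openin M U" "x \<in> U" and V: "openin ?E V"
    and "subtopology M U homeomorphic_space subtopology ?E V"
    using x by (auto simp: manifold_interior_def)
  then obtain g where g: "homeomorphic_map (subtopology ?E V) (subtopology M U) g"
    by (meson homeomorphic_space homeomorphic_space_sym)
  \<comment> \<open>\<open>U\<close> and \<open>V\<close> witness interiority for every point of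
    \<open>U\<close>.\<close>
  have UI: "U \<subseteq> manifold_interior m M"
    using U V \<open>subtopology M U homeomorphic_space subtopology ?E V\<close> openin_subset
    by (fastforce simp: manifold_interior_def)
  have VE: "V \<subseteq> topspace ?E" and UM: "U \<subseteq> topspace M"
    using openin_subset V U by auto
  have img: "g ` V = U"
    using homeomorphic_imp_surjective_map [OF g] VE UM by (simp add: Int_absorb1)
  then obtain v where v: "v \<in> V" "g v = x"
    using U by blast
  obtain r where r: "0 < r" "\<And>w. \<lbrakk>w \<in> topspace ?E; ed m w v < r\<rbrakk> \<Longrightarrow> w \<in> V"
    using openin_Euclidean_space_contains_ball [OF V v(1)] by metis
  \<comment> \<open>Scales the ball of radius 3, as \<open>chart\<close> requires it, to the ball of
    radius \<open>r\<close> around \<open>v\<close>.\<close>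
  define a where "a w = (\<lambda>i. v i + r / 3 * w i)" for w :: "nat \<Rightarrow> real"
  have vE: "v \<in> topspace ?E"
    using v VE by blast
  have aE: "a w \<in> topspace ?E" if "w \<in> topspace ?E" for w
    using that vE by (simp add: a_def topspace_Euclidean_space)
  have aV: "a w \<in> V" if "w \<in> nball m 3" for w
  proof (rule r(2))
    have "ed m (a w) v = r / 3 * nrm m w"
      using r(1) nrm_scale [of "r / 3" w m] by (simp add: ed_def a_def)
    also have "\<dots> < r"
      using that r(1) by (simp add: nball_def field_simps)
    finally show "ed m (a w) v < r" .
  qed (use aE that in \<open>simp add: nball_def\<close>)
  have "continuous_map ?E ?E a"
    using aE unfolding continuous_map_Euclidean_space_iff_components a_def
    by (auto intro!: continuous_intros continuous_map_Euclidean_component [OF continuous_map_id [unfolded id_def]])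
  then have "continuous_map (subtopology ?E (nball m 3)) (subtopology ?E V) a"
    using aV by (auto simp: continuous_map_in_subtopology continuous_map_from_subtopology)
  from continuous_map_compose [OF this homeomorphic_imp_continuous_map [OF g]]
  have c: "continuous_map (subtopology ?E (nball m 3)) M (\<lambda>w. g (a w))"
    by (simp add: continuous_map_in_subtopology o_def)
  have ginj: "inj_on g V"
    using homeomorphic_imp_injective_map [OF g] VE by (simp add: Int_absorb1)
  have inj: "inj_on (\<lambda>w. g (a w)) (nball m 3)"
  proof (rule inj_onI)
    fix w w' assume ww: "w \<in> nball m 3" "w' \<in> nball m 3" "g (a w) = g (a w')"
    then have "a w = a w'"
      using ginj aV by (auto dest: inj_onD)
    then show "w = w'"
      using r(1) by (auto simp: a_def fun_eq_iff)
  qed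
  have op: "openin M ((\<lambda>w. g (a w)) ` Q)" if Q: "openin ?E Q" "Q \<subseteq> nball m 3" for Q
  proof -
    define b where "b w = (\<lambda>i. 3 / r * (w i - v i))" for w :: "nat \<Rightarrow> real"
    have ab: "a (b w) = w" "b (a w) = w" for w
      using r(1) by (auto simp: a_def b_def fun_eq_iff field_simps)
    have "continuous_map ?E ?E b"
      using vE r(1) unfolding continuous_map_Euclidean_space_iff_components b_def
      by (auto simp: topspace_Euclidean_space
          intro!: continuous_intros continuous_map_Euclidean_component [OF continuous_map_id [unfolded id_def]])
    then have "openin ?E {w \<in> topspace ?E. b w \<in> Q}"
      using Q(1) openin_continuous_map_preimage by blast
    moreover have "{w \<in> topspace ?E. b w \<in> Q} = a ` Q"
      using ab aE openin_subset [OF Q(1)] by (auto simp: image_iff) (metis ab(1))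
    moreover have "a ` Q \<subseteq> V"
      using Q aV by blast
    ultimately have "openin (subtopology ?E V) (a ` Q)"
      by (auto simp: openin_subtopology)
    then have "openin (subtopology M U) (g ` a ` Q)"
      using g homeomorphic_imp_open_map open_map_def by blast
    then have "openin M (g ` a ` Q)"
      using U openin_trans_full by blast
    then show ?thesis
      by (simp add: image_image)
  qed
  have im: "g (a w) \<in> U" if "w \<in> nball m 3" for w
    using img aV that by blast
  show thesis
  proof
    show "chart m (subtopology M (manifold_interior m M)) (\<lambda>w. g (a w))"
      unfolding chart_def
    proof (intro conjI allI impI inj)
      show "continuous_map (subtopology ?E (nball m 3)) (subtopology M (manifold_interior m M)) (\<lambda>w. g (a w))"
        using c im UI by (auto simp: continuous_map_in_subtopology)
      fix Q assume Q: "openin ?E Q \<and> Q \<subseteq> nball m 3"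
      then have "(\<lambda>w. g (a w)) ` Q \<subseteq> manifold_interior m M"
        using im UI by blast
      with op Q show "openin (subtopology M (manifold_interior m M)) ((\<lambda>w. g (a w)) ` Q)"
        by (auto simp: openin_subtopology)
    qed
    show "g (a (\<lambda>i. 0)) = x"
      by (simp add: a_def v)
  qed
qed

lemma continuous_map_euclideanreal_compact_pos_lower_bound:
  assumes "compactin T C" "continuous_map T euclideanreal u" "\<And>z. z \<in> C \<Longrightarrow> 0 < u z"
  shows "\<exists>e>0. \<forall>z\<in>C. e \<le> u z"
proof -
  have "compact (insert 1 (u ` C))"
    using image_compactin [OF assms(1,2)] by (simp add: compact_insert)
  from compact_attains_inf [OF this] obtain e where "e \<in> insert 1 (u ` C)" "\<forall>y \<in> insert 1 (u ` C). e \<le> y"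
    by auto
  then show ?thesis
    using assms(3) by (intro exI [of _ e]) auto
qed

lemma hemisphere_generator:
  assumes "0 < m"
  obtains k where "rel_generator m (upper m) {x. x m = 0} k"
proof -
  obtain j where j: "m = Suc j"
    using assms gr0_implies_Suc by blast
  obtain c where "\<And>k. reduced_generator k (nsphere k) (symm_chain k (c k))"
    using hemisphere_chains by metis
  from upper_chain_step [OF this [of j]] show thesis
    using that unfolding j by blast
qed

text \<open>Collects what is needed near \<open>x0\<close> in a form that depends on
  \<open>f\<close> alone: \<open>g\<close> enters only through its distance from \<open>f\<close> on
  \<open>K\<close>. Hence the data can be fixed before the approximating maps are chosen, and
  \<open>K\<close> is compact because these converge uniformly on compact sets.\<close>

lemma local_chain:
  fixes X :: "'a topology"
  assumes m: "0 < m" and X: "Hausdorff_space X"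
    and h: "chart m X h" "h (\<lambda>i. 0) = x0"
    and cf: "continuous_map X (Euclidean_space (Suc m)) f"
    and emb: "\<And>U x. \<lbrakk>openin X U; x \<in> U\<rbrakk> \<Longrightarrow> \<exists>d>0. \<forall>y\<in>topspace X. ed (Suc m) (f y) (f x) < d \<longrightarrow> y \<in> U"
  obtains W c r A K where "openin X W" "x0 \<in> W" "A \<subseteq> topspace X" "singular_relcycle m X A c" "0 < r" "compactin X K"
    "\<And>x y. \<lbrakk>x \<in> W; y \<in> topspace X; ed (Suc m) (f y) (f x) < 2 * r\<rbrakk> \<Longrightarrow> y \<in> K \<and> y \<notin> A"
    "\<And>x. x \<in> W \<Longrightarrow> rel_generator m X (topspace X - {x}) c"
    "\<And>x. x \<in> W \<Longrightarrow> \<exists>p. continuous_map (top_of_set {0..1::real}) X p \<and> p 0 = x0 \<and> p 1 = x \<and> p ` {0..1} \<subseteq> W"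
    "\<And>g. \<lbrakk>disjoint_maps m X f g; \<And>y. y \<in> K \<Longrightarrow> ed (Suc m) (g y) (f y) < r\<rbrakk> \<Longrightarrow> link m f g r x0 c \<noteq> 0"
proof -
  let ?E = "Euclidean_space m" and ?ed = "ed (Suc m)"
  obtain k where k: "rel_generator m (upper m) {x. x m = 0} k"
    using hemisphere_generator [OF m] .
  have proj3: "nrm m (proj m x) < 3" and proj1: "nrm m (proj m x) \<le> 1" if "x \<in> topspace (nsphere m)" for x
    using nrm_le_1_nsphere [OF that] by (simp_all add: nrm_proj)
  have chp: "continuous_map (upper m) X (\<lambda>x. h (proj m x))"
    using proj3 by (intro continuous_map_chart [OF h(1)] continuous_map_from_subtopology continuous_map_proj) auto
  have hX: "h v \<in> topspace X" if "v \<in> nball m 3" for v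
    using h(1) that unfolding chart_def by (auto simp: continuous_map_def nball_def)
  define K where "K = (\<lambda>x. h (proj m x)) ` topspace (upper m)"
  have K: "compactin X K"
    unfolding K_def using compact_space_upper compact_space_def image_compactin chp by blast
  have hK: "h v \<in> K" if v: "v \<in> topspace ?E" "nrm m v \<le> 1" for v
  proof -
    obtain x where "x \<in> topspace (upper m)" "proj m x = v"
      using proj_upper_lift [OF v] .
    then show ?thesis
      unfolding K_def by blast
  qed
  have open_ball: "openin ?E (nball m r)" for r
    using openin_continuous_map_preimage [OF continuous_map_nrm, of "{..<r}" m] by (simp add: nball_def)
  have ball_mono: "nball m r \<subseteq> nball m r'" if "r \<le> r'" for r r'
    using that by (auto simp: nball_def)
  have openin_h: "openin X (h ` nball m r)" if "r \<le> 3" for r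
    using h(1) open_ball ball_mono [OF that] by (auto simp: chart_def)
  have zero: "(\<lambda>i. 0) \<in> nball m r" if "0 < r" for r
    using that by (simp add: nball_def topspace_Euclidean_space L2_set_def)
  define A where "A = topspace X - h ` nball m 1"
  have hA: "h v \<in> A" if "v \<in> topspace ?E" "nrm m v = 1" for v
  proof -
    have v3: "v \<in> nball m 3"
      using that by (simp add: nball_def)
    moreover have "h v \<noteq> h w" if w: "w \<in> nball m 1" for w
      using chart_inj [OF h(1), of v w] w v3 \<open>nrm m v = 1\<close> by (auto simp: nball_def)
    ultimately show ?thesis
      using hX by (auto simp: A_def)
  qed
  have "x0 \<in> h ` nball m 1"
    using h(2) zero by force
  then obtain d where d: "0 < d" "\<And>y. \<lbrakk>y \<in> topspace X; ?ed (f y) (f x0) < d\<rbrakk> \<Longrightarrow> y \<in> h ` nball m 1"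
    using emb [OF openin_h, of 1 x0] by auto
  let ?T = "prod_topology (top_of_set {0..1::real}) (upper m)"
  let ?C = "{z \<in> topspace ?T. snd z m \<in> {0}}"
  \<comment> \<open>For \<open>v = proj m x\<close> on the unit sphere, \<open>v\<close> differs
    from \<open>- t * v\<close>, so this distance is positive. A lower bound on the compact set
    \<open>?C\<close> gives the separation that \<open>link_nonzero\<close> wants along its
    deformation.\<close>
  let ?u = "\<lambda>z. ?ed (f (h (proj m (snd z)))) (f (h (\<lambda>i. - fst z * proj m (snd z) i)))"
  have fst: "continuous_map ?T euclideanreal fst"
    using continuous_map_into_fulltopology continuous_map_fst by blast
  have sndE: "continuous_map ?T euclideanreal (\<lambda>z. snd z m)"
    using continuous_map_compose [OF continuous_map_snd
        continuous_map_from_subtopology [OF continuous_map_nsphere_projection]] by (simp add: o_def)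
  have sndp: "continuous_map ?T ?E (\<lambda>z. proj m (snd z))"
    using continuous_map_compose [OF continuous_map_snd continuous_map_from_subtopology [OF continuous_map_proj]]
    by (simp add: o_def)
  have inE: "(\<lambda>i. - (t * proj m x i)) \<in> topspace ?E" for t x
    by (simp add: topspace_Euclidean_space proj_def)
  have nneg: "nrm m (\<lambda>i. - t * proj m x i) \<le> 1" if "0 \<le> t" "t \<le> 1" "x \<in> topspace (nsphere m)" for t x
    using nrm_scale [of "- t" "proj m x" m] that proj1 [OF that(3)] by (simp add: mult_le_one)
  have "continuous_map ?T ?E (\<lambda>z i. - fst z * proj m (snd z) i)"
    using sndp inE by (auto simp: continuous_map_Euclidean_space_iff_components intro!: continuous_intros fst)
  then have "continuous_map ?T X (\<lambda>z. h (\<lambda>i. - fst z * proj m (snd z) i))"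
    using nneg by (intro continuous_map_chart [OF h(1)]) (assumption, fastforce)
  moreover have "continuous_map ?T X (\<lambda>z. h (proj m (snd z)))"
    using proj3 by (intro continuous_map_chart [OF h(1) sndp]) auto
  ultimately have cu: "continuous_map ?T euclideanreal ?u"
    by (intro continuous_map_ed continuous_map_compose [OF _ cf, unfolded o_def])
  have finj: "x = y" if "x \<in> topspace X" "y \<in> topspace X" "f x = f y" for x y
  proof (rule ccontr)
    assume "x \<noteq> y"
    moreover have "openin X (topspace X - {y})"
      using closedin_Hausdorff_sing_eq [OF X, of y] that(2) by (auto simp: closedin_def)
    ultimately show False
      using emb [of "topspace X - {y}" x] that by auto
  qed
  have C: "compactin ?T ?C"
  proof (rule closedin_compact_space)
    show "compact_space ?T"
      using compact_space_upper by (simp add: compact_space_prod_topology compact_space_subtopology)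
    show "closedin ?T ?C"
      by (rule closedin_continuous_map_preimage [OF sndE]) auto
  qed
  have pos: "0 < ?u z" if z: "z \<in> ?C" for z
  proof -
    obtain t x where tx: "z = (t, x)" "0 \<le> t" "t \<le> 1" "x \<in> topspace (nsphere m)" "x m = 0"
      using z by auto
    let ?w = "\<lambda>i. - t * proj m x i"
    have "(nrm m (proj m x))\<^sup>2 = 1"
      using tx by (simp add: topspace_nsphere nrm_proj)
    then have n1: "nrm m (proj m x) = 1"
      by (simp add: power2_eq_1_iff) (smt (verit) L2_set_nonneg)
    have wE: "?w \<in> topspace ?E"
      using inE [of t x] by simp
    have w3: "nrm m ?w < 3"
      using nneg [OF tx(2-4)] by linarith
    have "proj m x \<noteq> ?w"
    proof
      assume eq: "proj m x = ?w"
      have "proj m x i = 0" for i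
      proof -
        have "(1 + t) * proj m x i = 0"
          using fun_cong [OF eq, of i] by (simp add: algebra_simps)
        then show ?thesis
          using tx by simp
      qed
      then show False
        using n1 by (simp add: L2_set_def)
    qed
    then have "h (proj m x) \<noteq> h ?w"
      using chart_inj [OF h(1) _ proj_in_Euclidean_space wE proj3 [OF tx(4)] w3] by blast
    moreover have "h (proj m x) \<in> topspace X" "h ?w \<in> topspace X"
      using hX wE w3 proj3 [OF tx(4)] by (simp_all add: nball_def)
    ultimately have "f (h (proj m x)) \<noteq> f (h ?w)" "f (h (proj m x)) \<in> topspace (Euclidean_space (Suc m))"
        "f (h ?w) \<in> topspace (Euclidean_space (Suc m))"
      using finj funcset_mem [OF continuous_map_funspace [OF cf]] by blast+
    then have "?ed (f (h (proj m x))) (f (h ?w)) \<noteq> 0"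
      by (simp add: ed_eq_0_iff)
    then have "0 < ?ed (f (h (proj m x))) (f (h ?w))"
      using ed_nonneg [of "Suc m" "f (h (proj m x))" "f (h ?w)"] by linarith
    then show ?thesis
      by (simp add: tx(1))
  qed
  from continuous_map_euclideanreal_compact_pos_lower_bound [OF C cu pos]
  obtain e where e: "0 < e" "\<And>z. z \<in> ?C \<Longrightarrow> e \<le> ?u z"
    by blast
  \<comment> \<open>With \<open>2 * r \<le> d / 2\<close>, the ball of radius \<open>2 * r\<close>
    around a point within \<open>d / 2\<close> of \<open>f x0\<close> stays within \<open>d\<close>
    of \<open>f x0\<close>, hence meets the image of \<open>f\<close> only in the image of the disc;
    \<open>2 * r \<le> e\<close> is the separation just found.\<close>
  define r where "r = min (d / 4) (e / 2)"
  have r: "0 < r" "2 * r \<le> d / 2" "2 * r \<le> e"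
    using d e by (auto simp: r_def)
  let ?Q = "{v \<in> nball m 1. ?ed (f (h v)) (f x0) < d / 2}"
  have x0X: "x0 \<in> topspace X"
    using hX [OF zero] h(2) by simp
  have "openin (subtopology ?E (nball m 3)) {v \<in> topspace (subtopology ?E (nball m 3)). ?ed (f (h v)) (f x0) \<in> {..<d / 2}}"
  proof (rule openin_continuous_map_preimage)
    have "continuous_map (subtopology ?E (nball m 3)) (Euclidean_space (Suc m)) (\<lambda>v. f (h v))"
      using continuous_map_compose [OF _ cf, of _ h] h(1) by (simp add: chart_def o_def)
    moreover have "f x0 \<in> topspace (Euclidean_space (Suc m))"
      using continuous_map_funspace [OF cf] x0X by blast
    ultimately show "continuous_map (subtopology ?E (nball m 3)) euclideanreal (\<lambda>v. ?ed (f (h v)) (f x0))"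
      by (intro continuous_map_ed) auto
  qed simp
  then have "openin ?E ({v \<in> topspace (subtopology ?E (nball m 3)). ?ed (f (h v)) (f x0) \<in> {..<d / 2}} \<inter> nball m 1)"
    by (intro openin_Int open_ball) (rule openin_trans_full [OF _ open_ball])
  moreover have "{v \<in> topspace (subtopology ?E (nball m 3)). ?ed (f (h v)) (f x0) \<in> {..<d / 2}} \<inter> nball m 1 = ?Q"
    by (auto simp: nball_def)
  ultimately have Q: "openin ?E ?Q"
    by simp
  have Q0: "(\<lambda>i. 0) \<in> ?Q"
    using zero d h(2) by simp
  obtain s where s: "0 < s" "\<And>v. \<lbrakk>v \<in> topspace ?E; ed m v (\<lambda>i. 0) < s\<rbrakk> \<Longrightarrow> v \<in> ?Q"
  proof (rule openin_Euclidean_space_contains_ball [OF Q Q0])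
    fix s assume "0 < s" "\<And>v. \<lbrakk>v \<in> topspace ?E; ed m v (\<lambda>i. 0) < s\<rbrakk> \<Longrightarrow> v \<in> ?Q"
    then show thesis
      by (rule that)
  qed
  \<comment> \<open>A round ball inside \<open>?Q\<close>, so that radii provide the paths to
    \<open>x0\<close>; \<open>q \<le> 1\<close> puts it into the reach of
    \<open>chart_rel_generator\<close>.\<close>
  define q where "q = min s 1"
  have q: "0 < q" "q \<le> 1" "nball m q \<subseteq> ?Q"
    using s by (auto simp: q_def nball_def ed_def)
  show thesis
  proof (rule that)
    show "openin X (h ` nball m q)"
      using q by (intro openin_h) simp
    show "x0 \<in> h ` nball m q"
      using zero [OF q(1)] h(2) by force
    show "A \<subseteq> topspace X"
      by (auto simp: A_def)
    show "0 < r" "compactin X K"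
      by (rule r, rule K)
    have "singular_relcycle m (upper m) (topspace (upper m) \<inter> {x. x m = 0}) k"
      using k by (simp add: rel_generator_def del: topspace_subtopology)
    then show "singular_relcycle m X A (chain_map m (h \<circ> proj m) k)"
    proof (rule singular_relcycle_chain_map)
      show "continuous_map (upper m) X (h \<circ> proj m)"
        using chp by (simp add: o_def)
      have "nrm m (proj m x) = 1" if "x \<in> topspace (nsphere m)" "x m = 0" for x
      proof -
        have "(nrm m (proj m x))\<^sup>2 = 1"
          using that by (simp add: topspace_nsphere nrm_proj)
        then show ?thesis
          by (simp add: power2_eq_1_iff) (smt (verit) L2_set_nonneg)
      qed
      then show "h \<circ> proj m \<in> topspace (upper m) \<inter> {x. x m = 0} \<rightarrow> A"
        using hA by auto
    qed
    show local: "y \<in> K \<and> y \<notin> A" if x: "x \<in> h ` nball m q" and y: "y \<in> topspace X" "?ed (f y) (f x) < 2 * r" for x y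
    proof -
      have "?ed (f x) (f x0) < d / 2"
        using x q(3) by blast
      then have "?ed (f y) (f x0) < d"
        using ed_triangle [of "Suc m" "f y" "f x0" "f x"] y r by linarith
      then have "y \<in> h ` nball m 1"
        using d y by blast
      then show ?thesis
        using hK by (auto simp: A_def nball_def)
    qed
    show "rel_generator m X (topspace X - {x}) (chain_map m (h \<circ> proj m) k)" if x: "x \<in> h ` nball m q" for x
      using x q(2) ball_mono by (auto intro!: chart_rel_generator [OF m k X h(1)])
    show "\<exists>p. continuous_map (top_of_set {0..1::real}) X p \<and> p 0 = x0 \<and> p 1 = x \<and> p ` {0..1} \<subseteq> h ` nball m q"
      if x: "x \<in> h ` nball m q" for x
    proof -
      obtain v where v: "v \<in> nball m q" "x = h v"
        using x by blast
      have tv: "(\<lambda>i. t * v i) \<in> nball m q" if "0 \<le> t" "t \<le> 1" for t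
      proof -
        have "t * nrm m v \<le> nrm m v"
          using that by (simp add: mult_left_le_one_le)
        then show ?thesis
          using v that nrm_scale [of t v m] by (simp add: nball_def topspace_Euclidean_space)
      qed
      have "continuous_map (top_of_set {0..1::real}) ?E (\<lambda>t i. t * v i)"
        using tv by (auto simp: continuous_map_Euclidean_space_iff_components nball_def intro!: continuous_intros)
      moreover have "nrm m (\<lambda>i. t * v i) < 3" if "0 \<le> t" "t \<le> 1" for t
        using tv [OF that] q(2) by (simp add: nball_def)
      ultimately have "continuous_map (top_of_set {0..1::real}) X (\<lambda>t. h (\<lambda>i. t * v i))"
        by (intro continuous_map_chart [OF h(1)]) auto
      then show ?thesis
        using tv v h(2) by (intro exI [of _ "\<lambda>t. h (\<lambda>i. t * v i)"]) auto
    qed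
    show "link m f g r x0 (chain_map m (h \<circ> proj m) k) \<noteq> 0"
      if g: "disjoint_maps m X f g" and near: "\<And>y. y \<in> K \<Longrightarrow> ?ed (g y) (f y) < r" for g
    proof -
      interpret disjoint_maps m X f g
        by (rule g)
      have "link m f g r (h (\<lambda>i. 0)) (chain_map m (h \<circ> proj m) k) \<noteq> 0"
      proof (rule link_nonzero [OF k h(1)])
        have "x0 \<in> h ` nball m q"
          using zero [OF q(1)] h(2) by force
        then show "admissible r (h (\<lambda>i. 0)) A"
          unfolding admissible_def h(2) using r x0X local near by blast
        show "2 * r \<le> ?ed (f (h v)) (f (h (\<lambda>i. - t * v i)))"
          if v: "v \<in> topspace ?E" "nrm m v = 1" and t: "0 \<le> t" "t \<le> 1" for v t
        proof -
          obtain x where x: "x \<in> topspace (upper m)" "proj m x = v"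
            using proj_upper_lift [OF v(1)] v(2) by auto
          have "nrm m x = 1"
            using v x(2) by (metis nrm_proj)
          then have "x m = 0"
            using x(1) by (simp add: topspace_nsphere)
          then have "(t, x) \<in> ?C"
            using x t by simp
          then show ?thesis
            using e(2) [of "(t, x)"] r x by simp
        qed
        show "h v \<in> A" if "v \<in> topspace ?E" "nrm m v = 1" for v
          using hA that .
        show "?ed (g (h v)) (f (h v)) < r" if "v \<in> topspace ?E" "nrm m v \<le> 1" for v
          using near hK that by blast
      qed
      then show ?thesis
        by (simp add: h(2))
    qed
  qed
qed

section \<open>Orienting the manifold\<close>

text \<open>Only the part \<open>e\<close> of the relative boundary has to avoid \<open>y\<close>,
  and the union of its simplices is compact, so it avoids a neighbourhood of \<open>y\<close> as
  well.\<close>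

lemma homologous_rel_compact_support:
  assumes X: "Hausdorff_space X" and y: "y \<in> topspace X" and hom: "homologous_rel p X (topspace X - {y}) a b"
  obtains U where "openin X U" "y \<in> U" "homologous_rel p X (topspace X - U) a b"
proof -
  obtain d e where d: "singular_chain (Suc p) X d" and e: "singular_chain p (subtopology X (topspace X - {y})) e"
      and eq: "chain_boundary (Suc p) d + e = a - b"
    using hom by (auto simp: homologous_rel_def singular_relboundary)
  let ?K = "\<Union>s \<in> Poly_Mapping.keys e. s ` standard_simplex p"
  have chain: "singular_chain p X e" and avoid: "?K \<subseteq> topspace X - {y}"
    using e by (auto simp: singular_chain_subtopology)
  have "compactin X (s ` standard_simplex p)" if "s \<in> Poly_Mapping.keys e" for s
  proof -
    have "continuous_map (subtopology (powertop_real UNIV) (standard_simplex p)) X s"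
      using chain that by (auto simp: singular_chain_def singular_simplex_def)
    then show ?thesis
      using compactin_standard_simplex image_compactin by (metis compactin_absolute)
  qed
  then have "compactin X ?K"
    by (intro compactin_Union) auto
  then have "openin X (topspace X - ?K)"
    using compactin_imp_closedin [OF X] by blast
  moreover have "singular_chain p (subtopology X (topspace X - (topspace X - ?K))) e"
    using chain avoid by (auto simp: singular_chain_subtopology)
  then have "homologous_rel p X (topspace X - (topspace X - ?K)) a b"
    using d eq unfolding homologous_rel_def singular_relboundary by blast
  ultimately show thesis
    using that y avoid by blast
qed

lemma embedding_map_Euclidean_nbhd:
  assumes f: "embedding_map X (Euclidean_space n) f" and U: "openin X U" "x \<in> U"
  shows "\<exists>d>0. \<forall>y\<in>topspace X. ed n (f y) (f x) < d \<longrightarrow> y \<in> U"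
proof -
  have h: "homeomorphic_map X (subtopology (Euclidean_space n) (f ` topspace X)) f"
    using f by (simp add: embedding_map_def)
  have UX: "U \<subseteq> topspace X"
    using openin_subset U(1) by blast
  have "openin (subtopology (Euclidean_space n) (f ` topspace X)) (f ` U)"
    using homeomorphic_imp_open_map [OF h] U(1) by (simp add: open_map_def)
  then obtain T where T: "openin (Euclidean_space n) T" "f ` U = T \<inter> f ` topspace X"
    by (auto simp: openin_subtopology)
  have "f x \<in> T"
    using T U by blast
  then obtain d where d: "0 < d" "\<And>w. \<lbrakk>w \<in> topspace (Euclidean_space n); ed n w (f x) < d\<rbrakk> \<Longrightarrow> w \<in> T"
    using openin_Euclidean_space_contains_ball [OF T(1)] by metis
  have fE: "f y \<in> topspace (Euclidean_space n)" if "y \<in> topspace X" for y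
    using homeomorphic_imp_surjective_map [OF h] that by auto
  have inj: "inj_on f (topspace X)"
    using homeomorphic_imp_injective_map [OF h] .
  have "y \<in> U" if "y \<in> topspace X" "ed n (f y) (f x) < d" for y
  proof -
    have "f y \<in> f ` U"
      using T(2) d(2) fE that by blast
    then show ?thesis
      using inj UX that(1) by (auto dest: inj_onD)
  qed
  then show ?thesis
    using d(1) by blast
qed

lemma rel_generator_unit_cmul:
  assumes "rel_generator p X S c" and k: "k * k = (1::int)"
  shows "rel_generator p X S (frag_cmul k c)"
  unfolding rel_generator_def
proof (intro conjI allI impI)
  show "singular_relcycle p X S (frag_cmul k c)"
    using assms by (simp add: rel_generator_def singular_relcycle_cmul)
  fix b assume "singular_relcycle p X S b"
  then obtain j where "homologous_rel p X S b (frag_cmul j c)"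
    using assms by (auto simp: rel_generator_def)
  moreover have "frag_cmul j c = frag_cmul (j * k) (frag_cmul k c)"
    by (simp add: k mult.assoc)
  ultimately show "\<exists>j. homologous_rel p X S b (frag_cmul j (frag_cmul k c))"
    by metis
qed

lemma orientable_manifold_if_locally_homologous:
  fixes X :: "'a topology" and c :: "'a \<Rightarrow> 'a chain"
  assumes W: "\<And>x. x \<in> C \<Longrightarrow> openin X (W x)" "topspace X = (\<Union>x\<in>C. W x)"
    and c: "\<And>x. x \<in> C \<Longrightarrow> singular_relcycle m X (topspace X - W x) (c x)"
    and gen: "\<And>x a. \<lbrakk>x \<in> C; a \<in> W x\<rbrakk> \<Longrightarrow> rel_generator m X (topspace X - {a}) (c x)"
    and hom: "\<And>x y a. \<lbrakk>x \<in> C; y \<in> C; a \<in> W x; a \<in> W y\<rbrakk> \<Longrightarrow> homologous_rel m X (topspace X - {a}) (c x) (c y)"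
  shows "orientable_manifold m X"
proof -
  \<comment> \<open>An arbitrary choice of chart at each point; by \<open>hom\<close> it does not
    affect the local class.\<close>
  define z where "z a = (SOME x. x \<in> C \<and> a \<in> W x)" for a
  have z: "z a \<in> C \<and> a \<in> W (z a)" if "a \<in> topspace X" for a
    unfolding z_def by (rule someI_ex) (use that W(2) in blast)
  define ori where "ori a = homologous_rel_set m X (topspace X - {a}) (c (z a))" for a
  have ori_eq: "ori a = homologous_rel_set m X (topspace X - {a}) (c x)" if "x \<in> C" "a \<in> W x" for x a
  proof -
    have "a \<in> topspace X"
      using that W(2) by blast
    then show ?thesis
      using hom z that by (simp only: ori_def homologous_rel_set_eq)
  qed
  show ?thesis
    unfolding orientable_manifold_def
  proof (intro exI [of _ ori] conjI ballI)
    fix a assume "a \<in> topspace X"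
    then have g: "rel_generator m X (topspace X - {a}) (c (z a))"
      using gen z by blast
    then show "ori a \<in> carrier (relative_homology_group (int m) X (topspace X - {a}))"
      unfolding ori_def by (intro homologous_rel_set_in_carrier) (simp add: rel_generator_def)
    show "generate (relative_homology_group (int m) X (topspace X - {a})) {ori a}
        = carrier (relative_homology_group (int m) X (topspace X - {a}))"
      unfolding ori_def by (rule rel_generator_imp_generate [OF g])
  next
    fix a assume a: "a \<in> topspace X"
    let ?c = "homologous_rel_set m X (topspace X - W (z a)) (c (z a))"
    have cyc: "singular_relcycle m X (topspace X - W (z a)) (c (z a))"
      using c z a by blast
    have "hom_induced (int m) X (topspace X - W (z a)) X (topspace X - {y}) id ?c = ori y" if y: "y \<in> W (z a)" for y
    proof -
      have "hom_induced (int m) X (topspace X - W (z a)) X (topspace X - {y}) id ?c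
          = homologous_rel_set m X (topspace X - {y}) (chain_map m id (c (z a)))"
        by (rule hom_induced_chain_map [OF _ _ cyc]) (use y in auto)
      also have "chain_map m id (c (z a)) = c (z a)"
        using cyc by (intro chain_map_ident [of _ X]) (simp add: singular_relcycle)
      also have "homologous_rel_set m X (topspace X - {y}) (c (z a)) = ori y"
        using ori_eq [of "z a" y] z [OF a] y by simp
      finally show ?thesis .
    qed
    then show "\<exists>U d. openin X U \<and> a \<in> U \<and> d \<in> carrier (relative_homology_group (int m) X (topspace X - U)) \<and>
        (\<forall>y\<in>U. hom_induced (int m) X (topspace X - U) X (topspace X - {y}) id d = ori y)"
      using W(1) z a homologous_rel_set_in_carrier [OF cyc] by blast
  qed
qed

theorem orientable_manifold_if_uncountably_many_embeddings:
  fixes X :: "'a topology" and f :: "'i \<Rightarrow> 'a \<Rightarrow> nat \<Rightarrow> real"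
  assumes m: "0 < m" and X: "Hausdorff_space X" "second_countable X"
    and chart: "\<And>x. x \<in> topspace X \<Longrightarrow> \<exists>h. chart m X h \<and> h (\<lambda>i. 0) = x"
    and F: "uncountable F" and emb: "\<And>S. S \<in> F \<Longrightarrow> embedding_map X (Euclidean_space (Suc m)) (f S)"
    and disj: "\<And>S S' x y. \<lbrakk>S \<in> F; S' \<in> F; S \<noteq> S'; x \<in> topspace X; y \<in> topspace X\<rbrakk> \<Longrightarrow> f S x \<noteq> f S' y"
  shows "orientable_manifold m X"
proof -
  let ?ed = "ed (Suc m)"
  have cf: "continuous_map X (Euclidean_space (Suc m)) (f S)" if "S \<in> F" for S
    using emb [OF that]
    by (auto simp: embedding_map_def continuous_map_in_subtopology dest: homeomorphic_imp_continuous_map)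
  obtain S0 S where S0: "S0 \<in> F" and S: "\<And>j::nat. S j \<in> F \<and> S j \<noteq> S0"
    and acc: "\<And>x e. \<lbrakk>x \<in> topspace X; 0 < e\<rbrakk> \<Longrightarrow>
       \<exists>U. openin X U \<and> x \<in> U \<and> (\<forall>\<^sub>F j in sequentially. \<forall>y\<in>U. ?ed (f (S j) y) (f S0 y) < e)"
  proof (rule uncountable_family_accumulates [OF X(2) F cf])
    fix S0 S
    assume "S0 \<in> F" "\<And>j::nat. S j \<in> F \<and> S j \<noteq> S0"
      "\<And>x e. \<lbrakk>x \<in> topspace X; 0 < e\<rbrakk> \<Longrightarrow>
       \<exists>U. openin X U \<and> x \<in> U \<and> (\<forall>\<^sub>F j in sequentially. \<forall>y\<in>U. ?ed (f (S j) y) (f S0 y) < e)"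
    then show thesis
      by (rule that)
  qed
  define f0 where "f0 = f S0"
  \<comment> \<open>One predicate for the conclusion of \<open>local_chain\<close>, so that all data
    can be chosen at once as functions of \<open>x\<close>.\<close>
  define L where "L x W c r A K \<longleftrightarrow> openin X W \<and> x \<in> W \<and> A \<subseteq> topspace X \<and> singular_relcycle m X A c \<and> 0 < r \<and> compactin X K \<and>
    (\<forall>a\<in>W. \<forall>y\<in>topspace X. ?ed (f0 y) (f0 a) < 2 * r \<longrightarrow> y \<in> K \<and> y \<notin> A) \<and>
    (\<forall>a\<in>W. rel_generator m X (topspace X - {a}) c) \<and>
    (\<forall>a\<in>W. \<exists>p. continuous_map (top_of_set {0..1::real}) X p \<and> p 0 = x \<and> p 1 = a \<and> p ` {0..1} \<subseteq> W) \<and>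
    (\<forall>g. disjoint_maps m X f0 g \<and> (\<forall>y\<in>K. ?ed (g y) (f0 y) < r) \<longrightarrow> link m f0 g r x c \<noteq> 0)"
    for x W c r A K
  have "\<exists>W c r A K. L x W c r A K" if x: "x \<in> topspace X" for x
  proof -
    obtain h where h: "chart m X h" "h (\<lambda>i. 0) = x"
      using chart [OF x] by blast
    show ?thesis
    proof (rule local_chain [OF m X(1) h, of f0])
      show "continuous_map X (Euclidean_space (Suc m)) f0"
        using cf S0 by (simp add: f0_def)
      show "\<exists>d>0. \<forall>y\<in>topspace X. ?ed (f0 y) (f0 a) < d \<longrightarrow> y \<in> U" if "openin X U" "a \<in> U" for U a
        using embedding_map_Euclidean_nbhd [OF emb [OF S0] that] by (simp add: f0_def)
      fix W c r A K
      assume "openin X W" "x \<in> W" "A \<subseteq> topspace X" "singular_relcycle m X A c" "0 < r" "compactin X K"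
        "\<And>x y. \<lbrakk>x \<in> W; y \<in> topspace X; ?ed (f0 y) (f0 x) < 2 * r\<rbrakk> \<Longrightarrow> y \<in> K \<and> y \<notin> A"
        "\<And>x. x \<in> W \<Longrightarrow> rel_generator m X (topspace X - {x}) c"
        "\<And>a. a \<in> W \<Longrightarrow> \<exists>p. continuous_map (top_of_set {0..1::real}) X p \<and> p 0 = x \<and> p 1 = a \<and> p ` {0..1} \<subseteq> W"
        "\<And>g. \<lbrakk>disjoint_maps m X f0 g; \<And>y. y \<in> K \<Longrightarrow> ?ed (g y) (f0 y) < r\<rbrakk> \<Longrightarrow> link m f0 g r x c \<noteq> 0"
      then have "L x W c r A K"
        unfolding L_def by simp
      then show ?thesis
        by blast
    qed
  qed
  then obtain W c r A K where Lx: "\<And>x. x \<in> topspace X \<Longrightarrow> L x (W x) (c x) (r x) (A x) (K x)"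
    by metis
  have W: "openin X (W x)" "x \<in> W x" and A: "A x \<subseteq> topspace X" and c: "singular_relcycle m X (A x) (c x)"
    and r: "0 < r x" and K: "compactin X (K x)"
    and near: "\<And>a y. \<lbrakk>a \<in> W x; y \<in> topspace X; ?ed (f0 y) (f0 a) < 2 * r x\<rbrakk> \<Longrightarrow> y \<in> K x \<and> y \<notin> A x"
    and gen: "\<And>a. a \<in> W x \<Longrightarrow> rel_generator m X (topspace X - {a}) (c x)"
    and path: "\<And>a. a \<in> W x \<Longrightarrow> \<exists>p. continuous_map (top_of_set {0..1::real}) X p \<and> p 0 = x \<and> p 1 = a \<and> p ` {0..1} \<subseteq> W x"
    and nz: "\<And>g. \<lbrakk>disjoint_maps m X f0 g; \<forall>y\<in>K x. ?ed (g y) (f0 y) < r x\<rbrakk> \<Longrightarrow> link m f0 g (r x) x (c x) \<noteq> 0"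
    if "x \<in> topspace X" for x
    using Lx [OF that] unfolding L_def by blast+
  have WX: "W x \<subseteq> topspace X" if "x \<in> topspace X" for x
    using openin_subset [OF W(1) [OF that]] .
  \<comment> \<open>The diagonal argument handles countably many signs, so countably many of the
    sets \<open>W x\<close> must cover \<open>X\<close>.\<close>
  obtain C where C: "countable C" "C \<subseteq> topspace X" and cover: "topspace X = (\<Union>x\<in>C. W x)"
  proof -
    have "\<Union>(W ` topspace X) = topspace X"
      using W WX by blast
    moreover have "openin X U" if "U \<in> W ` topspace X" for U
      using W(1) that by blast
    ultimately obtain \<V> where V: "countable \<V>" "\<V> \<subseteq> W ` topspace X" "\<Union>\<V> = topspace X"
      using Lindelof_spaceD [OF second_countable_imp_Lindelof_space [OF X(2)], of "W ` topspace X"] by auto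
    from countable_subset_image [THEN iffD1, OF conjI [OF V(1,2)]]
    obtain C where C: "countable C" "C \<subseteq> topspace X" "\<V> = W ` C"
      by auto
    show thesis
      by (rule that [OF C(1,2)]) (simp add: C(3) flip: V(3))
  qed
  have CX: "x \<in> topspace X" if "x \<in> C" for x
    using that C(2) by blast
  \<comment> \<open>Signs range over a finite set, as \<open>diagonal_eventually_constant\<close>
    demands. The value 0 is excluded later, for large \<open>j\<close>, by
    \<open>nz\<close>.\<close>
  define t where "t n j = sgn (link m f0 (f (S j)) (r (from_nat_into C n)) (from_nat_into C n) (c (from_nat_into C n)))" for n j
  have "t n j \<in> {-1, 0, 1}" for n j
    by (auto simp: t_def sgn_if)
  then obtain s v where s: "strict_mono s" and v: "\<And>n. \<forall>\<^sub>F j in sequentially. t n (s j) = v n"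
    using diagonal_eventually_constant [of "{-1, 0, 1}" t] by (metis finite.emptyI finite_insert)
  define G where "G j = f (S (s j))" for j
  define sg where "sg x = v (to_nat_on C x)" for x
  have sg_base: "\<forall>\<^sub>F j in sequentially. sgn (link m f0 (G j) (r x) x (c x)) = sg x" if "x \<in> C" for x
    using v [of "to_nat_on C x"] C(1) that by (simp add: t_def G_def sg_def)
  have dm: "disjoint_maps m X f0 (G j)" for j
  proof
    show "f0 x \<noteq> G j y" if "x \<in> topspace X" "y \<in> topspace X" for x y
      using disj [OF S0, of "S (s j)" x y] S that by (auto simp: f0_def G_def)
  qed (use m cf S0 S in \<open>auto simp: f0_def G_def\<close>)
  have close: "\<forall>\<^sub>F j in sequentially. \<forall>y\<in>Z. ?ed (G j y) (f0 y) < e" if "compactin X Z" "0 < e" for Z e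
  proof (rule locally_uniform_imp_uniform_on_compactin [OF that(1)])
    fix x assume "x \<in> topspace X"
    from acc [OF this that(2)]
    obtain U where U: "openin X U" "x \<in> U" "\<forall>\<^sub>F j in sequentially. \<forall>y\<in>U. ?ed (f (S j) y) (f S0 y) < e"
      by blast
    then show "\<exists>U. openin X U \<and> x \<in> U \<and> (\<forall>\<^sub>F j in sequentially. \<forall>y\<in>U. ?ed (G j y) (f0 y) < e)"
      using eventually_subseq [OF s U(3)] unfolding G_def f0_def by blast
  qed
  have adm: "disjoint_maps.admissible m X f0 (G j) e a (A x)"
    if "x \<in> topspace X" "a \<in> W x" "0 < e" "e \<le> r x" "\<forall>y\<in>K x. ?ed (G j y) (f0 y) < e" for x a e j
    unfolding disjoint_maps.admissible_def [OF dm]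
  proof (intro conjI ballI impI)
    show "a \<in> topspace X"
      using WX that by blast
    fix y assume y: "y \<in> topspace X" "?ed (f0 y) (f0 a) < 2 * e"
    then have "?ed (f0 y) (f0 a) < 2 * r x"
      using that(4) by linarith
    then show "y \<notin> A x" "?ed (G j y) (f0 y) < e"
      using near [OF that(1,2) y(1)] that(5) by auto
  qed (use that in auto)
  have sg_const: "\<forall>\<^sub>F j in sequentially. sgn (link m f0 (G j) (r x) a (c x)) = sg x" if x: "x \<in> C" and a: "a \<in> W x" for x a
  proof -
    obtain p where p: "continuous_map (top_of_set {0..1::real}) X p" "p 0 = x" "p 1 = a" "p ` {0..1} \<subseteq> W x"
      using path [OF CX [OF x] a] by blast
    show ?thesis
      using sg_base [OF x] close [OF K [OF CX [OF x]] r [OF CX [OF x]]]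
    proof eventually_elim
      case (elim j)
      have "link m f0 (G j) (r x) (p 0) (c x) = link m f0 (G j) (r x) (p 1) (c x)"
      proof (rule disjoint_maps.link_path [OF dm p(1)])
        show "disjoint_maps.admissible m X f0 (G j) (r x) (p t) (A x)" if "0 \<le> t" "t \<le> 1" for t
          using p(4) that elim(2) r [OF CX [OF x]] by (intro adm CX x) auto
      qed (use c CX x in auto)
      then show ?case
        using elim(1) p by simp
    qed
  qed
  have sg_unit: "sg x * sg x = 1" if x: "x \<in> C" for x
  proof -
    have "\<forall>\<^sub>F j in sequentially. link m f0 (G j) (r x) x (c x) \<noteq> 0"
      using close [OF K [OF CX [OF x]] r [OF CX [OF x]]]
      by (rule eventually_mono) (rule nz [OF CX [OF x] dm])
    with sg_base [OF x] have "\<forall>\<^sub>F j in sequentially. sg x * sg x = 1"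
    proof eventually_elim
      case (elim j)
      then have "sg x = 1 \<or> sg x = -1"
        by (metis sgn_if)
      then show ?case
        by auto
    qed
    then show ?thesis
      by simp
  qed
  \<comment> \<open>A smaller radius admits larger sets \<open>A\<close>, which makes chains of
    different charts comparable; the sign obtained with \<open>r x\<close> must survive the
    change.\<close>
  have shrink: "\<forall>\<^sub>F j in sequentially. link m f0 (G j) e a (c x) = link m f0 (G j) (r x) a (c x)"
    if x: "x \<in> C" and a: "a \<in> W x" and e: "0 < e" "e \<le> r x" for x a e
    using close [OF K [OF CX [OF x]] e(1)]
  proof eventually_elim
    case (elim j)
    \<comment> \<open>The path is constant at \<open>a\<close> and the radius moves linearly from
      \<open>e\<close> to \<open>r x\<close>; the ends are left unsimplified to match
      \<open>link_path\<close>.\<close>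
    have "link m f0 (G j) ((1 - 0) * e + 0 * r x) a (c x) = link m f0 (G j) ((1 - 1) * e + 1 * r x) a (c x)"
    proof (rule disjoint_maps.link_path [OF dm, of "\<lambda>_. a"])
      show "disjoint_maps.admissible m X f0 (G j) ((1 - t) * e + t * r x) a (A x)" if t: "0 \<le> t" "t \<le> 1" for t
      proof -
        have "e + 0 \<le> e + t * (r x - e)"
          using t e by (intro add_left_mono mult_nonneg_nonneg) auto
        moreover have "t * (r x - e) \<le> r x - e"
          using t e by (simp add: mult_left_le_one_le)
        moreover have "(1 - t) * e + t * r x = e + t * (r x - e)"
          by (simp add: algebra_simps)
        ultimately show ?thesis
          using e elim by (intro adm CX x a) (auto intro: less_le_trans)
      qed
    qed (use c CX x a WX in \<open>auto intro!: continuous_intros\<close>)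
    then show ?case
      by simp
  qed
  have hom: "homologous_rel m X (topspace X - {a}) (frag_cmul (sg x) (c x)) (frag_cmul (sg y) (c y))"
    if x: "x \<in> C" and y: "y \<in> C" and a: "a \<in> W x" "a \<in> W y" for x y a
  proof -
    have aX: "a \<in> topspace X"
      using WX CX x a by blast
    have gx: "rel_generator m X (topspace X - {a}) (c x)" and gy: "rel_generator m X (topspace X - {a}) (c y)"
      using gen CX x y a by blast+
    obtain k k' where k: "homologous_rel m X (topspace X - {a}) (c y) (frag_cmul k (c x))"
      and k': "homologous_rel m X (topspace X - {a}) (c x) (frag_cmul k' (c y))"
      using gx gy unfolding rel_generator_def by blast
    \<comment> \<open>The homologies hold relative to the complement of \<open>a\<close>, for which
      no radius is admissible; thus they are first spread to neighbourhoods of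
      \<open>a\<close>.\<close>
    obtain U where U: "openin X U" "a \<in> U" "homologous_rel m X (topspace X - U) (c y) (frag_cmul k (c x))"
      by (rule homologous_rel_compact_support [OF X(1) aX k])
    obtain U' where U': "openin X U'" "a \<in> U'" "homologous_rel m X (topspace X - U') (c x) (frag_cmul k' (c y))"
      by (rule homologous_rel_compact_support [OF X(1) aX k'])
    obtain d where d: "0 < d" "\<And>z. \<lbrakk>z \<in> topspace X; ?ed (f0 z) (f0 a) < d\<rbrakk> \<Longrightarrow> z \<in> U \<inter> U'"
      using embedding_map_Euclidean_nbhd [OF emb [OF S0] openin_Int [OF U(1) U'(1)], of a] U(2) U'(2)
      unfolding f0_def by blast
    define e where "e = min (d / 2) (min (r x) (r y))"
    have e: "0 < e" "e \<le> r x" "e \<le> r y" "2 * e \<le> d"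
      using d r CX x y by (auto simp: e_def)
    \<comment> \<open>The largest set, inside \<open>X\<close>, that radius \<open>e\<close> at
      \<open>a\<close> permits. It contains \<open>A x\<close> and \<open>A y\<close> as
      \<open>e\<close> is at most \<open>r x\<close> and \<open>r y\<close>, and the complements of
      \<open>U\<close> and \<open>U'\<close> as \<open>2 * e \<le> d\<close>.\<close>
    define B where "B = topspace X - {z. ?ed (f0 z) (f0 a) < 2 * e}"
    have AB: "A w \<subseteq> B" if w: "w \<in> C" "a \<in> W w" "e \<le> r w" for w
    proof
      fix z assume z: "z \<in> A w"
      then have zX: "z \<in> topspace X"
        using A [OF CX [OF w(1)]] by blast
      have "\<not> ?ed (f0 z) (f0 a) < 2 * e"
      proof
        assume "?ed (f0 z) (f0 a) < 2 * e"
        then have "?ed (f0 z) (f0 a) < 2 * r w"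
          using w(3) by linarith
        then show False
          using near [OF CX [OF w(1)] w(2) zX] z by blast
      qed
      then show "z \<in> B"
        using zX by (simp add: B_def)
    qed
    have cB: "singular_relcycle m X B (c x)" "singular_relcycle m X B (c y)"
      using singular_relcycle_mono [OF c [OF CX [OF x]] AB [OF x a(1) e(2)]]
        singular_relcycle_mono [OF c [OF CX [OF y]] AB [OF y a(2) e(3)]] .
    have "z \<in> U \<inter> U'" if "z \<in> topspace X" "?ed (f0 z) (f0 a) < 2 * e" for z
      using that e(4) by (intro d(2)) linarith+
    then have "topspace X - U \<subseteq> B" "topspace X - U' \<subseteq> B"
      unfolding B_def by blast+
    then have hB: "homologous_rel m X B (c y) (frag_cmul k (c x))" "homologous_rel m X B (c x) (frag_cmul k' (c y))"
      using homologous_rel_mono [OF U(3)] homologous_rel_mono [OF U'(3)] by blast+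
    \<comment> \<open>The claim does not mention \<open>j\<close>, so one good \<open>j\<close>
      proves it. The two link numbers are \<open>k\<close> and \<open>k'\<close> times each other
      and nonzero; hence \<open>k * k' = 1\<close>, so \<open>k\<close> is its own sign and relates
      the limit signs.\<close>
    have "\<forall>\<^sub>F j in sequentially. k * k' = 1 \<and> sg y = k * sg x"
      using shrink [OF x a(1) e(1,2)] shrink [OF y a(2) e(1,3)] sg_const [OF x a(1)] sg_const [OF y a(2)]
        close [OF K [OF CX [OF x]] e(1)]
    proof eventually_elim
      case (elim j)
      interpret disjoint_maps m X f0 "G j"
        by (rule dm)
      have ad: "admissible e a B"
        using adm [OF CX [OF x] a(1) e(1,2) elim(5)] by (auto simp: admissible_def B_def)
      have kx: "link m f0 (G j) e a (c y) = k * link m f0 (G j) e a (c x)"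
        using link_homologous [OF ad cB(2) singular_relcycle_cmul [OF cB(1)] hB(1)] link_cmul [OF ad cB(1)] by simp
      have ky: "link m f0 (G j) e a (c x) = k' * link m f0 (G j) e a (c y)"
        using link_homologous [OF ad cB(1) singular_relcycle_cmul [OF cB(2)] hB(2)] link_cmul [OF ad cB(2)] by simp
      have "link m f0 (G j) e a (c x) \<noteq> 0"
        using elim(1,3) sg_unit [OF x] by auto
      moreover have "link m f0 (G j) e a (c x) * (k * k') = k' * (k * link m f0 (G j) e a (c x))"
        by (simp add: ac_simps)
      then have "link m f0 (G j) e a (c x) * (k * k') = link m f0 (G j) e a (c x) * 1"
        using ky [unfolded kx] by linarith
      ultimately have kk: "k * k' = 1"
        using mult_cancel_left by blast
      then have "sgn k = k"
        using zmult_eq_1_iff [of k k'] by auto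
      have "sg y = sgn (k * link m f0 (G j) e a (c x))"
        using elim(2,4) kx by simp
      also have "\<dots> = k * sg x"
        using elim(1,3) \<open>sgn k = k\<close> by (simp add: sgn_mult)
      finally show ?case
        using kk by simp
    qed
    then have kk: "k * k' = 1" "sg y = k * sg x"
      by simp_all
    then have "k * k = 1"
      using zmult_eq_1_iff [of k k'] by auto
    have "homologous_rel m X (topspace X - {a}) (frag_cmul (sg y) (c y)) (frag_cmul (sg y) (frag_cmul k (c x)))"
      by (rule homologous_rel_cmul [OF k])
    also have "frag_cmul (sg y) (frag_cmul k (c x)) = frag_cmul (sg x) (c x)"
    proof -
      have "sg y * k = k * k * sg x"
        using kk(2) by simp
      then show ?thesis
        using \<open>k * k = 1\<close> by simp
    qed
    finally show ?thesis
      by (simp only: homologous_rel_sym)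
  qed
  show ?thesis
  proof (rule orientable_manifold_if_locally_homologous [OF _ cover, where c = "\<lambda>x. frag_cmul (sg x) (c x)"])
    show "openin X (W x)" if "x \<in> C" for x
      using W CX that by blast
    show "singular_relcycle m X (topspace X - W x) (frag_cmul (sg x) (c x))" if x: "x \<in> C" for x
    proof -
      have "a \<notin> A x" if a: "a \<in> W x" for a
      proof -
        have "a \<in> topspace X"
          using WX [OF CX [OF x]] a by blast
        then show ?thesis
          using near [OF CX [OF x] a, of a] r [OF CX [OF x]] by simp
      qed
      then have "A x \<subseteq> topspace X - W x"
        using A CX x by blast
      then show ?thesis
        using singular_relcycle_mono [OF c [OF CX [OF x]]] singular_relcycle_cmul by blast
    qed
    show "rel_generator m X (topspace X - {a}) (frag_cmul (sg x) (c x))" if "x \<in> C" "a \<in> W x" for x a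
      using gen CX that sg_unit rel_generator_unit_cmul by blast
  qed (rule hom)
qed

theorem theorem1:
  fixes M :: "'a topology" and n :: nat
  assumes "n \<ge> 2"
    and "manifold_with_boundary (n - 1) M"
    and "\<not> orientable_mwb (n - 1) M"
    and "\<exists>K :: ('b::euclidean_space) set set. triangulates K M"
  shows "\<not> (\<exists>\<F>. uncountable \<F> \<and> disjoint \<F> \<and>
            (\<forall>S \<in> \<F>. S \<subseteq> topspace (Euclidean_space n) \<and>
                 subtopology (Euclidean_space n) S homeomorphic_space M))"
proof
  define m where "m = n - 1"
  have n: "n = Suc m" and m: "0 < m"
    using assms(1) by (simp_all add: m_def)
  let ?X = "subtopology M (manifold_interior m M)"
  assume "\<exists>\<F>. uncountable \<F> \<and> disjoint \<F> \<and>
            (\<forall>S \<in> \<F>. S \<subseteq> topspace (Euclidean_space n) \<and>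
                 subtopology (Euclidean_space n) S homeomorphic_space M)"
  then obtain \<F> where F: "uncountable \<F>" "disjoint \<F>"
    and homeo: "\<And>S. S \<in> \<F> \<Longrightarrow> subtopology (Euclidean_space n) S homeomorphic_space M"
    by blast
  have M: "Hausdorff_space M" "second_countable M"
    using assms(2) by (auto simp: manifold_with_boundary_def)
  have "\<exists>f. homeomorphic_map M (subtopology (Euclidean_space n) S) f" if "S \<in> \<F>" for S
    using homeo [OF that] by (meson homeomorphic_space homeomorphic_space_sym)
  then obtain f where f: "\<And>S. S \<in> \<F> \<Longrightarrow> homeomorphic_map M (subtopology (Euclidean_space n) S) (f S)"
    by metis
  have fS: "f S x \<in> S" if "S \<in> \<F>" "x \<in> topspace M" for S x
    using homeomorphic_imp_surjective_map [OF f [OF that(1)]] that(2) by auto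
  have "orientable_manifold m ?X"
  proof (rule orientable_manifold_if_uncountably_many_embeddings [OF m _ _ _ F(1), of _ f])
    show "Hausdorff_space ?X" "second_countable ?X"
      using M by (simp_all add: Hausdorff_space_subtopology second_countable_subtopology)
    show "\<exists>h. chart m ?X h \<and> h (\<lambda>i. 0) = x" if "x \<in> topspace ?X" for x
      using manifold_interior_chart [of x m M] that by auto
    show "embedding_map ?X (Euclidean_space (Suc m)) (f S)" if "S \<in> \<F>" for S
    proof -
      have "embedding_map M (Euclidean_space n) (f S)"
        using f [OF that] by (simp add: embedding_map_in_subtopology flip: surjective_embedding_map)
      \<comment> \<open>The inclusion of the interior is an embedding, so the homeomorphisms of
        \<open>M\<close> restrict to embeddings of \<open>?X\<close>.\<close>
      moreover have "homeomorphic_map ?X ?X id"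
        by simp
      then have "embedding_map ?X ?X id"
        using surjective_embedding_map by blast
      then have "embedding_map ?X M id"
        by (simp add: embedding_map_in_subtopology)
      ultimately have "embedding_map ?X (Euclidean_space n) (f S \<circ> id)"
        by (intro embedding_map_compose)
      then show ?thesis
        by (simp add: n)
    qed
    show "f S x \<noteq> f S' y" if "S \<in> \<F>" "S' \<in> \<F>" "S \<noteq> S'" "x \<in> topspace ?X" "y \<in> topspace ?X" for S S' x y
      using disjointD [OF F(2) that(1-3)] fS [OF that(1), of x] fS [OF that(2), of y] that(4,5) by auto
  qed
  then show False
    using assms(3) by (simp add: orientable_mwb_def m_def)
qed

end
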